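(* There is an absolute constant $c>0$ such that for every $n$, every symmetric tiling body $D\subseteq\mathbb{R}^n$ of volume $1$ whose boundary is a piecewise smooth surface has surface area at least $c\cdot \frac{n}{\sqrt{\log n}}$.
   Context: A body $D\subseteq\mathbb{R}^n$ is a tiling body (of $\mathbb{R}^n$ with respect to $\mathbb{Z}^n$) if its translates $D+z$, $z\in\mathbb{Z}^n$, cover $\mathbb{R}^n$ and have pairwise disjoint interiors. A set $D\subseteq\mathbb{R}^n$ is symmetric if for every permutation $\pi\in S_n$ and every $x\in\mathbb{R}^n$, $x\in D$ if and only if $\pi(x)\in D$, where $\pi(x)$ permutes the coordinates of $x$. *)

theory Defs
  imports "HOL-Analysis.Analysis" "HOL-Combinatorics.Permutations"
    "Jordan_Normal_Form.Determinant"
begin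

text \<open>
  The absolute constant of the theorem is chosen before the dimension, so the dimension has to be
  a natural number and not a type.  We let \<open>\<real>\<^sup>n\<close> consist of the functions on
  \<open>{..<n}\<close> (extensional, that is, \<open>undefined\<close> outside of \<open>{..<n}\<close>), because then the library's
  product topology and product measure live on the same carrier.
\<close>

abbreviation eucl :: "nat \<Rightarrow> (nat \<Rightarrow> real) topology" where
  "eucl n \<equiv> product_topology (\<lambda>_. euclideanreal) {..<n}"

abbreviation eucl_lebesgue :: "nat \<Rightarrow> (nat \<Rightarrow> real) measure" where
  "eucl_lebesgue n \<equiv> PiM {..<n} (\<lambda>_. lborel)"

abbreviation int_lattice :: "nat \<Rightarrow> (nat \<Rightarrow> int) set" where
  "int_lattice n \<equiv> {..<n} \<rightarrow>\<^sub>E UNIV"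

definition translate :: "nat \<Rightarrow> (nat \<Rightarrow> int) \<Rightarrow> (nat \<Rightarrow> real) set \<Rightarrow> (nat \<Rightarrow> real) set" where
  "translate n z D = (\<lambda>x. \<lambda>i\<in>{..<n}. x i + real_of_int (z i)) ` D"

definition body :: "nat \<Rightarrow> (nat \<Rightarrow> real) set \<Rightarrow> bool" where
  "body n D \<longleftrightarrow> compactin (eucl n) D \<and> eucl n interior_of D \<noteq> {}"

definition tiling_body :: "nat \<Rightarrow> (nat \<Rightarrow> real) set \<Rightarrow> bool" where
  "tiling_body n D \<longleftrightarrow>
     body n D \<and>
     (\<Union>z\<in>int_lattice n. translate n z D) = topspace (eucl n) \<and>
     disjoint_family_on (\<lambda>z. eucl n interior_of translate n z D) (int_lattice n)"

text \<open>
  A permutation of \<open>{..<n}\<close> fixes all other indices, so \<open>x \<circ> \<pi>\<close> is again extensional.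
\<close>

definition symmetric_set :: "nat \<Rightarrow> (nat \<Rightarrow> real) set \<Rightarrow> bool" where
  "symmetric_set n D \<longleftrightarrow>
     (\<forall>\<pi>. \<pi> permutes {..<n} \<longrightarrow> (\<forall>x\<in>topspace (eucl n). x \<in> D \<longleftrightarrow> x \<circ> \<pi> \<in> D))"

text \<open>
  \<open>partial_deriv f j u\<close> is the partial derivative of \<open>f\<close> at \<open>u\<close> in the \<open>j\<close>-th coordinate.
\<close>

definition partial_deriv :: "((nat \<Rightarrow> real) \<Rightarrow> real) \<Rightarrow> nat \<Rightarrow> (nat \<Rightarrow> real) \<Rightarrow> real" where
  "partial_deriv f j u = deriv (\<lambda>t. f (u(j := t))) (u j)"

definition C1_on :: "nat \<Rightarrow> nat \<Rightarrow> (nat \<Rightarrow> real) set \<Rightarrow> ((nat \<Rightarrow> real) \<Rightarrow> (nat \<Rightarrow> real)) \<Rightarrow> bool" where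
  "C1_on m n U \<phi> \<longleftrightarrow>
     \<phi> ` U \<subseteq> topspace (eucl n) \<and>
     (\<forall>i<n. \<forall>j<m.
        (\<forall>u\<in>U. (\<lambda>t. \<phi> (u(j := t)) i) differentiable (at (u j))) \<and>
        continuous_map (subtopology (eucl m) U) euclideanreal (partial_deriv (\<lambda>u. \<phi> u i) j))"

text \<open>
  A parametrized piece of a hypersurface in \<open>\<real>\<^sup>n\<close>: a compact Jordan measurable parameter domain
  \<open>K\<close> in \<open>\<real>\<^sup>n\<^sup>-\<^sup>1\<close> (its frontier is a null set), and a map \<open>\<phi>\<close> that is continuously differentiable
  on a neighbourhood of \<open>K\<close> and is injective and immersive on the interior of \<open>K\<close>.  As usual for
  parametrizations (polar coordinates, say), \<open>\<phi>\<close> may degenerate on the frontier of \<open>K\<close>.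
\<close>

definition smooth_piece ::
  "nat \<Rightarrow> (nat \<Rightarrow> real) set \<Rightarrow> ((nat \<Rightarrow> real) \<Rightarrow> (nat \<Rightarrow> real)) \<Rightarrow> bool" where
  "smooth_piece n K \<phi> \<longleftrightarrow>
     compactin (eucl (n - 1)) K \<and>
     eucl (n - 1) frontier_of K \<in> null_sets (eucl_lebesgue (n - 1)) \<and>
     (\<exists>U. openin (eucl (n - 1)) U \<and> K \<subseteq> U \<and> C1_on (n - 1) n U \<phi>) \<and>
     inj_on \<phi> (eucl (n - 1) interior_of K) \<and>
     (\<forall>u\<in>eucl (n - 1) interior_of K. \<forall>c :: nat \<Rightarrow> real.
        (\<forall>i<n. (\<Sum>j<n - 1. c j * partial_deriv (\<lambda>u. \<phi> u i) j u) = 0) \<longrightarrow> (\<forall>j<n - 1. c j = 0))"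

definition gram_matrix ::
  "nat \<Rightarrow> ((nat \<Rightarrow> real) \<Rightarrow> (nat \<Rightarrow> real)) \<Rightarrow> (nat \<Rightarrow> real) \<Rightarrow> real mat" where
  "gram_matrix n \<phi> u = Matrix.mat (n - 1) (n - 1)
     (\<lambda>(j, k). \<Sum>i<n. partial_deriv (\<lambda>u. \<phi> u i) j u * partial_deriv (\<lambda>u. \<phi> u i) k u)"

definition piece_area ::
  "nat \<Rightarrow> (nat \<Rightarrow> real) set \<Rightarrow> ((nat \<Rightarrow> real) \<Rightarrow> (nat \<Rightarrow> real)) \<Rightarrow> real" where
  "piece_area n K \<phi> = (LINT u:K|eucl_lebesgue (n - 1). sqrt (Determinant.det (gram_matrix n \<phi> u)))"

text \<open>
  \<open>has_surface_area n S A\<close>: \<open>S\<close> is a piecewise smooth hypersurface in \<open>\<real>\<^sup>n\<close>, that is, a finite union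
  of smooth pieces that overlap at most along their edges, and its pieces have total area \<open>A\<close>.
  The value of \<open>A\<close> does not depend on the decomposition into pieces; stating it as a relation
  avoids a choice of decomposition.
\<close>

definition has_surface_area :: "nat \<Rightarrow> (nat \<Rightarrow> real) set \<Rightarrow> real \<Rightarrow> bool" where
  "has_surface_area n S A \<longleftrightarrow>
     (\<exists>(N :: nat) K \<phi>.
        (\<forall>p<N. smooth_piece n (K p) (\<phi> p)) \<and>
        disjoint_family_on (\<lambda>p. \<phi> p ` (eucl (n - 1) interior_of K p)) {..<N} \<and>
        S = (\<Union>p<N. \<phi> p ` K p) \<and>
        A = (\<Sum>p<N. piece_area n (K p) (\<phi> p)))"

end

theory Submission
  imports Defs
begin

text \<open>
  Swapping two coordinates that differ by a nonzero integer translates a point by a nonzero lattice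
  vector, so the interior of a symmetric tiling body contains no such point.  Fix \<open>x\<close> in the unit cube
  and lift it to \<open>y = x - z\<close> in \<open>D\<close>.  If the segment from \<open>x\<close> to \<open>x + v\<close> avoids the lattice translates
  of the boundary, then \<open>y + t v\<close> stays in the interior, and hence coordinates that collide modulo \<open>1\<close>
  on the way collide exactly.  Let each \<open>v\<^sub>i\<close> be independently \<open>\<plusminus> s\<close> with probability about \<open>1 / ln n\<close>
  each and \<open>0\<close> otherwise, where \<open>s\<close> is of order \<open>ln n / n\<close>.  For typical \<open>x\<close> every arc of the circle of
  length \<open>s / 2\<close> contains many coordinates, so with large probability some coordinate sweeps over any two
  given static ones in the next arc.  If most segments avoided the boundary, all coordinates could be
  matched in this way around the whole circle, which is impossible because they pick up a winding of \<open>1\<close>.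
  So a segment hits the boundary with probability bounded below.

  On the other hand, the volume of the set of \<open>x\<close> whose segment in direction \<open>v\<close> hits the boundary is at
  most the integral of \<open>\<bar>\<langle>\<nu>, v\<rangle>\<bar>\<close> over the boundary, where \<open>\<nu>\<close> is the unit normal, and the mean of
  \<open>\<bar>\<langle>\<nu>, v\<rangle>\<bar>\<close> is at most the standard deviation of a coordinate of \<open>v\<close>, which is of order
  \<open>sqrt (ln n) / n\<close>.
\<close>

section \<open>Measure and topology on extensional functions\<close>

text \<open>The square root comes from letting most coordinates rest. A union bound over all arcs
  makes each arc hold about ln n coordinates, so the step length is about ln n / n for any law of
  \<open>v\<close>; with a fixed proportion of moving coordinates the mean of |<nu, v>| could be of
  that order, and only n / ln n would result. One mover per arc suffices, so the moving proportion
  can be lowered to 2 / r with r about ln n, which divides the standard deviation by about sqrt r.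
  No single direction has to match all coordinates: the lift z is fixed before v, so each pair of
  coordinates may use its own direction. For one pair the failures (a hit, either coordinate not at
  rest, no upward mover in the arc) have total proportion below 1/2 + 1/8 + 1/8 + 1/4 = 1. For the
  swept volume an upper estimate is enough. It is the bound of the volume of f(K) by the integral of
  |det f'|, used for f(u, t) = phi(u) - t v, where |det f'| is |<v, c>| with c the cross product of
  the columns of phi'. The length of c is the area density, and Cauchy-Schwarz over the directions
  turns second moments into area.\<close>

lemma PiE_UNIV_eq_extensional: "PiE I (\<lambda>_. UNIV) = extensional I"
  by (auto simp: PiE_def)

lemma topspace_eucl: "topspace (eucl n) = extensional {..<n}"
  by (simp add: PiE_UNIV_eq_extensional)

lemma space_eucl_lebesgue: "space (eucl_lebesgue n) = extensional {..<n}"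
  by (simp add: space_PiM PiE_UNIV_eq_extensional)

text \<open>Open balls of the sup norm. They form a neighbourhood basis of \<open>eucl n\<close>, so
  topological hypotheses can be used as epsilon-delta estimates.\<close>

definition obox :: "nat \<Rightarrow> (nat \<Rightarrow> real) \<Rightarrow> real \<Rightarrow> (nat \<Rightarrow> real) set" where
  "obox n u d = PiE {..<n} (\<lambda>i. {u i - d<..<u i + d})"

lemma obox_iff: "x \<in> obox n u d \<longleftrightarrow> x \<in> extensional {..<n} \<and> (\<forall>i<n. \<bar>x i - u i\<bar> < d)"
  by (simp add: obox_def PiE_iff conj_commute Ball_def abs_less_iff) (smt (verit))

lemma obox_mono: "a \<le> b \<Longrightarrow> obox n x a \<subseteq> obox n x b"
  unfolding obox_def by (intro PiE_mono) auto

lemma openin_obox: "openin (eucl n) (obox n u d)"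
  unfolding obox_def by (subst openin_PiE_gen) auto

lemma openin_eucl_obox:
  assumes U: "openin (eucl n) U" and u: "u \<in> U"
  obtains d where "d > 0" "obox n u d \<subseteq> U"
proof -
  obtain W where W: "\<forall>i\<in>{..<n}. open (W i)" "u \<in> Pi\<^sub>E {..<n} W" "Pi\<^sub>E {..<n} W \<subseteq> U"
    using U u unfolding openin_product_topology_alt by (metis open_openin)
  have "\<forall>i\<in>{..<n}. \<exists>e>0. \<forall>y. \<bar>y - u i\<bar> < e \<longrightarrow> y \<in> W i"
    using W(1,2) by (fastforce simp: open_dist dist_real_def PiE_iff)
  then obtain e where e: "\<forall>i\<in>{..<n}. e i > 0 \<and> (\<forall>y. \<bar>y - u i\<bar> < e i \<longrightarrow> y \<in> W i)"
    by metis
  define d where "d = Min (insert 1 (e ` {..<n}))"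
  have d: "d \<le> e i" if "i < n" for i
    unfolding d_def using that by (intro Min_le) auto
  show ?thesis
  proof
    show "d > 0" unfolding d_def using e by (subst Min_gr_iff) auto
    show "obox n u d \<subseteq> U"
    proof
      fix x assume x: "x \<in> obox n u d"
      have "x i \<in> W i" if "i < n" for i
      proof -
        have "\<bar>x i - u i\<bar> < e i" using x d[OF that] that unfolding obox_iff by fastforce
        then show ?thesis using e that by blast
      qed
      then have "x \<in> Pi\<^sub>E {..<n} W" using x unfolding obox_iff PiE_iff by blast
      then show "x \<in> U" using W(3) by blast
    qed
  qed
qed

lemma openin_euclI:
  assumes "U \<subseteq> extensional {..<n}" "\<And>u. u \<in> U \<Longrightarrow> \<exists>d>0. obox n u d \<subseteq> U"
  shows "openin (eucl n) U"
proof (subst openin_subopen, intro ballI)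
  fix u assume u: "u \<in> U"
  obtain d where "d > 0" "obox n u d \<subseteq> U" using assms(2)[OF u] by blast
  then show "\<exists>T. openin (eucl n) T \<and> u \<in> T \<and> T \<subseteq> U"
    using openin_obox[of n u d] assms(1) u by (intro exI[of _ "obox n u d"]) (auto simp: obox_iff)
qed

text \<open>On the full countable product over \<open>nat\<close> the Borel sets are the product
  sigma-algebra. \<open>U\<close> is carried there by pulling back along restriction and brought
  back along \<open>h\<close>, extension by zero.\<close>

lemma sets_openin_eucl:
  assumes U: "openin (eucl n) U"
  shows "U \<in> sets (eucl_lebesgue n)"
proof -
  define h :: "(nat \<Rightarrow> real) \<Rightarrow> nat \<Rightarrow> real" where "h = (\<lambda>x i. if i < n then x i else 0)"
  have sub: "U \<subseteq> extensional {..<n}"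
    using openin_subset[OF U] by (simp only: topspace_eucl)
  have 1: "continuous_map (product_topology (\<lambda>_. euclideanreal) UNIV) (eucl n) (\<lambda>x. restrict x {..<n})"
    by (intro continuous_map_componentwise[THEN iffD2] conjI ballI)
      (auto intro: continuous_map_product_projection)
  have "openin (product_topology (\<lambda>_::nat. euclideanreal) UNIV) {x. restrict x {..<n} \<in> U}"
    using openin_continuous_map_preimage[OF 1 U] by simp
  then have "open {x::nat \<Rightarrow> real. restrict x {..<n} \<in> U}"
    by (simp add: open_fun_def)
  then have 2: "{x::nat \<Rightarrow> real. restrict x {..<n} \<in> U} \<in> sets (PiM UNIV (\<lambda>_. borel))"
    by (simp add: sets_PiM_equal_borel)
  have "h \<in> measurable (eucl_lebesgue n) (PiM UNIV (\<lambda>_. borel))"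
    unfolding h_def
  proof (rule measurable_PiM_single')
    fix i show "(\<lambda>x. if i < n then x i else 0) \<in> borel_measurable (eucl_lebesgue n)"
      by (cases "i < n") auto
  qed auto
  from measurable_sets[OF this 2]
  have "h -` {x. restrict x {..<n} \<in> U} \<inter> extensional {..<n} \<in> sets (eucl_lebesgue n)"
    by (simp add: space_eucl_lebesgue)
  also have "h -` {x. restrict x {..<n} \<in> U} \<inter> extensional {..<n} = U"
  proof -
    have "restrict (h x) {..<n} = x" if "x \<in> extensional {..<n}" for x
      using that by (auto simp: h_def restrict_def extensional_def fun_eq_iff)
    with sub show ?thesis by auto
  qed
  finally show ?thesis .
qed

lemma sets_closedin_eucl:
  assumes "closedin (eucl n) C"
  shows "C \<in> sets (eucl_lebesgue n)"
proof -
  have sub: "C \<subseteq> extensional {..<n}" and op: "openin (eucl n) (extensional {..<n} - C)"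
    using assms unfolding closedin_def by (auto simp only: topspace_eucl)
  have "space (eucl_lebesgue n) - (extensional {..<n} - C) \<in> sets (eucl_lebesgue n)"
    using sets_openin_eucl[OF op] by (rule sets.compl_sets)
  then show ?thesis using sub by (simp add: space_eucl_lebesgue double_diff)
qed

lemma Hausdorff_eucl: "Hausdorff_space (eucl n)"
  by (simp add: Hausdorff_space_product_topology)

lemma compactin_eucl_closedin: "compactin (eucl n) C \<Longrightarrow> closedin (eucl n) C"
  using compactin_imp_closedin[OF Hausdorff_eucl] .

lemma compactin_eucl_sets: "compactin (eucl n) C \<Longrightarrow> C \<in> sets (eucl_lebesgue n)"
  by (intro sets_closedin_eucl compactin_eucl_closedin)

lemma compactin_eucl_extensional: "compactin (eucl n) C \<Longrightarrow> C \<subseteq> extensional {..<n}"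
  using compactin_subset_topspace[of "eucl n" C] by (simp only: topspace_eucl)

lemma compactin_eucl_separation:
  assumes K: "compactin (eucl n) K" and u: "u \<in> extensional {..<n}" "u \<notin> K"
  obtains d where "d > 0" "obox n u d \<inter> K = {}"
proof -
  have "openin (eucl n) (extensional {..<n} - K)"
    using compactin_eucl_closedin[OF K] unfolding closedin_def by (simp only: topspace_eucl)
  moreover have "u \<in> extensional {..<n} - K" using u by blast
  ultimately obtain d where "d > 0" "obox n u d \<subseteq> extensional {..<n} - K"
    by (rule openin_eucl_obox)
  then show ?thesis using that by blast
qed

section \<open>Boxes, slices and translations under the product measure\<close>

interpretation lb: product_sigma_finite "\<lambda>_::nat. lborel :: real measure" ..

abbreviation vol :: "nat \<Rightarrow> (nat \<Rightarrow> real) set \<Rightarrow> ennreal" where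
  "vol n \<equiv> emeasure (eucl_lebesgue n)"

lemma emeasure_eucl_PiE:
  "(\<And>i. i < n \<Longrightarrow> X i \<in> sets borel) \<Longrightarrow>
    vol n (PiE {..<n} X) = (\<Prod>i<n. emeasure lborel (X i))"
  by (subst lb.emeasure_PiM) auto

lemma emeasure_eucl_slices:
  assumes "S \<in> sets (eucl_lebesgue n)" "k < n"
  shows "vol n S =
    (\<integral>\<^sup>+x. emeasure lborel {t. x(k := t) \<in> S} \<partial>PiM ({..<n} - {k}) (\<lambda>_. lborel))"
proof -
  have eq: "{..<n} = insert k ({..<n} - {k})" using assms(2) by auto
  have S: "S \<in> sets (PiM (insert k ({..<n} - {k})) (\<lambda>_. lborel))"
    using assms(1) eq by simp
  have "vol n S = (\<integral>\<^sup>+x. indicator S x \<partial>eucl_lebesgue n)"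
    using assms(1) by simp
  also have "\<dots> = (\<integral>\<^sup>+x. indicator S x \<partial>PiM (insert k ({..<n} - {k})) (\<lambda>_. lborel))"
    by (subst eq) simp
  also have "\<dots> = (\<integral>\<^sup>+x. (\<integral>\<^sup>+t. indicator S (x(k := t)) \<partial>lborel) \<partial>PiM ({..<n} - {k}) (\<lambda>_. lborel))"
    by (rule lb.product_nn_integral_insert) (use S in auto)
  also have "\<dots> = (\<integral>\<^sup>+x. emeasure lborel {t. x(k := t) \<in> S} \<partial>PiM ({..<n} - {k}) (\<lambda>_. lborel))"
  proof (rule nn_integral_cong)
    fix x assume x: "x \<in> space (PiM ({..<n} - {k}) (\<lambda>_. lborel :: real measure))"
    have m: "(\<lambda>t. x(k := t)) \<in> measurable lborel (PiM (insert k ({..<n} - {k})) (\<lambda>_. lborel))"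
      using x by (intro measurable_fun_upd[where J = "{..<n} - {k}"]) auto
    have "{t. x(k := t) \<in> S} \<in> sets lborel"
      using measurable_sets[OF m S] by (simp add: vimage_def)
    then have "emeasure lborel {t. x(k := t) \<in> S} = (\<integral>\<^sup>+t. indicator {t. x(k := t) \<in> S} t \<partial>lborel)"
      by simp
    then show "(\<integral>\<^sup>+t. indicator S (x(k := t)) \<partial>lborel) = emeasure lborel {t. x(k := t) \<in> S}"
      by (simp add: indicator_def)
  qed
  finally show ?thesis .
qed

text \<open>The product measure is determined by its values on boxes, and each factor is translation
  invariant. The image under a translation is treated as the preimage under the inverse translation
  \<open>?T\<close>.\<close>

lemma emeasure_eucl_translate:
  assumes "S \<in> sets (eucl_lebesgue n)"
  shows "vol n ((\<lambda>x. \<lambda>i\<in>{..<n}. x i + a i) ` S) = vol n S"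
    and "(\<lambda>x. \<lambda>i\<in>{..<n}. x i + a i) ` S \<in> sets (eucl_lebesgue n)"
proof -
  let ?T = "\<lambda>x. \<lambda>i\<in>{..<n}. x i - a i"
  have m: "?T \<in> measurable (eucl_lebesgue n) (eucl_lebesgue n)"
    by (rule measurable_restrict) auto
  have "distr (eucl_lebesgue n) (eucl_lebesgue n) ?T = eucl_lebesgue n"
  proof (rule lb.PiM_eqI)
    fix X :: "nat \<Rightarrow> real set" assume X: "\<And>i. i \<in> {..<n} \<Longrightarrow> X i \<in> sets lborel"
    have "emeasure (distr (eucl_lebesgue n) (eucl_lebesgue n) ?T) (PiE {..<n} X) =
      vol n (?T -` PiE {..<n} X \<inter> space (eucl_lebesgue n))"
      by (rule emeasure_distr[OF m]) (use X in \<open>auto intro: sets_PiM_I_finite\<close>)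
    also have "?T -` PiE {..<n} X \<inter> space (eucl_lebesgue n) = PiE {..<n} (\<lambda>i. (\<lambda>t. t - a i) -` X i)"
      unfolding space_eucl_lebesgue by (intro Set.set_eqI) (simp add: PiE_iff conj_commute)
    also have "vol n \<dots> = (\<Prod>i<n. emeasure lborel ((\<lambda>t. t - a i) -` X i))"
    proof (rule emeasure_eucl_PiE)
      fix i assume "i < n"
      then have "(\<lambda>t. t - a i) -` X i \<inter> space borel \<in> sets borel"
        using X[of i] by (intro measurable_sets[of _ borel borel]) auto
      then show "(\<lambda>t. t - a i) -` X i \<in> sets borel" by simp
    qed
    also have "\<dots> = (\<Prod>i\<in>{..<n}. emeasure lborel (X i))"
    proof (rule prod.cong)
      fix i assume "i \<in> {..<n}"
      then have "emeasure lborel (X i) = emeasure (distr lborel borel (\<lambda>t. - a i + t)) (X i)"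
        by (subst lborel_distr_plus) simp
      also have "\<dots> = emeasure lborel ((\<lambda>t. - a i + t) -` X i \<inter> space lborel)"
        by (rule emeasure_distr) (use X \<open>i \<in> {..<n}\<close> in auto)
      finally show "emeasure lborel ((\<lambda>t. t - a i) -` X i) = emeasure lborel (X i)"
        by simp
    qed simp
    finally show "emeasure (distr (eucl_lebesgue n) (eucl_lebesgue n) ?T) (PiE {..<n} X) =
      (\<Prod>i\<in>{..<n}. emeasure lborel (X i))" .
  qed auto
  then have "vol n S = vol n (?T -` S \<inter> space (eucl_lebesgue n))"
    using emeasure_distr[OF m assms] by simp
  moreover have "?T -` S \<inter> space (eucl_lebesgue n) = (\<lambda>x. \<lambda>i\<in>{..<n}. x i + a i) ` S"
  proof (intro Set.set_eqI iffI)
    fix x assume x: "x \<in> ?T -` S \<inter> space (eucl_lebesgue n)"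
    then have "x = (\<lambda>i\<in>{..<n}. ?T x i + a i)"
      by (auto simp: space_eucl_lebesgue extensional_def restrict_def fun_eq_iff)
    then show "x \<in> (\<lambda>x. \<lambda>i\<in>{..<n}. x i + a i) ` S" using x by blast
  next
    fix x assume "x \<in> (\<lambda>x. \<lambda>i\<in>{..<n}. x i + a i) ` S"
    then obtain y where y: "y \<in> S" "x = (\<lambda>i\<in>{..<n}. y i + a i)" by blast
    have "y \<in> extensional {..<n}"
      using sets.sets_into_space[OF assms] y(1) by (auto simp: space_eucl_lebesgue)
    then have "?T x = y" using y(2) by (auto simp: extensional_def restrict_def fun_eq_iff)
    then show "x \<in> ?T -` S \<inter> space (eucl_lebesgue n)"
      using y by (auto simp: space_eucl_lebesgue)
  qed
  ultimately show "vol n ((\<lambda>x. \<lambda>i\<in>{..<n}. x i + a i) ` S) = vol n S"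
    and "(\<lambda>x. \<lambda>i\<in>{..<n}. x i + a i) ` S \<in> sets (eucl_lebesgue n)"
    using measurable_sets[OF m assms] by simp_all
qed

section \<open>Volumes of linear images\<close>

definition lin :: "nat \<Rightarrow> real Matrix.mat \<Rightarrow> (nat \<Rightarrow> real) \<Rightarrow> nat \<Rightarrow> real" where
  "lin n M x = (\<lambda>i\<in>{..<n}. \<Sum>j<n. M $$ (i, j) * x j)"

text \<open>As a map it changes only coordinate \<open>k\<close>, so volumes can be compared slice
  by slice along that coordinate. The family contains shears, scalings and, for
  \<open>a k = 0\<close>, projections.\<close>

definition rowmat :: "nat \<Rightarrow> nat \<Rightarrow> (nat \<Rightarrow> real) \<Rightarrow> real Matrix.mat" where
  "rowmat n k a = Matrix.mat n n (\<lambda>(i, j). if i = k then a j else if i = j then 1 else 0)"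

lemma rowmat_carrier [simp]: "rowmat n k a \<in> carrier_mat n n"
  by (simp add: rowmat_def)

lemma index_mult_mat_sum:
  fixes A B :: "'a :: comm_ring_1 Matrix.mat"
  assumes "A \<in> carrier_mat n n" "B \<in> carrier_mat n n" "i < n" "j < n"
  shows "(A * B) $$ (i, j) = (\<Sum>k<n. A $$ (i, k) * B $$ (k, j))"
  using assms by (simp add: scalar_prod_def atLeast0LessThan)

lemma lin_extensional: "lin n M x \<in> extensional {..<n}"
  by (simp add: lin_def)

lemma lin_apply: "i < n \<Longrightarrow> lin n M x i = (\<Sum>j<n. M $$ (i, j) * x j)"
  by (simp add: lin_def)

lemma lin_mult:
  assumes "A \<in> carrier_mat n n" "B \<in> carrier_mat n n"
  shows "lin n (A * B) x = lin n A (lin n B x)"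
proof (rule extensionalityI[OF lin_extensional lin_extensional])
  fix i assume i: "i \<in> {..<n}"
  have "lin n (A * B) x i = (\<Sum>j<n. (\<Sum>k<n. A $$ (i, k) * B $$ (k, j)) * x j)"
    using i assms unfolding lin_def by (simp add: index_mult_mat_sum del: index_mult_mat)
  also have "\<dots> = (\<Sum>k<n. A $$ (i, k) * (\<Sum>j<n. B $$ (k, j) * x j))"
    unfolding sum_distrib_left sum_distrib_right by (subst sum.swap) (simp add: mult.assoc)
  also have "\<dots> = lin n A (lin n B x) i" using i by (simp add: lin_def)
  finally show "lin n (A * B) x i = lin n A (lin n B x) i" .
qed

lemma lin_one: "x \<in> extensional {..<n} \<Longrightarrow> lin n (1\<^sub>m n) x = x"
  by (intro extensionalityI[OF lin_extensional])
    (auto simp: lin_def one_mat_def if_distrib[of "\<lambda>a. a * _"] cong: if_cong)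

lemma continuous_map_lin: "continuous_map (eucl n) (eucl n) (lin n M)"
  unfolding lin_def
  by (intro continuous_map_componentwise[THEN iffD2] conjI ballI)
    (auto intro!: continuous_map_sum continuous_map_real_mult continuous_map_product_projection)

lemma compactin_lin: "compactin (eucl n) S \<Longrightarrow> compactin (eucl n) (lin n M ` S)"
  by (rule image_compactin[OF _ continuous_map_lin])

lemma det_rowmat:
  assumes k: "k < n"
  shows "Determinant.det (rowmat n k a) = a k"
proof -
  have cof: "cofactor (rowmat n k a) k j = cofactor (1\<^sub>m n) k j" if "j < n" for j
  proof -
    have "mat_delete (rowmat n k a) k j = mat_delete (1\<^sub>m n) k j"
      unfolding mat_delete_def using that k by (intro eq_matI) (auto simp: rowmat_def)
    then show ?thesis by (simp add: cofactor_def)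
  qed
  \<comment> \<open>The identity is its own adjugate, which yields all its cofactors without
    evaluating minors.\<close>
  have adj: "adj_mat (1\<^sub>m n) = (1\<^sub>m n :: real Matrix.mat)"
    using adj_mat(1,3)[of "1\<^sub>m n :: real Matrix.mat" n] by (auto intro!: eq_matI)
  have "cofactor (1\<^sub>m n) k j = (if j = k then 1 else 0 :: real)" if "j < n" for j
  proof -
    have "adj_mat (1\<^sub>m n :: real Matrix.mat) $$ (j, k) = cofactor (1\<^sub>m n) k j"
      unfolding adj_mat_def using that k by simp
    then show ?thesis using that k unfolding adj by simp
  qed
  note one = this
  have "Determinant.det (rowmat n k a) =
      (\<Sum>j<n. rowmat n k a $$ (k, j) * cofactor (rowmat n k a) k j)"
    using k by (intro laplace_expansion_row) auto
  also have "\<dots> = (\<Sum>j<n. a j * (if j = k then 1 else 0))"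
  proof (rule sum.cong)
    fix j assume "j \<in> {..<n}"
    then have j: "j < n" by simp
    show "rowmat n k a $$ (k, j) * cofactor (rowmat n k a) k j = a j * (if j = k then 1 else 0)"
      unfolding cof[OF j] one[OF j] using j k by (simp add: rowmat_def)
  qed simp
  also have "\<dots> = a k"
    using k by (simp add: if_distrib[of "\<lambda>t. _ * t"] cong: if_cong)
  finally show ?thesis .
qed

lemma emeasure_lborel_affine_image_le:
  fixes X :: "real set"
  assumes X: "X \<in> sets borel"
  assumes Y: "Y \<subseteq> (\<lambda>t. a * t + c) ` X"
  shows "emeasure lborel Y \<le> ennreal \<bar>a\<bar> * emeasure lborel X"
proof (cases "a = 0")
  case True
  have "emeasure lborel Y \<le> emeasure lborel {c}"
    using Y True by (intro emeasure_mono) auto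
  then show ?thesis by simp
next
  case False
  have eq: "(\<lambda>t. a * t + c) ` X = (\<lambda>t. (t - c) / a) -` X"
  proof (intro Set.set_eqI iffI)
    fix t assume "t \<in> (\<lambda>t. (t - c) / a) -` X"
    moreover have "t = a * ((t - c) / a) + c" using False by simp
    ultimately show "t \<in> (\<lambda>t. a * t + c) ` X" by blast
  qed (use False in auto)
  have m: "(\<lambda>t. (t - c) / a) -` X \<in> sets borel"
    using measurable_sets[of "\<lambda>t. (t - c) / a" borel borel X] X by simp
  have "emeasure lborel Y \<le> emeasure lborel ((\<lambda>t. (t - c) / a) -` X)"
    using Y eq m by (intro emeasure_mono) auto
  also have "\<dots> = (\<integral>\<^sup>+t. indicator ((\<lambda>t. (t - c) / a) -` X) t \<partial>lborel)"
    using m by simp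
  also have "\<dots> = ennreal \<bar>a\<bar> * (\<integral>\<^sup>+t. indicator ((\<lambda>t. (t - c) / a) -` X) (c + a * t) \<partial>lborel)"
    using m False by (intro nn_integral_real_affine) auto
  also have "(\<integral>\<^sup>+t. indicator ((\<lambda>t. (t - c) / a) -` X) (c + a * t) \<partial>lborel) = (\<integral>\<^sup>+t. indicator X t \<partial>lborel)"
    using False by (intro nn_integral_cong) (simp add: indicator_def)
  finally show ?thesis using X by simp
qed

lemma sets_slice_eucl:
  assumes S: "S \<in> sets (eucl_lebesgue n)" and k: "k < n" and x: "x \<in> extensional ({..<n} - {k})"
  shows "{t. x(k := t) \<in> S} \<in> sets borel"
proof -
  have eq: "insert k ({..<n} - {k}) = {..<n}" using k by auto
  have "(\<lambda>t. x(k := t)) \<in> measurable lborel (PiM (insert k ({..<n} - {k})) (\<lambda>_. lborel))"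
    using x by (intro measurable_fun_upd[where J = "{..<n} - {k}"])
      (auto simp: space_PiM PiE_UNIV_eq_extensional)
  from measurable_sets[OF this, of S] S show ?thesis
    unfolding eq by (simp add: vimage_def)
qed

text \<open>On a line parallel to axis \<open>k\<close> the map acts as \<open>t\<close> to
  \<open>a k * t + c\<close>, with \<open>c\<close> determined by the other coordinates. Integrating
  this one-dimensional bound over the slices gives the claim, also for
  \<open>a k = 0\<close>.\<close>

lemma emeasure_rowmat_image_le:
  assumes k: "k < n" and S: "compactin (eucl n) S"
  shows "vol n (lin n (rowmat n k a) ` S) \<le> ennreal \<bar>a k\<bar> * vol n S"
proof -
  define T where "T = lin n (rowmat n k a) ` S"
  have T: "T \<in> sets (eucl_lebesgue n)"
    unfolding T_def by (intro compactin_eucl_sets compactin_lin S)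
  note Sm = compactin_eucl_sets[OF S]
  have eq: "{..<n} = insert k ({..<n} - {k})" using k by auto
  have "vol n T =
      (\<integral>\<^sup>+x. emeasure lborel {t. x(k := t) \<in> T} \<partial>PiM ({..<n} - {k}) (\<lambda>_. lborel))"
    by (rule emeasure_eucl_slices[OF T k])
  also have "\<dots> \<le> (\<integral>\<^sup>+x. ennreal \<bar>a k\<bar> * emeasure lborel {t. x(k := t) \<in> S} \<partial>PiM ({..<n} - {k}) (\<lambda>_. lborel))"
  proof (rule nn_integral_mono)
    fix x assume "x \<in> space (PiM ({..<n} - {k}) (\<lambda>_. lborel :: real measure))"
    then have x: "x \<in> extensional ({..<n} - {k})" by (simp add: space_PiM PiE_UNIV_eq_extensional)
    define c where "c = (\<Sum>j\<in>{..<n} - {k}. a j * x j)"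
    have "{t. x(k := t) \<in> T} \<subseteq> (\<lambda>t. a k * t + c) ` {t. x(k := t) \<in> S}"
    proof
      fix t assume "t \<in> {t. x(k := t) \<in> T}"
      then obtain y where y: "y \<in> S" "x(k := t) = lin n (rowmat n k a) y"
        unfolding T_def by blast
      have ye: "y \<in> extensional {..<n}" using y(1) compactin_eucl_extensional[OF S] by blast
      have yi: "y i = x i" if "i \<noteq> k" for i
      proof (cases "i < n")
        case True
        have "x i = lin n (rowmat n k a) y i" using y(2) that by (metis fun_upd_other)
        also have "\<dots> = (\<Sum>j<n. (if i = j then 1 else 0) * y j)"
          using True that by (simp add: lin_def rowmat_def)
        also have "\<dots> = y i" using True by (simp add: if_distrib[of "\<lambda>a. a * _"] cong: if_cong)
        finally show ?thesis by simp
      next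
        case False
        then show ?thesis using x ye by (simp add: extensional_def)
      qed
      have "t = lin n (rowmat n k a) y k" using y(2) by (metis fun_upd_same)
      also have "\<dots> = (\<Sum>j<n. a j * y j)" using k by (simp add: lin_def rowmat_def)
      also have "\<dots> = a k * y k + (\<Sum>j\<in>{..<n} - {k}. a j * y j)"
        using k by (simp add: sum.remove)
      also have "(\<Sum>j\<in>{..<n} - {k}. a j * y j) = c"
        unfolding c_def using yi by (intro sum.cong) auto
      finally have t: "t = a k * y k + c" .
      have "x(k := y k) = y" using yi by (auto simp: fun_eq_iff)
      then show "t \<in> (\<lambda>t. a k * t + c) ` {t. x(k := t) \<in> S}" using y(1) t by auto
    qed
    then show "emeasure lborel {t. x(k := t) \<in> T} \<le> ennreal \<bar>a k\<bar> * emeasure lborel {t. x(k := t) \<in> S}"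
      by (rule emeasure_lborel_affine_image_le[OF sets_slice_eucl[OF Sm k x]])
  qed
  also have "\<dots> = ennreal \<bar>a k\<bar> * (\<integral>\<^sup>+x. emeasure lborel {t. x(k := t) \<in> S} \<partial>PiM ({..<n} - {k}) (\<lambda>_. lborel))"
  proof (rule nn_integral_cmult)
    have m: "(\<lambda>p. (fst p)(k := snd p)) \<in> measurable (PiM ({..<n} - {k}) (\<lambda>_. lborel :: real measure) \<Otimes>\<^sub>M lborel) (PiM (insert k ({..<n} - {k})) (\<lambda>_. lborel))"
      by (intro measurable_fun_upd[where J = "{..<n} - {k}"]) auto
    have S': "S \<in> sets (PiM (insert k ({..<n} - {k})) (\<lambda>_. lborel))" using Sm eq by simp
    from measurable_sets[OF m this]
    have Q: "(\<lambda>p. (fst p)(k := snd p)) -` S \<inter> space (PiM ({..<n} - {k}) (\<lambda>_. lborel :: real measure) \<Otimes>\<^sub>M lborel)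
        \<in> sets (PiM ({..<n} - {k}) (\<lambda>_. lborel) \<Otimes>\<^sub>M lborel)" .
    have "(\<lambda>x. emeasure lborel (Pair x -` ((\<lambda>p. (fst p)(k := snd p)) -` S \<inter> space (PiM ({..<n} - {k}) (\<lambda>_. lborel :: real measure) \<Otimes>\<^sub>M lborel))))
      \<in> borel_measurable (PiM ({..<n} - {k}) (\<lambda>_. lborel))"
      by (rule lborel.measurable_emeasure_Pair[OF Q])
    moreover have "Pair x -` ((\<lambda>p. (fst p)(k := snd p)) -` S \<inter> space (PiM ({..<n} - {k}) (\<lambda>_. lborel :: real measure) \<Otimes>\<^sub>M lborel))
      = {t. x(k := t) \<in> S}" if "x \<in> space (PiM ({..<n} - {k}) (\<lambda>_. lborel :: real measure))" for x
      using that by (auto simp: space_pair_measure)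
    ultimately show "(\<lambda>x. emeasure lborel {t. x(k := t) \<in> S}) \<in> borel_measurable (PiM ({..<n} - {k}) (\<lambda>_. lborel))"
      by (simp cong: measurable_cong)
  qed
  also have "\<dots> = ennreal \<bar>a k\<bar> * vol n S"
    by (subst emeasure_eucl_slices[OF Sm k]) simp
  finally show ?thesis unfolding T_def .
qed

text \<open>Multiplication from the right is a column operation: column \<open>k\<close> is scaled
  by \<open>a k\<close>, and multiples of it are added to the other columns. This is how the
  elimination below uses \<open>rowmat\<close>.\<close>

lemma mult_rowmat_index:
  assumes A: "A \<in> carrier_mat n n" and k: "k < n" and ij: "i < n" "j < n"
  shows "(A * rowmat n k a) $$ (i, j) = A $$ (i, k) * a j + (if j = k then 0 else A $$ (i, j))"
proof -
  have "(A * rowmat n k a) $$ (i, j) = (\<Sum>l<n. A $$ (i, l) * (if l = k then a j else if l = j then 1 else 0))"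
    using index_mult_mat_sum[OF A rowmat_carrier ij] ij by (simp add: rowmat_def)
  also have "\<dots> = A $$ (i, k) * a j + (\<Sum>l\<in>{..<n} - {k}. A $$ (i, l) * (if l = k then a j else if l = j then 1 else 0))"
    using k by (simp add: sum.remove)
  also have "(\<Sum>l\<in>{..<n} - {k}. A $$ (i, l) * (if l = k then a j else if l = j then 1 else 0)) =
      (\<Sum>l\<in>{..<n} - {k}. if l = j then A $$ (i, l) else 0)"
    by (intro sum.cong) auto
  also have "\<dots> = (if j = k then 0 else A $$ (i, j))"
    using ij by (subst sum.delta) auto
  finally show ?thesis .
qed

text \<open>
  Working upwards from the last row, every square matrix is a product of matrices that differ from
  the identity in a single row, unless one of its rows depends on the rows below.
\<close>

lemma emeasure_lin_image_le:
  assumes M: "M \<in> carrier_mat n n" and S: "compactin (eucl n) S"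
  shows "vol n (lin n M ` S) \<le> ennreal \<bar>Determinant.det M\<bar> * vol n S"
proof -
  define P where "P M \<longleftrightarrow> (\<forall>S. compactin (eucl n) S \<longrightarrow>
    vol n (lin n M ` S) \<le> ennreal \<bar>Determinant.det M\<bar> * vol n S)" for M
  have PI: "P (A * B)" if "P A" "P B" and AB: "A \<in> carrier_mat n n" "B \<in> carrier_mat n n" for A B
    unfolding P_def
  proof (intro allI impI)
    fix S assume S: "compactin (eucl n) S"
    have "lin n (A * B) ` S = lin n A ` (lin n B ` S)"
      using lin_mult[OF AB] by (simp add: image_image)
    then have "vol n (lin n (A * B) ` S)
        \<le> ennreal \<bar>Determinant.det A\<bar> * vol n (lin n B ` S)"
      using \<open>P A\<close> compactin_lin[OF S] by (simp add: P_def)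
    also have "\<dots> \<le> ennreal \<bar>Determinant.det A\<bar> * (ennreal \<bar>Determinant.det B\<bar> * vol n S)"
      using \<open>P B\<close> S by (intro mult_left_mono) (auto simp: P_def)
    also have "\<dots> = ennreal \<bar>Determinant.det (A * B)\<bar> * vol n S"
      by (simp add: Determinant.det_mult[OF AB] abs_mult ennreal_mult mult.assoc)
    finally show "vol n (lin n (A * B) ` S) \<le>
      ennreal \<bar>Determinant.det (A * B)\<bar> * vol n S" .
  qed
  have PR: "P (rowmat n k a)" if "k < n" for k a
    unfolding P_def using emeasure_rowmat_image_le[OF that] det_rowmat[OF that] by auto
  \<comment> \<open>Here \<open>k\<close> counts the leading rows that are still arbitrary; from row
    \<open>k\<close> on, \<open>M\<close> agrees with the identity.\<close>
  have "P M" if "k \<le> n" "M \<in> carrier_mat n n"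
    "\<forall>i j. k \<le> i \<longrightarrow> i < n \<longrightarrow> j < n \<longrightarrow> M $$ (i, j) = (if i = j then 1 else 0)" for k M
    using that
  proof (induction k arbitrary: M)
    case 0
    then have M1: "M = 1\<^sub>m n" by (intro eq_matI) auto
    have "lin n M ` S = S" if "compactin (eucl n) S" for S
    proof -
      have "lin n M x = x" if "x \<in> S" for x
        using compactin_eucl_extensional[OF \<open>compactin (eucl n) S\<close>] that lin_one[of x n]
        unfolding M1 by blast
      then show ?thesis by simp
    qed
    then show ?case unfolding P_def by (simp add: M1)
  next
    case (Suc k)
    have k: "k < n" using Suc.prems(1) by simp
    have nonzero: "P M" if M: "M \<in> carrier_mat n n" and ne: "M $$ (k, k) \<noteq> 0"
      and id: "\<forall>i j. Suc k \<le> i \<longrightarrow> i < n \<longrightarrow> j < n \<longrightarrow> M $$ (i, j) = (if i = j then 1 else 0)" for M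
    proof -
      define a where "a j = M $$ (k, j)" for j
      \<comment> \<open>\<open>M'\<close> is \<open>M\<close> times the inverse of
        \<open>rowmat n k a\<close>: column operations with pivot \<open>a k\<close> turn row
        \<open>k\<close> into a unit row.\<close>
      define M' where "M' = Matrix.mat n n (\<lambda>(i, j). if j = k then M $$ (i, k) / a k
        else M $$ (i, j) - M $$ (i, k) * a j / a k)"
      have M': "M' \<in> carrier_mat n n" by (simp add: M'_def)
      have ak: "a k \<noteq> 0" using ne by (simp add: a_def)
      have "P M'"
      proof (rule Suc.IH[OF _ M'])
        show "\<forall>i j. k \<le> i \<longrightarrow> i < n \<longrightarrow> j < n \<longrightarrow> M' $$ (i, j) = (if i = j then 1 else 0)"
        proof (intro allI impI)
          fix i j assume ij: "k \<le> i" "i < n" "j < n"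
          show "M' $$ (i, j) = (if i = j then 1 else 0)"
          proof (cases "i = k")
            case True
            then show ?thesis using ij ak by (auto simp: M'_def a_def)
          next
            case False
            then show ?thesis using ij id k by (simp add: M'_def)
          qed
        qed
      qed (use k in simp)
      moreover have "M = M' * rowmat n k a"
      proof (rule eq_matI)
        fix i j assume "i < dim_row (M' * rowmat n k a)" "j < dim_col (M' * rowmat n k a)"
        then have ij: "i < n" "j < n" using M' by (auto simp: rowmat_def)
        show "M $$ (i, j) = (M' * rowmat n k a) $$ (i, j)"
          unfolding mult_rowmat_index[OF M' k ij] using ij k ak by (simp add: M'_def field_simps)
      qed (use M M' in \<open>auto simp: rowmat_def\<close>)
      ultimately show ?thesis using PI[OF _ PR[OF k] M' rowmat_carrier] by simp
    qed
    note M = Suc.prems(2) and id = Suc.prems(3)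
    show ?case
    proof (cases "M $$ (k, k) = 0")
      case False
      then show ?thesis using nonzero M id by blast
    next
      case True
      show ?thesis
      proof (cases "\<exists>j<k. M $$ (k, j) \<noteq> 0")
        case True
        then obtain j where j: "j < k" "M $$ (k, j) \<noteq> 0" by blast
        have jn: "j < n" using j k by simp
        \<comment> \<open>With \<open>b\<close>, column \<open>j\<close> is added to column
          \<open>k\<close> to create a nonzero pivot; \<open>c\<close> undoes this. Since
          \<open>j < k\<close>, the finished rows below are zero in column \<open>j\<close> and stay
          intact.\<close>
        define b c where "b l = (if l = j \<or> l = k then 1 else 0 :: real)"
          and "c l = (if l = j then 1 else if l = k then -1 else 0 :: real)" for l
        define M'' where "M'' = M * rowmat n j b"
        have M'': "M'' \<in> carrier_mat n n" using M unfolding M''_def by (metis mult_carrier_mat rowmat_carrier)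
        have idx: "M'' $$ (i, l) = (if l = k then M $$ (i, k) + M $$ (i, j) else M $$ (i, l))"
          if "i < n" "l < n" for i l
          unfolding M''_def mult_rowmat_index[OF M jn that] using j by (auto simp: b_def)
        have "P M''"
        proof (rule nonzero[OF M''])
          show "M'' $$ (k, k) \<noteq> 0" using idx k j \<open>M $$ (k, k) = 0\<close> by simp
          show "\<forall>i j. Suc k \<le> i \<longrightarrow> i < n \<longrightarrow> j < n \<longrightarrow> M'' $$ (i, j) = (if i = j then 1 else 0)"
            using idx id j jn k by auto
        qed
        moreover have "M = M'' * rowmat n j c"
        proof (rule eq_matI)
          fix i l assume "i < dim_row (M'' * rowmat n j c)" "l < dim_col (M'' * rowmat n j c)"
          then have ij: "i < n" "l < n" using M'' by (auto simp: rowmat_def)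
          show "M $$ (i, l) = (M'' * rowmat n j c) $$ (i, l)"
            unfolding mult_rowmat_index[OF M'' jn ij] using ij jn j by (auto simp: idx c_def)
        qed (use M M'' in \<open>auto simp: rowmat_def\<close>)
        ultimately show ?thesis using PI[OF _ PR[OF jn] M'' rowmat_carrier] by simp
      next
        case False
        define a where "a j = M $$ (k, j)" for j
        have a0: "a j = 0" if "j \<le> k" for j
          using that False True unfolding a_def by (cases "j = k") auto
        \<comment> \<open>Row \<open>k\<close> vanishes up to column \<open>k\<close>, and the rows
          below are unit rows, so coordinate \<open>k\<close> of the image is a combination of later
          coordinates. Hence \<open>rowmat n k a\<close> fixes the image, and as
          \<open>a k = 0\<close> the image is a null set.\<close>
        have fix_row: "lin n (rowmat n k a) (lin n M x) = lin n M x" for x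
        proof (rule extensionalityI[OF lin_extensional lin_extensional])
          fix i assume "i \<in> {..<n}"
          then have i: "i < n" by simp
          show "lin n (rowmat n k a) (lin n M x) i = lin n M x i"
          proof (cases "i = k")
            case False
            have "lin n (rowmat n k a) (lin n M x) i = (\<Sum>j<n. (if i = j then 1 else 0) * lin n M x j)"
              unfolding lin_apply[OF i, of "rowmat n k a"]
              using False i by (intro sum.cong) (auto simp: rowmat_def)
            then show ?thesis using i by (simp add: if_distrib[of "\<lambda>a. a * _"] cong: if_cong)
          next
            case True
            have "lin n (rowmat n k a) (lin n M x) k = (\<Sum>j<n. a j * lin n M x j)"
              unfolding lin_apply[OF k, of "rowmat n k a"]
              using k by (intro sum.cong) (auto simp: rowmat_def)
            also have "\<dots> = (\<Sum>j<n. a j * x j)"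
            proof (rule sum.cong)
              fix j assume "j \<in> {..<n}"
              then have j: "j < n" by simp
              show "a j * lin n M x j = a j * x j"
              proof (cases "j \<le> k")
                case False
                then have "lin n M x j = (\<Sum>l<n. (if j = l then 1 else 0) * x l)"
                  using id j by (simp add: lin_apply)
                then show ?thesis using j by (simp add: if_distrib[of "\<lambda>a. a * _"] cong: if_cong)
              qed (simp add: a0)
            qed simp
            also have "\<dots> = lin n M x k" using k by (simp add: lin_apply a_def)
            finally show ?thesis using True by simp
          qed
        qed
        show ?thesis unfolding P_def
        proof (intro allI impI)
          fix S assume S: "compactin (eucl n) S"
          have "lin n M ` S = lin n (rowmat n k a) ` (lin n M ` S)"
            using fix_row by (simp add: image_image)
          then have "vol n (lin n M ` S) \<le> ennreal \<bar>a k\<bar> * vol n (lin n M ` S)"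
            using emeasure_rowmat_image_le[OF k compactin_lin[OF S, of M], of a] by simp
          then show "vol n (lin n M ` S) \<le> ennreal \<bar>Determinant.det M\<bar> * vol n S"
            by (simp add: a0)
        qed
      qed
    qed
  qed
  from this[of n M] M S show ?thesis by (simp add: P_def)
qed

section \<open>Linear approximation of maps with continuous partial derivatives\<close>

lemma continuous_map_euclI:
  assumes "\<And>i. i < n \<Longrightarrow> continuous_map X euclideanreal (\<lambda>x. f x i)"
    and "\<And>x. x \<in> topspace X \<Longrightarrow> f x \<in> extensional {..<n}"
  shows "continuous_map X (eucl n) f"
  using assms by (intro continuous_map_componentwise[THEN iffD2] conjI ballI image_subsetI) auto

lemma continuous_map_eucl_coord: "i < n \<Longrightarrow> continuous_map (eucl n) euclideanreal (\<lambda>x. x i)"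
  by (rule continuous_map_product_projection) simp

lemma continuous_map_subtopology_eucl_iff:
  assumes U: "openin (eucl n) U"
  shows "continuous_map (subtopology (eucl n) U) euclideanreal g \<longleftrightarrow>
    (\<forall>u\<in>U. \<forall>e>0. \<exists>d>0. \<forall>v\<in>obox n u d \<inter> U. \<bar>g v - g u\<bar> < e)" (is "?L \<longleftrightarrow> ?R")
proof
  assume L: ?L
  show ?R
  proof (intro ballI allI impI)
    fix u and e :: real assume u: "u \<in> U" and e: "e > 0"
    have ts: "topspace (subtopology (eucl n) U) = U"
      using openin_subset[OF U] by (simp add: inf_absorb2)
    have "openin (subtopology (eucl n) U) {v \<in> topspace (subtopology (eucl n) U). g v \<in> ball (g u) e}"
      by (rule openin_continuous_map_preimage[OF L]) simp
    then have "openin (eucl n) {v \<in> U. g v \<in> ball (g u) e}"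
      unfolding ts using U by (simp add: openin_open_subtopology)
    moreover have "u \<in> {v \<in> U. g v \<in> ball (g u) e}" using u e by simp
    ultimately obtain d where "d > 0" "obox n u d \<subseteq> {v \<in> U. g v \<in> ball (g u) e}"
      by (rule openin_eucl_obox)
    then show "\<exists>d>0. \<forall>v\<in>obox n u d \<inter> U. \<bar>g v - g u\<bar> < e"
      by (intro exI[of _ d]) (auto simp: dist_real_def abs_minus_commute)
  qed
next
  assume R: ?R
  have Ue: "U \<subseteq> extensional {..<n}" using openin_subset[OF U] by (simp only: topspace_eucl)
  have ts: "topspace (subtopology (eucl n) U) = U"
    using openin_subset[OF U] by (simp add: inf_absorb2)
  show ?L
    unfolding continuous_map_def ts
  proof (intro conjI allI impI)
    fix S assume "openin euclideanreal S"
    then have S: "open S" by simp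
    have "openin (eucl n) {v \<in> U. g v \<in> S}"
    proof (rule openin_euclI)
      show "{v \<in> U. g v \<in> S} \<subseteq> extensional {..<n}" using Ue by blast
      fix u assume "u \<in> {v \<in> U. g v \<in> S}"
      then have u: "u \<in> U" "g u \<in> S" by auto
      obtain e where e: "e > 0" "\<And>y. \<bar>y - g u\<bar> < e \<Longrightarrow> y \<in> S"
        using S u(2) unfolding open_dist dist_real_def by blast
      obtain d1 where d1: "d1 > 0" "\<forall>v\<in>obox n u d1 \<inter> U. \<bar>g v - g u\<bar> < e" using R u(1) e(1) by blast
      obtain d2 where d2: "d2 > 0" "obox n u d2 \<subseteq> U" using openin_eucl_obox[OF U u(1)] .
      have "obox n u (min d1 d2) \<subseteq> obox n u d1 \<inter> obox n u d2" by (auto simp: obox_iff)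
      then have "obox n u (min d1 d2) \<subseteq> {v \<in> U. g v \<in> S}" using d1 d2 e by blast
      then show "\<exists>d>0. obox n u d \<subseteq> {v \<in> U. g v \<in> S}"
        using d1 d2 by (intro exI[of _ "min d1 d2"]) auto
    qed
    then show "openin (subtopology (eucl n) U) {v \<in> U. g v \<in> S}"
      using U by (simp add: openin_open_subtopology)
  qed simp
qed

lemma compactin_eucl_bounded:
  assumes "compactin (eucl n) C"
  obtains R where "R > 0" "C \<subseteq> PiE {..<n} (\<lambda>_. {-R..R})"
proof -
  have "\<exists>r. \<forall>x\<in>C. \<bar>x i\<bar> \<le> r" if "i < n" for i
  proof -
    have "compactin euclideanreal ((\<lambda>x. x i) ` C)"
      by (rule image_compactin[OF assms continuous_map_eucl_coord[OF that]])
    then have "bounded ((\<lambda>x. x i) ` C)" using compact_imp_bounded by auto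
    then show ?thesis unfolding bounded_iff by auto
  qed
  then obtain r where r: "\<And>i x. i < n \<Longrightarrow> x \<in> C \<Longrightarrow> \<bar>x i\<bar> \<le> r i" by metis
  define R where "R = 1 + (\<Sum>i<n. \<bar>r i\<bar>)"
  have R: "\<bar>x i\<bar> \<le> R" if "i < n" "x \<in> C" for i x
  proof -
    have "\<bar>r i\<bar> \<le> (\<Sum>i<n. \<bar>r i\<bar>)" using that by (intro member_le_sum) auto
    then show ?thesis using r[OF that] by (simp add: R_def)
  qed
  show ?thesis
  proof
    show "R > 0" unfolding R_def by (smt (verit) sum_nonneg abs_ge_zero)
    show "C \<subseteq> PiE {..<n} (\<lambda>_. {-R..R})"
    proof
      fix x assume x: "x \<in> C"
      have "x i \<in> {-R..R}" if "i < n" for i using R[OF that x] by (simp add: abs_le_iff)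
      then show "x \<in> PiE {..<n} (\<lambda>_. {-R..R})"
        using compactin_eucl_extensional[OF assms] x by (auto simp: PiE_iff)
    qed
  qed
qed

lemma emeasure_eucl_cbox:
  "a \<le> b \<Longrightarrow> vol n (PiE {..<n} (\<lambda>i. {c i + a..c i + b})) = ennreal ((b - a) ^ n)"
  by (subst emeasure_eucl_PiE) (auto simp: ennreal_power)

lemma emeasure_eucl_half_open_cube:
  "a \<le> b \<Longrightarrow> vol n (PiE {..<n} (\<lambda>i. {c i + a..<c i + b})) = ennreal ((b - a) ^ n)"
  by (subst emeasure_eucl_PiE) (auto simp: ennreal_power)

lemma emeasure_compactin_eucl_finite:
  assumes "compactin (eucl n) C"
  shows "vol n C < \<infinity>"
proof -
  obtain R where R: "R > 0" "C \<subseteq> PiE {..<n} (\<lambda>_. {-R..R})" using compactin_eucl_bounded[OF assms] .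
  have "vol n C \<le> vol n (PiE {..<n} (\<lambda>i. {0 + - R..0 + R}))"
    using R by (intro emeasure_mono sets_PiM_I_finite) auto
  also have "\<dots> < \<infinity>" using R by (subst emeasure_eucl_cbox) auto
  finally show ?thesis .
qed

text \<open>The closed sup-norm neighbourhood of radius \<open>e\<close> of the parallelepiped
  spanned by the columns of \<open>M\<close>. Rescaled images of small cubes under a differentiable
  map end up in such sets.\<close>

definition thick_image :: "nat \<Rightarrow> real Matrix.mat \<Rightarrow> real \<Rightarrow> (nat \<Rightarrow> real) set" where
  "thick_image n M e = {x \<in> extensional {..<n}.
    \<exists>u\<in>PiE {..<n} (\<lambda>_. {0..1}). \<forall>i<n. \<bar>x i - lin n M u i\<bar> \<le> e}"

lemma compactin_thick_image: "compactin (eucl n) (thick_image n M e)"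
proof -
  let ?C = "PiE {..<n} (\<lambda>_. {0..1::real}) \<times> PiE {..<n} (\<lambda>_. {-e..e})"
  let ?f = "\<lambda>p. \<lambda>i\<in>{..<n}. lin n M (fst p) i + snd p i"
  have "continuous_map (prod_topology (eucl n) (eucl n)) (eucl n) ?f"
  proof (rule continuous_map_euclI)
    fix i assume i: "i < n"
    have 1: "continuous_map (prod_topology (eucl n) (eucl n)) euclideanreal (\<lambda>p. lin n M (fst p) i)"
      using continuous_map_compose[OF continuous_map_compose[OF continuous_map_fst continuous_map_lin[of n M]]
          continuous_map_eucl_coord[OF i], of "eucl n"] by (simp add: o_def)
    have 2: "continuous_map (prod_topology (eucl n) (eucl n)) euclideanreal (\<lambda>p. snd p i)"
      using continuous_map_compose[OF continuous_map_snd continuous_map_eucl_coord[OF i], of "eucl n"]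
      by (simp add: o_def)
    show "continuous_map (prod_topology (eucl n) (eucl n)) euclideanreal (\<lambda>p. ?f p i)"
      using i by (simp add: continuous_map_add[OF 1 2])
  qed simp
  moreover have "compactin (prod_topology (eucl n) (eucl n)) ?C"
    by (simp add: compactin_Times compactin_PiE)
  ultimately have "compactin (eucl n) (?f ` ?C)" using image_compactin by blast
  moreover have "?f ` ?C = thick_image n M e"
  proof (intro equalityI subsetI)
    fix x assume "x \<in> ?f ` ?C"
    then obtain u w where uw: "u \<in> PiE {..<n} (\<lambda>_. {0..1::real})" "w \<in> PiE {..<n} (\<lambda>_. {-e..e})"
      "x = ?f (u, w)" by blast
    have *: "\<bar>x i - lin n M u i\<bar> \<le> e" if "i < n" for i
    proof -
      have "w i \<in> {-e..e}" using uw(2) that by blast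
      then show ?thesis using uw(3) that by (simp add: abs_le_iff)
    qed
    have "x \<in> extensional {..<n}" using uw(3) by simp
    with * show "x \<in> thick_image n M e" using uw(1) unfolding thick_image_def by blast
  next
    fix x assume "x \<in> thick_image n M e"
    then obtain u where xu: "x \<in> extensional {..<n}" "u \<in> PiE {..<n} (\<lambda>_. {0..1})"
      "\<And>i. i < n \<Longrightarrow> \<bar>x i - lin n M u i\<bar> \<le> e" unfolding thick_image_def by blast
    define w where "w = (\<lambda>i\<in>{..<n}. x i - lin n M u i)"
    have "w \<in> PiE {..<n} (\<lambda>_. {-e..e})"
      using xu(3) unfolding w_def by (simp add: PiE_iff abs_le_iff) (smt (verit) lessThan_iff)
    moreover have "x = ?f (u, w)"
      by (rule extensionalityI[OF xu(1)]) (auto simp: w_def)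
    ultimately show "x \<in> ?f ` ?C" using xu(2) by blast
  qed
  ultimately show ?thesis by simp
qed

text \<open>The parallelepiped is compact, hence closed, so it is the intersection of its closed
  neighbourhoods of radius \<open>1 / Suc k\<close>. Their volumes are finite and therefore converge
  to that of the parallelepiped, which \<open>emeasure_lin_image_le\<close> bounds by the
  determinant.\<close>

lemma emeasure_thick_image_less:
  assumes M: "M \<in> carrier_mat n n" and eta: "\<eta> > 0"
  obtains e where "e > 0" "vol n (thick_image n M e) \<le> ennreal (\<bar>Determinant.det M\<bar> + \<eta>)"
proof -
  let ?Q = "PiE {..<n} (\<lambda>_. {0..1::real})"
  define Z where "Z k = thick_image n M (1 / real (Suc k))" for k
  have Zc: "compactin (eucl n) (Z k)" for k unfolding Z_def by (rule compactin_thick_image)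
  have dec: "decseq Z"
    unfolding decseq_def
  proof (intro allI impI)
    fix k m :: nat assume "k \<le> m"
    then have "1 / real (Suc m) \<le> 1 / real (Suc k)" by (simp add: frac_le)
    then have "\<bar>t\<bar> \<le> 1 / real (Suc k)" if "\<bar>t\<bar> \<le> 1 / real (Suc m)" for t
      using that by linarith
    then show "Z m \<subseteq> Z k" unfolding Z_def thick_image_def by blast
  qed
  have lim: "(\<lambda>k. vol n (Z k)) \<longlonglongrightarrow> vol n (\<Inter>k. Z k)"
  proof (rule Lim_emeasure_decseq[OF _ dec])
    show "range Z \<subseteq> sets (eucl_lebesgue n)" using compactin_eucl_sets[OF Zc] by blast
    show "vol n (Z k) \<noteq> \<infinity>" for k
      using emeasure_compactin_eucl_finite[OF Zc, of k] by simp
  qed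
  have Qc: "compactin (eucl n) ?Q" by (simp add: compactin_PiE)
  have Tc: "compactin (eucl n) (lin n M ` ?Q)" by (rule compactin_lin[OF Qc])
  have "(\<Inter>k. Z k) \<subseteq> lin n M ` ?Q"
  proof
    fix x assume x: "x \<in> (\<Inter>k. Z k)"
    show "x \<in> lin n M ` ?Q"
    proof (rule ccontr)
      assume nx: "x \<notin> lin n M ` ?Q"
      have "x \<in> extensional {..<n}" using x unfolding Z_def thick_image_def by blast
      then obtain d where d: "d > 0" "obox n x d \<inter> lin n M ` ?Q = {}"
        using compactin_eucl_separation[OF Tc _ nx] by blast
      obtain k where k: "1 / real (Suc k) < d"
        using d(1) nat_approx_posE by blast
      have "x \<in> Z k" using x by blast
      then obtain u where u: "u \<in> ?Q" "\<And>i. i < n \<Longrightarrow> \<bar>x i - lin n M u i\<bar> \<le> 1 / real (Suc k)"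
        unfolding Z_def thick_image_def by blast
      have "lin n M u \<in> obox n x d"
        unfolding obox_iff
      proof (intro conjI allI impI lin_extensional)
        fix i assume "i < n"
        then show "\<bar>lin n M u i - x i\<bar> < d" using u(2)[of i] k by linarith
      qed
      then show False using d(2) u(1) by blast
    qed
  qed
  then have "vol n (\<Inter>k. Z k) \<le> vol n (lin n M ` ?Q)"
    by (rule emeasure_mono[OF _ compactin_eucl_sets[OF Tc]])
  also have "\<dots> \<le> ennreal \<bar>Determinant.det M\<bar> * vol n ?Q"
    by (rule emeasure_lin_image_le[OF M Qc])
  also have "vol n ?Q = 1"
    using emeasure_eucl_cbox[of 0 1 n "\<lambda>_. 0"] by simp
  also have "ennreal \<bar>Determinant.det M\<bar> * 1 < ennreal (\<bar>Determinant.det M\<bar> + \<eta>)"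
    using eta by (simp add: ennreal_lessI)
  finally have "\<forall>\<^sub>F k in sequentially. vol n (Z k) < ennreal (\<bar>Determinant.det M\<bar> + \<eta>)"
    using order_tendstoD(2)[OF lim] by blast
  then obtain k where "vol n (Z k) < ennreal (\<bar>Determinant.det M\<bar> + \<eta>)"
    by (auto simp: eventually_sequentially)
  then show ?thesis using that[of "1 / real (Suc k)"] unfolding Z_def by (simp add: less_imp_le)
qed

text \<open>The path from \<open>u0\<close> to \<open>u\<close> changes one coordinate at a time,
  \<open>w k\<close> being the point after \<open>k\<close> changes. Continuity of the partial
  derivatives makes each single step linear up to the factor \<open>e\<close>, and the steps
  telescope.\<close>

lemma partials_linear_approx:
  fixes g :: "(nat \<Rightarrow> real) \<Rightarrow> real"
  assumes U: "openin (eucl n) U"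
    and der: "\<And>u j. u \<in> U \<Longrightarrow> j < n \<Longrightarrow> ((\<lambda>t. g (u(j := t))) has_real_derivative g' j u) (at (u j))"
    and cont: "\<And>j. j < n \<Longrightarrow> continuous_map (subtopology (eucl n) U) euclideanreal (g' j)"
    and u0: "u0 \<in> U" and e: "e > 0"
  obtains d where "d > 0" "obox n u0 d \<subseteq> U"
    "\<And>u. u \<in> obox n u0 d \<Longrightarrow>
      \<bar>g u - g u0 - (\<Sum>j<n. g' j u0 * (u j - u0 j))\<bar> \<le> e * (\<Sum>j<n. \<bar>u j - u0 j\<bar>)"
proof -
  have "\<exists>d>0. \<forall>v\<in>obox n u0 d \<inter> U. \<bar>g' j v - g' j u0\<bar> < e" if "j < n" for j
    using cont[OF that] u0 e unfolding continuous_map_subtopology_eucl_iff[OF U] by blast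
  then obtain D where D: "\<And>j. j < n \<Longrightarrow> D j > 0"
    "\<And>j v. j < n \<Longrightarrow> v \<in> obox n u0 (D j) \<inter> U \<Longrightarrow> \<bar>g' j v - g' j u0\<bar> < e" by metis
  obtain d0 where d0: "d0 > 0" "obox n u0 d0 \<subseteq> U" using openin_eucl_obox[OF U u0] .
  define d where "d = Min (insert d0 (D ` {..<n}))"
  have dpos: "d > 0" unfolding d_def using d0 D by (subst Min_gr_iff) auto
  have dle: "d \<le> d0" "\<And>j. j < n \<Longrightarrow> d \<le> D j" unfolding d_def by (auto intro: Min_le)
  have dU: "obox n u0 d \<subseteq> U" using obox_mono[OF dle(1)] d0(2) by (rule order_trans)
  have g': "\<bar>g' j v - g' j u0\<bar> \<le> e" if "j < n" "v \<in> obox n u0 d" for j v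
  proof -
    have "v \<in> obox n u0 (D j)" using that(2) obox_mono[OF dle(2)[OF that(1)]] by (rule subsetD[rotated])
    then show ?thesis using D(2)[OF that(1)] that(2) dU by (meson IntI less_imp_le subsetD)
  qed
  have u0e: "u0 \<in> extensional {..<n}"
    using openin_subset[OF U] u0 by (simp only: topspace_eucl) blast
  show ?thesis
  proof (rule that[OF dpos dU])
    fix u assume u: "u \<in> obox n u0 d"
    define w where "w k = (\<lambda>i\<in>{..<n}. if i < k then u i else u0 i)" for k
    have step: "\<bar>(g (w (Suc k)) - g (w k)) - g' k u0 * (u k - u0 k)\<bar> \<le> e * \<bar>u k - u0 k\<bar>" if k: "k < n" for k
    proof -
      have inbox: "(w k)(k := t) \<in> obox n u0 d" if "t \<in> {u0 k - d<..<u0 k + d}" for t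
        using that u k dpos unfolding obox_iff w_def by (auto simp: abs_less_iff extensional_def)
      \<comment> \<open>The mean value bound is applied after subtracting the linear term, so the
        derivative is the difference of two values of \<open>g' k\<close>, at most
        \<open>e\<close>.\<close>
      have "norm ((\<lambda>t. g ((w k)(k := t)) - g' k u0 * t) (u k) - (\<lambda>t. g ((w k)(k := t)) - g' k u0 * t) (u0 k)) \<le> e * norm (u k - u0 k)"
      proof (rule field_differentiable_bound[where S = "{u0 k - d<..<u0 k + d}"])
        fix t assume t: "t \<in> {u0 k - d<..<u0 k + d}"
        have "((\<lambda>s. g (((w k)(k := t))(k := s))) has_real_derivative g' k ((w k)(k := t))) (at (((w k)(k := t)) k))"
          by (rule der) (use inbox[OF t] dU k in auto)
        then have "((\<lambda>s. g ((w k)(k := s))) has_real_derivative g' k ((w k)(k := t))) (at t)"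
          by simp
        then have "((\<lambda>s. g ((w k)(k := s)) - g' k u0 * s) has_real_derivative g' k ((w k)(k := t)) - g' k u0) (at t)"
          by (auto intro!: derivative_eq_intros)
        then show "((\<lambda>s. g ((w k)(k := s)) - g' k u0 * s) has_real_derivative g' k ((w k)(k := t)) - g' k u0) (at t within {u0 k - d<..<u0 k + d})"
          by (rule has_field_derivative_at_within)
        show "norm (g' k ((w k)(k := t)) - g' k u0) \<le> e"
          using g'[OF k inbox[OF t]] by simp
      next
        show "u k \<in> {u0 k - d<..<u0 k + d}" using u k unfolding obox_iff by (auto simp: abs_less_iff)
      qed (use dpos in auto)
      moreover have "(w k)(k := u k) = w (Suc k)"
        using k by (auto simp: w_def fun_eq_iff less_Suc_eq)
      moreover have "(w k)(k := u0 k) = w k" using k by (auto simp: w_def fun_eq_iff)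
      ultimately show ?thesis by (simp add: algebra_simps)
    qed
    have w0: "w 0 = u0" using u0e by (auto simp: w_def fun_eq_iff extensional_def)
    have wn: "w n = u" using u unfolding obox_iff by (auto simp: w_def fun_eq_iff extensional_def)
    have "g u - g u0 = (\<Sum>k<n. g (w (Suc k)) - g (w k))"
      using sum_lessThan_telescope[of "\<lambda>k. g (w k)" n] by (simp add: w0 wn)
    then have "\<bar>g u - g u0 - (\<Sum>j<n. g' j u0 * (u j - u0 j))\<bar> =
        \<bar>\<Sum>k<n. (g (w (Suc k)) - g (w k)) - g' k u0 * (u k - u0 k)\<bar>"
      by (simp add: sum_subtractf)
    also have "\<dots> \<le> (\<Sum>k<n. e * \<bar>u k - u0 k\<bar>)"
      by (rule order_trans[OF sum_abs]) (use step in \<open>auto intro: sum_mono\<close>)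
    finally show "\<bar>g u - g u0 - (\<Sum>j<n. g' j u0 * (u j - u0 j))\<bar> \<le> e * (\<Sum>j<n. \<bar>u j - u0 j\<bar>)"
      by (simp add: sum_distrib_left)
  qed
qed

lemma partials_imp_continuous_map:
  fixes g :: "(nat \<Rightarrow> real) \<Rightarrow> real"
  assumes U: "openin (eucl n) U"
    and der: "\<And>u j. u \<in> U \<Longrightarrow> j < n \<Longrightarrow> ((\<lambda>t. g (u(j := t))) has_real_derivative g' j u) (at (u j))"
    and cont: "\<And>j. j < n \<Longrightarrow> continuous_map (subtopology (eucl n) U) euclideanreal (g' j)"
  shows "continuous_map (subtopology (eucl n) U) euclideanreal g"
  unfolding continuous_map_subtopology_eucl_iff[OF U]
proof (intro ballI allI impI)
  fix u0 and e :: real assume u0: "u0 \<in> U" and e: "e > 0"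
  obtain d where d: "d > 0" "obox n u0 d \<subseteq> U"
    "\<And>u. u \<in> obox n u0 d \<Longrightarrow> \<bar>g u - g u0 - (\<Sum>j<n. g' j u0 * (u j - u0 j))\<bar> \<le> 1 * (\<Sum>j<n. \<bar>u j - u0 j\<bar>)"
    by (rule partials_linear_approx[OF U der cont u0, of 1]) auto
  define B where "B = 1 + (\<Sum>j<n. \<bar>g' j u0\<bar> + 1)"
  have B: "B > 0" unfolding B_def by (smt (verit) sum_nonneg abs_ge_zero)
  define d' where "d' = min d (e / B)"
  show "\<exists>d>0. \<forall>v\<in>obox n u0 d \<inter> U. \<bar>g v - g u0\<bar> < e"
  proof (intro exI[of _ d'] conjI ballI)
    show "d' > 0" using d e B by (simp add: d'_def)
    fix v assume v: "v \<in> obox n u0 d' \<inter> U"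
    have vd: "\<bar>v j - u0 j\<bar> < d'" if "j < n" for j using v that by (simp add: obox_iff)
    have "v \<in> obox n u0 d" using v by (simp add: obox_iff d'_def)
    then have "\<bar>g v - g u0\<bar> \<le> \<bar>\<Sum>j<n. g' j u0 * (v j - u0 j)\<bar> + (\<Sum>j<n. \<bar>v j - u0 j\<bar>)"
      using d(3)[of v] by linarith
    also have "\<dots> \<le> (\<Sum>j<n. \<bar>g' j u0\<bar> * \<bar>v j - u0 j\<bar>) + (\<Sum>j<n. \<bar>v j - u0 j\<bar>)"
      using sum_abs[of "\<lambda>j. g' j u0 * (v j - u0 j)" "{..<n}"] by (simp add: abs_mult)
    also have "\<dots> = (\<Sum>j<n. (\<bar>g' j u0\<bar> + 1) * \<bar>v j - u0 j\<bar>)"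
      by (simp add: sum.distrib algebra_simps)
    also have "\<dots> \<le> (\<Sum>j<n. (\<bar>g' j u0\<bar> + 1) * d')"
      using vd by (intro sum_mono mult_left_mono) (auto intro: less_imp_le)
    also have "\<dots> = (B - 1) * d'" by (simp add: B_def sum_distrib_right)
    also have "\<dots> < B * d'" using \<open>d' > 0\<close> by simp
    also have "\<dots> \<le> B * (e / B)" using B by (intro mult_left_mono) (auto simp: d'_def)
    also have "\<dots> = e" using B by simp
    finally show "\<bar>g v - g u0\<bar> < e" .
  qed
qed

lemma continuous_map_det:
  assumes "\<And>i j. i < n \<Longrightarrow> j < n \<Longrightarrow> continuous_map X euclideanreal (g i j)"
  shows "continuous_map X euclideanreal (\<lambda>u. Determinant.det (Matrix.mat n n (\<lambda>(i, j). g i j u)))"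
proof -
  have eq: "Determinant.det (Matrix.mat n n (\<lambda>(i, j). g i j u)) =
      (\<Sum>p\<in>{p. p permutes {0..<n}}. signof p * (\<Prod>i = 0..<n. g i (p i) u))" for u
    by (subst det_def'[where n = n])
      (auto intro!: sum.cong prod.cong simp: permutes_in_image)
  show ?thesis
    unfolding eq
  proof (intro continuous_map_sum continuous_map_real_mult continuous_map_prod)
    fix p i assume "p \<in> {p. p permutes {0..<n}}" "i \<in> {0..<n}"
    then have "p i < n" "i < n" using permutes_in_image[of p "{0..<n}" i] by auto
    then show "continuous_map X euclideanreal (g i (p i))" using assms by blast
  qed (auto simp: finite_permutations)
qed

lemma borel_measurable_indicator_openin_eucl:
  assumes U: "openin (eucl n) U" and g: "continuous_map (subtopology (eucl n) U) euclideanreal g"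
  shows "(\<lambda>u. indicator U u * g u) \<in> borel_measurable (eucl_lebesgue n)"
proof (rule borel_measurableI)
  fix S :: "real set" assume S: "open S"
  have ts: "topspace (subtopology (eucl n) U) = U"
    using openin_subset[OF U] by (simp add: inf_absorb2)
  have "openin (subtopology (eucl n) U) {u \<in> topspace (subtopology (eucl n) U). g u \<in> S}"
    by (rule openin_continuous_map_preimage[OF g]) (use S in simp)
  then have "openin (eucl n) {u \<in> U. g u \<in> S}"
    unfolding ts using U by (simp add: openin_open_subtopology)
  from sets_openin_eucl[OF this] have 1: "{u \<in> U. g u \<in> S} \<in> sets (eucl_lebesgue n)" .
  have 2: "space (eucl_lebesgue n) - U \<in> sets (eucl_lebesgue n)"
    using sets_openin_eucl[OF U] by (rule sets.compl_sets)
  have "(\<lambda>u. indicator U u * g u) -` S \<inter> space (eucl_lebesgue n) =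
      {u \<in> U. g u \<in> S} \<union> (if 0 \<in> S then space (eucl_lebesgue n) - U else {})"
    using sets.sets_into_space[OF sets_openin_eucl[OF U]] by (auto simp: indicator_def of_bool_def split: if_splits)
  then show "(\<lambda>u. indicator U u * g u) -` S \<inter> space (eucl_lebesgue n) \<in> sets (eucl_lebesgue n)"
    using 1 2 by auto
qed

text \<open>Cousin's argument: if \<open>P\<close> fails on a cube, it fails on one of the halved
  cubes, and the nested sequence shrinks to a point where \<open>local\<close> is violated. Local
  volume estimates can thus be added up over a cube without choosing a uniform mesh.\<close>

lemma cube_bisection:
  fixes P :: "(nat \<Rightarrow> real) \<Rightarrow> real \<Rightarrow> bool"
  assumes split: "\<And>c h. h > 0 \<Longrightarrow>
      (\<And>b. b \<in> PiE {..<n} (\<lambda>_. {0, 1}) \<Longrightarrow> P (\<lambda>i. c i + b i * (h / 2)) (h / 2)) \<Longrightarrow> P c h"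
    and local: "\<And>u. u \<in> extensional {..<n} \<Longrightarrow>
      \<exists>d>0. \<forall>c h. 0 < h \<longrightarrow> h < d \<longrightarrow> (\<forall>i<n. c i \<le> u i \<and> u i \<le> c i + h) \<longrightarrow> P c h"
    and h: "h > 0"
  shows "P c h"
proof (rule ccontr)
  assume neg: "\<not> P c h"
  have "\<exists>F. \<forall>k. (\<not> P (fst (F k)) (snd (F k)) \<and> snd (F k) = h / 2 ^ k) \<and>
    (\<exists>b\<in>PiE {..<n} (\<lambda>_. {0, 1}). fst (F (Suc k)) = (\<lambda>i. fst (F k) i + b i * (snd (F k) / 2)))"
  proof (rule dependent_nat_choice)
    show "\<exists>x. \<not> P (fst x) (snd x) \<and> snd x = h / 2 ^ 0" using neg by (intro exI[of _ "(c, h)"]) simp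
  next
    fix x k assume x: "\<not> P (fst x) (snd x) \<and> snd x = h / 2 ^ k"
    then have "snd x > 0" using h by simp
    with split[of "snd x" "fst x"] x obtain b where "b \<in> PiE {..<n} (\<lambda>_. {0, 1})"
      "\<not> P (\<lambda>i. fst x i + b i * (snd x / 2)) (snd x / 2)" by blast
    then show "\<exists>y. (\<not> P (fst y) (snd y) \<and> snd y = h / 2 ^ Suc k) \<and>
      (\<exists>b\<in>PiE {..<n} (\<lambda>_. {0, 1}). fst y = (\<lambda>i. fst x i + b i * (snd x / 2)))"
      using x by (intro exI[of _ "(\<lambda>i. fst x i + b i * (snd x / 2), snd x / 2)"]) auto
  qed
  then obtain F where F: "\<And>k. \<not> P (fst (F k)) (snd (F k))" "\<And>k. snd (F k) = h / 2 ^ k"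
    "\<And>k. \<exists>b\<in>PiE {..<n} (\<lambda>_. {0, 1}). fst (F (Suc k)) = (\<lambda>i. fst (F k) i + b i * (snd (F k) / 2))"
    by blast
  define C where "C k = fst (F k)" for k
  have bit: "C (Suc k) i = C k i \<or> C (Suc k) i = C k i + h / 2 ^ Suc k" if "i < n" for i k
  proof -
    obtain b where b: "b \<in> PiE {..<n} (\<lambda>_. {0, 1::real})" "C (Suc k) = (\<lambda>i. C k i + b i * (snd (F k) / 2))"
      using F(3)[of k] unfolding C_def by blast
    have "b i \<in> {0, 1}" using b(1) that by blast
    then have "b i = 0 \<or> b i = 1" by blast
    moreover have "C (Suc k) i = C k i + b i * (h / 2 ^ Suc k)"
      using b(2) F(2)[of k] by simp
    ultimately show ?thesis by auto
  qed
  have "\<exists>l. (\<forall>k. C k i \<le> l) \<and> (\<forall>k. l \<le> C k i + h / 2 ^ k)" if i: "i < n" for i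
  proof -
    have "\<exists>l. ((\<forall>k. C k i \<le> l) \<and> (\<lambda>k. C k i) \<longlonglongrightarrow> l) \<and>
      ((\<forall>k. l \<le> C k i + h / 2 ^ k) \<and> (\<lambda>k. C k i + h / 2 ^ k) \<longlonglongrightarrow> l)"
    proof (rule nested_sequence_unique)
      show "\<forall>k. C k i \<le> C (Suc k) i" using bit[OF i] h by (smt (verit) divide_nonneg_nonneg zero_le_power)
      show "\<forall>k. C (Suc k) i + h / 2 ^ Suc k \<le> C k i + h / 2 ^ k"
      proof
        fix k
        have "h / 2 ^ k = h / 2 ^ Suc k + h / 2 ^ Suc k" by simp
        moreover have "h / 2 ^ Suc k \<ge> 0" using h by simp
        ultimately show "C (Suc k) i + h / 2 ^ Suc k \<le> C k i + h / 2 ^ k"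
          using bit[OF i, of k] by linarith
      qed
      show "\<forall>k. C k i \<le> C k i + h / 2 ^ k" using h by simp
      have "(\<lambda>k. - (h * (1 / 2) ^ k)) \<longlonglongrightarrow> - (h * 0)"
        by (intro tendsto_intros LIMSEQ_power_zero) simp
      then show "(\<lambda>k. C k i - (C k i + h / 2 ^ k)) \<longlonglongrightarrow> 0" by (simp add: power_divide)
    qed
    then show ?thesis by blast
  qed
  then obtain l where l: "\<And>i k. i < n \<Longrightarrow> C k i \<le> l i" "\<And>i k. i < n \<Longrightarrow> l i \<le> C k i + h / 2 ^ k"
    by metis
  define u where "u = (\<lambda>i\<in>{..<n}. l i)"
  obtain d where d: "d > 0" "\<And>c h. 0 < h \<Longrightarrow> h < d \<Longrightarrow> (\<forall>i<n. c i \<le> u i \<and> u i \<le> c i + h) \<Longrightarrow> P c h"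
    using local[of u] unfolding u_def by auto
  obtain k where k: "h / 2 ^ k < d"
  proof -
    have "(\<lambda>k. h * (1 / 2) ^ k) \<longlonglongrightarrow> h * 0"
      by (intro tendsto_intros LIMSEQ_power_zero) simp
    then have "\<forall>\<^sub>F k in sequentially. h * (1 / 2) ^ k < d"
      using d(1) by (intro order_tendstoD(2)[of _ "h * 0"]) auto
    then show ?thesis using that by (auto simp: eventually_sequentially power_divide)
  qed
  have "P (C k) (h / 2 ^ k)"
  proof (rule d(2)[OF _ k])
    show "0 < h / 2 ^ k" using h by simp
    show "\<forall>i<n. C k i \<le> u i \<and> u i \<le> C k i + h / 2 ^ k" using l unfolding u_def by simp
  qed
  then show False using F(1,2)[of k] unfolding C_def by simp
qed

text \<open>Source and target have the same dimension \<open>n\<close>. The maps to which this is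
  applied sweep a hypersurface piece in a fixed direction, with time as the additional source
  coordinate.\<close>

locale C1_self_map =
  fixes n :: nat and U :: "(nat \<Rightarrow> real) set" and f :: "(nat \<Rightarrow> real) \<Rightarrow> nat \<Rightarrow> real"
    and f' :: "nat \<Rightarrow> nat \<Rightarrow> (nat \<Rightarrow> real) \<Rightarrow> real"
  assumes openU: "openin (eucl n) U"
    and ext: "\<And>u. u \<in> U \<Longrightarrow> f u \<in> extensional {..<n}"
    and der: "\<And>u i j. u \<in> U \<Longrightarrow> i < n \<Longrightarrow> j < n \<Longrightarrow>
      ((\<lambda>t. f (u(j := t)) i) has_real_derivative f' i j u) (at (u j))"
    and cont: "\<And>i j. i < n \<Longrightarrow> j < n \<Longrightarrow> continuous_map (subtopology (eucl n) U) euclideanreal (f' i j)"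
begin

definition jac :: "(nat \<Rightarrow> real) \<Rightarrow> real" where
  "jac u = \<bar>Determinant.det (Matrix.mat n n (\<lambda>(i, j). f' i j u))\<bar>"

lemma jac_nonneg: "jac u \<ge> 0"
  by (simp add: jac_def)

lemma continuous_map_jac: "continuous_map (subtopology (eucl n) U) euclideanreal jac"
  unfolding jac_def by (intro continuous_map_real_abs continuous_map_det cont)

lemma compactin_image:
  assumes "compactin (eucl n) K" "K \<subseteq> U"
  shows "compactin (eucl n) (f ` K)"
proof -
  have ts: "topspace (subtopology (eucl n) U) = U"
    using openin_subset[OF openU] by (simp add: inf_absorb2)
  have "continuous_map (subtopology (eucl n) U) (eucl n) f"
  proof (rule continuous_map_euclI)
    fix i assume i: "i < n"
    show "continuous_map (subtopology (eucl n) U) euclideanreal (\<lambda>x. f x i)"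
      by (rule partials_imp_continuous_map[OF openU der[OF _ i] cont[OF i]])
  qed (use ext ts in blast)
  moreover have "compactin (subtopology (eucl n) U) K" using assms by (simp add: compactin_subtopology)
  ultimately show ?thesis using image_compactin by blast
qed

text \<open>After scaling by \<open>1 / h\<close> the image of the cube is within \<open>e\<close>
  of a translate of the parallelepiped of the derivative at \<open>u0\<close>, so it fits into a
  scaled \<open>thick_image\<close>. The cube only has to contain \<open>u0\<close>, in whatever
  position, which is the form that \<open>cube_bisection\<close> asks for.\<close>

lemma cube_image_estimate:
  assumes u0: "u0 \<in> U" and eta: "\<eta> > 0"
  obtains d where "d > 0" "obox n u0 d \<subseteq> U"
    "\<And>c h. 0 < h \<Longrightarrow> h < d \<Longrightarrow> (\<forall>i<n. c i \<le> u0 i \<and> u0 i \<le> c i + h) \<Longrightarrow>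
      \<exists>Y\<in>sets (eucl_lebesgue n). f ` PiE {..<n} (\<lambda>i. {c i..c i + h}) \<subseteq> Y \<and>
        vol n Y \<le> ennreal ((jac u0 + \<eta>) * h ^ n)"
proof -
  define M where "M = Matrix.mat n n (\<lambda>(i, j). f' i j u0)"
  have M: "M \<in> carrier_mat n n" by (simp add: M_def)
  obtain e where e: "e > 0"
    "vol n (thick_image n M e) \<le> ennreal (\<bar>Determinant.det M\<bar> + \<eta>)"
    using emeasure_thick_image_less[OF M eta] .
  \<comment> \<open>The coordinate distances inside the cube add up to at most \<open>n * h\<close>,
    so the factor \<open>e / (n + 1)\<close> leaves an error of at most \<open>e * h\<close>; the
    \<open>+ 1\<close> covers \<open>n = 0\<close>.\<close>
  have "\<exists>d>0. obox n u0 d \<subseteq> U \<and> (\<forall>u\<in>obox n u0 d.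
      \<bar>f u i - f u0 i - (\<Sum>j<n. f' i j u0 * (u j - u0 j))\<bar> \<le> e / (real n + 1) * (\<Sum>j<n. \<bar>u j - u0 j\<bar>))"
    if i: "i < n" for i
  proof -
    obtain d where "d > 0" "obox n u0 d \<subseteq> U"
      "\<And>u. u \<in> obox n u0 d \<Longrightarrow> \<bar>f u i - f u0 i - (\<Sum>j<n. f' i j u0 * (u j - u0 j))\<bar>
         \<le> e / (real n + 1) * (\<Sum>j<n. \<bar>u j - u0 j\<bar>)"
      by (rule partials_linear_approx[OF openU, of "\<lambda>u. f u i" "f' i" u0 "e / (real n + 1)"])
        (use der[OF _ i] cont[OF i] u0 e in auto)
    then show ?thesis by blast
  qed
  then have "\<forall>i\<in>{..<n}. \<exists>d>0. obox n u0 d \<subseteq> U \<and> (\<forall>u\<in>obox n u0 d.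
      \<bar>f u i - f u0 i - (\<Sum>j<n. f' i j u0 * (u j - u0 j))\<bar> \<le> e / (real n + 1) * (\<Sum>j<n. \<bar>u j - u0 j\<bar>))"
    unfolding lessThan_iff by blast
  from bchoice[OF this] obtain D where D: "\<And>i. i < n \<Longrightarrow> D i > 0"
    "\<And>i u. i < n \<Longrightarrow> u \<in> obox n u0 (D i) \<Longrightarrow>
      \<bar>f u i - f u0 i - (\<Sum>j<n. f' i j u0 * (u j - u0 j))\<bar> \<le> e / (real n + 1) * (\<Sum>j<n. \<bar>u j - u0 j\<bar>)"
    unfolding Ball_def lessThan_iff by blast
  obtain d0 where d0: "d0 > 0" "obox n u0 d0 \<subseteq> U" using openin_eucl_obox[OF openU u0] .
  define d where "d = Min (insert d0 (D ` {..<n}))"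
  have dpos: "d > 0" unfolding d_def using d0 D by (subst Min_gr_iff) auto
  have dle: "d \<le> d0" "\<And>j. j < n \<Longrightarrow> d \<le> D j" unfolding d_def by (auto intro: Min_le)
  have dU: "obox n u0 d \<subseteq> U" using obox_mono[OF dle(1)] d0(2) by (rule order_trans)
  show ?thesis
  proof (rule that[OF dpos dU])
    fix c h assume h: "0 < h" "h < d" and c: "\<forall>i<n. c i \<le> u0 i \<and> u0 i \<le> c i + h"
    \<comment> \<open>The affine approximation at \<open>u0\<close> maps the corner \<open>c\<close>
      to \<open>a\<close>, so \<open>Y\<close> is the parallelepiped attached to \<open>a\<close>,
      thickened and scaled by \<open>h\<close>.\<close>
    define a where "a i = f u0 i + (\<Sum>j<n. f' i j u0 * (c j - u0 j))" for i
    define S where "S = lin n (h \<cdot>\<^sub>m 1\<^sub>m n) ` thick_image n M e"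
    define Y where "Y = (\<lambda>x. \<lambda>i\<in>{..<n}. x i + a i) ` S"
    have Sm: "S \<in> sets (eucl_lebesgue n)"
      unfolding S_def by (intro compactin_eucl_sets compactin_lin compactin_thick_image)
    have Ym: "Y \<in> sets (eucl_lebesgue n)" unfolding Y_def by (rule emeasure_eucl_translate(2)[OF Sm])
    have "vol n Y = vol n S"
      unfolding Y_def by (rule emeasure_eucl_translate(1)[OF Sm])
    also have "\<dots> \<le> ennreal \<bar>Determinant.det (h \<cdot>\<^sub>m 1\<^sub>m n)\<bar> * vol n (thick_image n M e)"
      unfolding S_def by (intro emeasure_lin_image_le compactin_thick_image) simp
    also have "\<dots> \<le> ennreal (h ^ n) * ennreal (\<bar>Determinant.det M\<bar> + \<eta>)"
      using e(2) h by (intro mult_mono) auto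
    also have "\<dots> = ennreal ((jac u0 + \<eta>) * h ^ n)"
      using h eta by (subst ennreal_mult[symmetric]) (auto simp: jac_def M_def mult.commute)
    finally have "vol n Y \<le> ennreal ((jac u0 + \<eta>) * h ^ n)" .
    moreover have "f ` PiE {..<n} (\<lambda>i. {c i..c i + h}) \<subseteq> Y"
    proof (rule image_subsetI)
      fix u assume u: "u \<in> PiE {..<n} (\<lambda>i. {c i..c i + h})"
      have ui: "c i \<le> u i \<and> u i \<le> c i + h" if "i < n" for i
        using PiE_mem[OF u, of i] that by simp
      have dist: "\<bar>u i - u0 i\<bar> \<le> h" if "i < n" for i
        using ui[OF that] c that by (smt (verit))
      have ue: "u \<in> extensional {..<n}" using u by (simp add: PiE_iff)
      have uD: "u \<in> obox n u0 r" if "d \<le> r" for r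
        unfolding obox_iff using ue dist h that by (meson le_less_trans less_le_trans)
      have "u \<in> U" using uD[of d] dU by blast
      define s where "s = (\<lambda>j\<in>{..<n}. (u j - c j) / h)"
      define y where "y = (\<lambda>i\<in>{..<n}. (f u i - a i) / h)"
      have s: "s \<in> PiE {..<n} (\<lambda>_. {0..1})"
        unfolding s_def by (rule restrict_PiE_iff[THEN iffD2]) (use ui h in \<open>auto simp: field_simps\<close>)
      have "\<bar>y i - lin n M s i\<bar> \<le> e" if i: "i < n" for i
      proof -
        have "h * lin n M s i = (\<Sum>j<n. f' i j u0 * (u j - c j))"
          unfolding lin_apply[OF i] sum_distrib_left
          using i h by (intro sum.cong) (auto simp: M_def s_def)
        moreover have "h * y i = f u i - a i" using i h by (simp add: y_def)
        ultimately have "h * (y i - lin n M s i) = f u i - a i - (\<Sum>j<n. f' i j u0 * (u j - c j))"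
          unfolding right_diff_distrib[of h] by simp
        also have "\<dots> = f u i - f u0 i - (\<Sum>j<n. f' i j u0 * (u j - u0 j))"
          by (simp add: a_def right_diff_distrib sum_subtractf)
        finally have "h * \<bar>y i - lin n M s i\<bar> = \<bar>f u i - f u0 i - (\<Sum>j<n. f' i j u0 * (u j - u0 j))\<bar>"
          using h by (metis abs_mult abs_of_pos)
        also have "\<dots> \<le> e / (real n + 1) * (\<Sum>j<n. \<bar>u j - u0 j\<bar>)"
          by (rule D(2)[OF i uD[OF dle(2)[OF i]]])
        also have "\<dots> \<le> e / (real n + 1) * (\<Sum>j<n. h)"
          using e dist by (intro mult_left_mono sum_mono) auto
        also have "\<dots> \<le> h * e"
          using e h by (simp add: field_simps)
        finally show ?thesis using h by simp
      qed
      then have "y \<in> thick_image n M e" using s unfolding thick_image_def y_def by auto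
      moreover have "f u = (\<lambda>i\<in>{..<n}. lin n (h \<cdot>\<^sub>m 1\<^sub>m n) y i + a i)"
      proof (rule extensionalityI[OF ext[OF \<open>u \<in> U\<close>]])
        fix i assume "i \<in> {..<n}"
        then have i: "i < n" by simp
        have "lin n (h \<cdot>\<^sub>m 1\<^sub>m n) y i = (\<Sum>j<n. (if i = j then h else 0) * y j)"
          unfolding lin_apply[OF i] using i by (intro sum.cong) auto
        also have "\<dots> = h * y i"
          using i by (simp add: if_distrib[of "\<lambda>a. a * _"] cong: if_cong)
        finally show "f u i = (\<lambda>i\<in>{..<n}. lin n (h \<cdot>\<^sub>m 1\<^sub>m n) y i + a i) i"
          using i h by (simp add: y_def)
      qed simp
      ultimately show "f u \<in> Y" unfolding Y_def S_def by blast
    qed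
    ultimately show "\<exists>Y\<in>sets (eucl_lebesgue n). f ` PiE {..<n} (\<lambda>i. {c i..c i + h}) \<subseteq> Y \<and>
        vol n Y \<le> ennreal ((jac u0 + \<eta>) * h ^ n)" using Ym by blast
  qed
qed

end

section \<open>The area inequality for continuously differentiable maps\<close>

context C1_self_map
begin

lemma jac_near:
  assumes "u \<in> U" "e > 0"
  obtains d where "d > 0" "\<And>v. v \<in> obox n u d \<Longrightarrow> v \<in> U \<Longrightarrow> \<bar>jac v - jac u\<bar> < e"
  using continuous_map_jac assms unfolding continuous_map_subtopology_eucl_iff[OF openU] by blast

lemma measurable_indicator_jac:
  assumes W: "openin (eucl n) W" "W \<subseteq> U"
  shows "(\<lambda>u. indicator W u * jac u) \<in> borel_measurable (eucl_lebesgue n)"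
  by (rule borel_measurable_indicator_openin_eucl[OF W(1)
        continuous_map_from_subtopology_mono[OF continuous_map_jac W(2)]])

text \<open>
  The open set \<open>W\<close> and the summand \<open>\<eta>\<close> give the linear approximation at a point of \<open>K\<close> enough room to
  hold on all small cubes around it, also on those that are not contained in \<open>K\<close>.
\<close>

lemma emeasure_image_cube_le:
  assumes K: "compactin (eucl n) K" and W: "openin (eucl n) W" "K \<subseteq> W" "W \<subseteq> U" and eta: "\<eta> > 0"
    and h: "h > 0"
  shows "vol n (f ` (K \<inter> PiE {..<n} (\<lambda>i. {c i..c i + h}))) \<le>
    emeasure (density (eucl_lebesgue n) (\<lambda>u. ennreal (indicator W u * jac u + \<eta>))) (PiE {..<n} (\<lambda>i. {c i..<c i + h}))"
proof -
  define g where "g u = ennreal (indicator W u * jac u + \<eta>)" for u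
  have gm: "g \<in> borel_measurable (eucl_lebesgue n)"
    unfolding g_def using measurable_indicator_jac[OF W(1,3)] by measurable
  define \<nu> where "\<nu> = density (eucl_lebesgue n) g"
  have nus: "sets \<nu> = sets (eucl_lebesgue n)" by (simp add: \<nu>_def)
  \<comment> \<open>Closed cubes keep the images compact and hence measurable; half-open cubes make
    the parts of a bisected cube disjoint, so that \<open>\<nu>\<close> adds up exactly.\<close>
  let ?Qc = "\<lambda>c h. PiE {..<n} (\<lambda>i. {c i..c i + h::real})"
  let ?Qo = "\<lambda>c h. PiE {..<n} (\<lambda>i. {c i..<c i + h::real})"
  have Qo: "?Qo c h \<in> sets (eucl_lebesgue n)" for c h by (intro sets_PiM_I_finite) auto
  have Kc: "compactin (eucl n) (f ` (K \<inter> ?Qc c h))" for c h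
  proof (rule compactin_image)
    show "compactin (eucl n) (K \<inter> ?Qc c h)"
      by (rule closed_Int_compactin[OF compactin_eucl_closedin[OF K]]) (simp add: compactin_PiE)
  qed (use W in blast)
  define P where "P c h \<longleftrightarrow> vol n (f ` (K \<inter> ?Qc c h)) \<le> emeasure \<nu> (?Qo c h)" for c h
  have "P c h"
  proof (rule cube_bisection[where P = P, OF _ _ h])
    fix c :: "nat \<Rightarrow> real" and h :: real
    let ?B = "PiE {..<n} (\<lambda>_. {0, 1::real})"
    assume h: "h > 0" and IH: "\<And>b. b \<in> ?B \<Longrightarrow> P (\<lambda>i. c i + b i * (h / 2)) (h / 2)"
    have finB: "finite ?B" by (intro finite_PiE) auto
    let ?c = "\<lambda>b i. c i + b i * (h / 2)"
    have "K \<inter> ?Qc c h \<subseteq> (\<Union>b\<in>?B. K \<inter> ?Qc (?c b) (h / 2))"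
    proof
      fix u assume u: "u \<in> K \<inter> ?Qc c h"
      define b where "b = (\<lambda>i\<in>{..<n}. if u i \<le> c i + h / 2 then 0 else 1::real)"
      have "b \<in> ?B" unfolding b_def by (simp add: restrict_PiE_iff)
      moreover have "u \<in> ?Qc (?c b) (h / 2)"
      proof (rule PiE_I)
        fix i assume i: "i \<in> {..<n}"
        have "u i \<in> {c i..c i + h}" using u i by blast
        then show "u i \<in> {?c b i..?c b i + h / 2}" using i h by (simp add: b_def)
      next
        fix i assume "i \<notin> {..<n}"
        moreover have "u \<in> extensional {..<n}" using u by (simp add: PiE_iff)
        ultimately show "u i = undefined" by (rule extensional_arb[rotated])
      qed
      ultimately show "u \<in> (\<Union>b\<in>?B. K \<inter> ?Qc (?c b) (h / 2))" using u by blast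
    qed
    from image_mono[OF this, of f]
    have sub: "f ` (K \<inter> ?Qc c h) \<subseteq> (\<Union>b\<in>?B. f ` (K \<inter> ?Qc (?c b) (h / 2)))"
      by (simp only: image_UN)
    have disj: "disjoint_family_on (\<lambda>b. ?Qo (?c b) (h / 2)) ?B"
      unfolding disjoint_family_on_def
    proof (intro ballI impI)
      fix b b' assume b: "b \<in> ?B" "b' \<in> ?B" "b \<noteq> b'"
      then obtain i where i: "i < n" "b i \<noteq> b' i" by (metis PiE_ext lessThan_iff)
      have "b i \<in> {0, 1}" "b' i \<in> {0, 1}" using b i by blast+
      then have "{?c b i..<?c b i + h / 2} \<inter> {?c b' i..<?c b' i + h / 2} = {}"
        using i(2) h by auto
      then show "?Qo (?c b) (h / 2) \<inter> ?Qo (?c b') (h / 2) = {}" using i(1) by blast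
    qed
    have sub2: "(\<Union>b\<in>?B. ?Qo (?c b) (h / 2)) \<subseteq> ?Qo c h"
    proof (intro UN_least PiE_mono)
      fix b i assume "b \<in> ?B" "i \<in> {..<n}"
      then have "b i \<in> {0, 1}" by blast
      then show "{?c b i..<?c b i + h / 2} \<subseteq> {c i..<c i + h}" using h by auto
    qed
    have "vol n (f ` (K \<inter> ?Qc c h)) \<le>
        vol n (\<Union>b\<in>?B. f ` (K \<inter> ?Qc (?c b) (h / 2)))"
      by (rule emeasure_mono[OF sub]) (intro sets.finite_UN finB compactin_eucl_sets Kc)
    also have "\<dots> \<le> (\<Sum>b\<in>?B. vol n (f ` (K \<inter> ?Qc (?c b) (h / 2))))"
      by (rule emeasure_subadditive_finite[OF finB]) (intro image_subsetI compactin_eucl_sets Kc)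
    also have "\<dots> \<le> (\<Sum>b\<in>?B. emeasure \<nu> (?Qo (?c b) (h / 2)))"
      by (rule sum_mono) (use IH in \<open>simp only: P_def\<close>)
    also have "\<dots> = emeasure \<nu> (\<Union>b\<in>?B. ?Qo (?c b) (h / 2))"
      by (rule sum_emeasure[OF _ disj finB]) (unfold nus, intro image_subsetI Qo)
    also have "\<dots> \<le> emeasure \<nu> (?Qo c h)"
      by (rule emeasure_mono[OF sub2]) (unfold nus, rule Qo)
    finally show "P c h" unfolding P_def .
  next
    fix u :: "nat \<Rightarrow> real" assume ue: "u \<in> extensional {..<n}"
    have cube_sub: "?Qc c h \<subseteq> obox n u d" if "h < d" "\<forall>i<n. c i \<le> u i \<and> u i \<le> c i + h" for c h d
    proof
      fix v assume v: "v \<in> ?Qc c h"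
      have "\<bar>v i - u i\<bar> < d" if "i < n" for i
      proof -
        have "v i \<in> {c i..c i + h}" using v that by blast
        then show ?thesis using \<open>h < d\<close> \<open>\<forall>i<n. c i \<le> u i \<and> u i \<le> c i + h\<close> that by (smt (verit) atLeastAtMost_iff)
      qed
      moreover have "v \<in> extensional {..<n}" using v by (simp add: PiE_iff)
      ultimately show "v \<in> obox n u d" unfolding obox_iff by blast
    qed
    show "\<exists>d>0. \<forall>c h. 0 < h \<longrightarrow> h < d \<longrightarrow> (\<forall>i<n. c i \<le> u i \<and> u i \<le> c i + h) \<longrightarrow> P c h"
    proof (cases "u \<in> K")
      case False
      obtain d where d: "d > 0" "obox n u d \<inter> K = {}"
        using compactin_eucl_separation[OF K ue False] .
      show ?thesis
      proof (intro exI[of _ d] conjI allI impI)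
        fix c h assume "0 < h" "h < d" "\<forall>i<n. c i \<le> u i \<and> u i \<le> c i + h"
        then have "K \<inter> ?Qc c h = {}" using d cube_sub by blast
        then show "P c h" unfolding P_def by simp
      qed (use d in simp)
    next
      case True
      then have uU: "u \<in> U" and uW: "u \<in> W" using W by auto
      \<comment> \<open>One half of \<open>\<eta>\<close> pays for the linear approximation on the
        cube, the other half for the variation of \<open>jac\<close> over it.\<close>
      obtain d1 where d1: "d1 > 0"
        "\<And>c h. 0 < h \<Longrightarrow> h < d1 \<Longrightarrow> (\<forall>i<n. c i \<le> u i \<and> u i \<le> c i + h) \<Longrightarrow>
          \<exists>Y\<in>sets (eucl_lebesgue n). f ` ?Qc c h \<subseteq> Y \<and>
            vol n Y \<le> ennreal ((jac u + \<eta> / 2) * h ^ n)"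
        by (rule cube_image_estimate[OF uU, of "\<eta> / 2"]) (use eta in auto)
      obtain d2 where d2: "d2 > 0" "obox n u d2 \<subseteq> W" using openin_eucl_obox[OF W(1) uW] .
      obtain d3 where d3: "d3 > 0" "\<And>v. v \<in> obox n u d3 \<Longrightarrow> v \<in> U \<Longrightarrow> \<bar>jac v - jac u\<bar> < \<eta> / 2"
        using jac_near[OF uU, of "\<eta> / 2"] eta by auto
      show ?thesis
      proof (intro exI[of _ "min d1 (min d2 d3)"] conjI allI impI)
        fix c h assume h: "0 < h" "h < min d1 (min d2 d3)" and c: "\<forall>i<n. c i \<le> u i \<and> u i \<le> c i + h"
        obtain Y where Y: "Y \<in> sets (eucl_lebesgue n)" "f ` ?Qc c h \<subseteq> Y"
          "vol n Y \<le> ennreal ((jac u + \<eta> / 2) * h ^ n)"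
          using d1(2)[OF h(1) _ c] h(2) by auto
        have oc: "?Qo c h \<subseteq> ?Qc c h" by (intro PiE_mono) auto
        have lower: "ennreal (jac u + \<eta> / 2) \<le> g v" if "v \<in> ?Qo c h" for v
        proof -
          have "v \<in> ?Qc c h" using that oc by (rule subsetD[rotated])
          then have "v \<in> obox n u d2" using cube_sub[of h d2 c] h c by auto
          then have "v \<in> W" using d2(2) by (rule subsetD[rotated])
          moreover have "v \<in> obox n u d3" using \<open>v \<in> ?Qc c h\<close> cube_sub[of h d3 c] h c by auto
          ultimately have "\<bar>jac v - jac u\<bar> < \<eta> / 2" using d3(2) W by blast
          then have "jac u + \<eta> / 2 \<le> jac v + \<eta>" by (simp only: abs_less_iff) linarith
          then show ?thesis unfolding g_def using \<open>v \<in> W\<close> by (intro ennreal_leI) simp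
        qed
        have "vol n (f ` (K \<inter> ?Qc c h)) \<le> vol n Y"
          using Y by (intro emeasure_mono) auto
        also have "\<dots> \<le> ennreal (jac u + \<eta> / 2) * ennreal (h ^ n)"
          using Y(3) h jac_nonneg[of u] eta by (simp add: ennreal_mult)
        also have "ennreal (h ^ n) = vol n (?Qo c h)"
          using emeasure_eucl_half_open_cube[of 0 h n c] h by simp
        also have "ennreal (jac u + \<eta> / 2) * vol n (?Qo c h) =
            (\<integral>\<^sup>+v. ennreal (jac u + \<eta> / 2) * indicator (?Qo c h) v \<partial>eucl_lebesgue n)"
          using Qo by (simp add: nn_integral_cmult)
        also have "\<dots> \<le> (\<integral>\<^sup>+v. g v * indicator (?Qo c h) v \<partial>eucl_lebesgue n)"
          using lower by (intro nn_integral_mono) (simp add: indicator_def)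
        also have "\<dots> = emeasure \<nu> (?Qo c h)"
          unfolding \<nu>_def using gm Qo by (simp add: emeasure_density)
        finally show "P c h" unfolding P_def .
      qed (use d1 d2 d3 in simp)
    qed
  qed
  then show ?thesis unfolding P_def \<nu>_def g_def .
qed

lemma emeasure_image_le_open:
  assumes K: "compactin (eucl n) K" and W: "openin (eucl n) W" "K \<subseteq> W" "W \<subseteq> U"
  shows "vol n (f ` K) \<le> (\<integral>\<^sup>+u. ennreal (indicator W u * jac u) \<partial>eucl_lebesgue n)"
proof (rule ennreal_le_epsilon)
  fix e :: real assume e: "e > 0"
  obtain R where R: "R > 0" "K \<subseteq> PiE {..<n} (\<lambda>_. {-R..R})" using compactin_eucl_bounded[OF K] .
  \<comment> \<open>\<open>\<eta>\<close> times the volume of the cube enclosing \<open>K\<close> is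
    exactly \<open>e\<close>.\<close>
  define \<eta> where "\<eta> = e / (2 * R) ^ n"
  have eta: "\<eta> > 0" using e R by (simp add: \<eta>_def)
  let ?Q = "PiE {..<n} (\<lambda>_. {-R..<-R + 2 * R})"
  have Q: "?Q \<in> sets (eucl_lebesgue n)" by (intro sets_PiM_I_finite) auto
  note m = measurable_indicator_jac[OF W(1,3)]
  have "K \<inter> PiE {..<n} (\<lambda>i. {-R..-R + 2 * R}) = K" using R by auto
  then have "vol n (f ` K) \<le>
      emeasure (density (eucl_lebesgue n) (\<lambda>u. ennreal (indicator W u * jac u + \<eta>))) ?Q"
    using emeasure_image_cube_le[OF K W eta, of "2 * R" "\<lambda>_. -R"] R by simp
  also have "\<dots> = (\<integral>\<^sup>+u. ennreal (indicator W u * jac u + \<eta>) * indicator ?Q u \<partial>eucl_lebesgue n)"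
    by (rule emeasure_density) (use m Q in measurable)
  also have "\<dots> \<le> (\<integral>\<^sup>+u. ennreal (indicator W u * jac u) + ennreal \<eta> * indicator ?Q u \<partial>eucl_lebesgue n)"
    using eta jac_nonneg by (intro nn_integral_mono) (auto simp: indicator_def)
  also have "\<dots> = (\<integral>\<^sup>+u. ennreal (indicator W u * jac u) \<partial>eucl_lebesgue n) + ennreal \<eta> * vol n ?Q"
    using m Q by (subst nn_integral_add) (auto simp: nn_integral_cmult)
  also have "vol n ?Q = ennreal ((2 * R) ^ n)"
    using emeasure_eucl_half_open_cube[of 0 "2 * R" n "\<lambda>_. -R"] R by simp
  also have "ennreal \<eta> * ennreal ((2 * R) ^ n) = ennreal e"
    using eta R by (subst ennreal_mult[symmetric]) (auto simp: \<eta>_def)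
  finally show "vol n (f ` K) \<le>
    (\<integral>\<^sup>+u. ennreal (indicator W u * jac u) \<partial>eucl_lebesgue n) + ennreal e" .
qed

lemma emeasure_obox_finite: "vol n (obox n x d) < \<infinity>"
proof -
  have "vol n (obox n x d) \<le> vol n (PiE {..<n} (\<lambda>i. {x i + - \<bar>d\<bar>..x i + \<bar>d\<bar>}))"
    unfolding obox_def by (intro emeasure_mono PiE_mono sets_PiM_I_finite) auto
  also have "\<dots> < \<infinity>" by (subst emeasure_eucl_cbox) auto
  finally show ?thesis .
qed

text \<open>Monotone convergence from above needs a starting function with finite integral. Since
  \<open>jac\<close> is locally bounded, finitely many boxes covering \<open>K\<close> provide a
  neighbourhood on which it is bounded.\<close>

lemma finite_integral_nbhd:
  assumes K: "compactin (eucl n) K" "K \<subseteq> U"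
  obtains W where "openin (eucl n) W" "K \<subseteq> W" "W \<subseteq> U"
    "(\<integral>\<^sup>+u. ennreal (indicator W u * jac u) \<partial>eucl_lebesgue n) < \<infinity>"
proof -
  have "\<exists>d>0. obox n x d \<subseteq> U \<and> (\<forall>v\<in>obox n x d. jac v < jac x + 1)" if x: "x \<in> K" for x
  proof -
    have xU: "x \<in> U" using x K by blast
    obtain d1 where d1: "d1 > 0" "obox n x d1 \<subseteq> U" using openin_eucl_obox[OF openU xU] .
    obtain d2 where d2: "d2 > 0" "\<And>v. v \<in> obox n x d2 \<Longrightarrow> v \<in> U \<Longrightarrow> \<bar>jac v - jac x\<bar> < 1"
      using jac_near[OF xU, of 1] by auto
    have sub: "obox n x (min d1 d2) \<subseteq> obox n x d1" "obox n x (min d1 d2) \<subseteq> obox n x d2"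
      by (simp_all add: obox_mono)
    show ?thesis
    proof (intro exI[of _ "min d1 d2"] conjI ballI)
      fix v assume "v \<in> obox n x (min d1 d2)"
      then have "v \<in> obox n x d2 \<inter> U" using sub d1 by blast
      then have "\<bar>jac v - jac x\<bar> < 1" using d2(2) by blast
      then show "jac v < jac x + 1" by linarith
    qed (use d1 d2 sub in auto)
  qed
  then have "\<forall>x\<in>K. \<exists>d>0. obox n x d \<subseteq> U \<and> (\<forall>v\<in>obox n x d. jac v < jac x + 1)" by blast
  from bchoice[OF this] obtain d where d: "\<And>x. x \<in> K \<Longrightarrow> d x > 0" "\<And>x. x \<in> K \<Longrightarrow> obox n x (d x) \<subseteq> U"
    "\<And>x v. x \<in> K \<Longrightarrow> v \<in> obox n x (d x) \<Longrightarrow> jac v < jac x + 1" by blast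
  have "\<exists>\<F>. finite \<F> \<and> \<F> \<subseteq> (\<lambda>x. obox n x (d x)) ` K \<and> K \<subseteq> \<Union>\<F>"
  proof -
    have "K \<subseteq> \<Union>((\<lambda>x. obox n x (d x)) ` K)"
    proof
      fix x assume x: "x \<in> K"
      have "x \<in> obox n x (d x)" unfolding obox_iff using compactin_eucl_extensional[OF K(1)] x d(1)[OF x] by auto
      then show "x \<in> \<Union>((\<lambda>x. obox n x (d x)) ` K)" using x by blast
    qed
    moreover have "\<forall>V\<in>(\<lambda>x. obox n x (d x)) ` K. openin (eucl n) V" using openin_obox by blast
    ultimately show ?thesis using K(1) unfolding compactin_def by meson
  qed
  then obtain \<F> where F: "finite \<F>" "\<F> \<subseteq> (\<lambda>x. obox n x (d x)) ` K" "K \<subseteq> \<Union>\<F>" by blast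
  obtain T where T: "T \<subseteq> K" "finite T" "\<F> = (\<lambda>x. obox n x (d x)) ` T"
    using finite_subset_image[OF F(1,2)] by blast
  define W where "W = (\<Union>x\<in>T. obox n x (d x))"
  have Wo: "openin (eucl n) W" unfolding W_def using openin_obox by blast
  define B where "B = (\<Sum>x\<in>T. jac x + 1)"
  have B: "jac v \<le> B" if "v \<in> W" for v
  proof -
    obtain x where x: "x \<in> T" "v \<in> obox n x (d x)" using \<open>v \<in> W\<close> unfolding W_def by blast
    have "jac v \<le> jac x + 1" using d(3)[of x v] x T by (meson less_imp_le subsetD)
    also have "\<dots> \<le> B" unfolding B_def using x T jac_nonneg
      by (intro member_le_sum) (auto intro: add_nonneg_nonneg)
    finally show ?thesis .
  qed
  have Wm: "W \<in> sets (eucl_lebesgue n)" by (rule sets_openin_eucl[OF Wo])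
  have "(\<integral>\<^sup>+u. ennreal (indicator W u * jac u) \<partial>eucl_lebesgue n) \<le> (\<integral>\<^sup>+u. ennreal B * indicator W u \<partial>eucl_lebesgue n)"
    using B by (intro nn_integral_mono) (auto simp: indicator_def intro: ennreal_leI)
  also have "\<dots> = ennreal B * vol n W" using Wm by (simp add: nn_integral_cmult)
  also have "vol n W \<le> (\<Sum>x\<in>T. vol n (obox n x (d x)))"
    unfolding W_def by (rule emeasure_subadditive_finite[OF T(2)]) (intro image_subsetI sets_openin_eucl openin_obox)
  then have "ennreal B * vol n W \<le> ennreal B * (\<Sum>x\<in>T. vol n (obox n x (d x)))"
    by (rule mult_left_mono) simp
  also have "\<dots> < \<infinity>" using emeasure_obox_finite by (auto simp: ennreal_mult_less_top ennreal_sum_less_top[OF T(2)])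
  finally have "(\<integral>\<^sup>+u. ennreal (indicator W u * jac u) \<partial>eucl_lebesgue n) < \<infinity>" .
  moreover have "K \<subseteq> W" using F(3) T(3) unfolding W_def by blast
  moreover have "W \<subseteq> U" unfolding W_def using T(1) d(2) by blast
  ultimately show ?thesis using that Wo by blast
qed

text \<open>The bound for open neighbourhoods is applied to the sets \<open>V k\<close>, which
  decrease to the compact set \<open>K\<close>. Inside a neighbourhood of finite integral, the limit
  can be taken under the integral.\<close>

theorem emeasure_image_le:
  assumes K: "compactin (eucl n) K" "K \<subseteq> U"
  shows "vol n (f ` K) \<le> (\<integral>\<^sup>+u. ennreal (indicator K u * jac u) \<partial>eucl_lebesgue n)"
proof -
  obtain W where W: "openin (eucl n) W" "K \<subseteq> W" "W \<subseteq> U"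
    "(\<integral>\<^sup>+u. ennreal (indicator W u * jac u) \<partial>eucl_lebesgue n) < \<infinity>"
    using finite_integral_nbhd[OF K] .
  define V where "V k = W \<inter> (\<Union>x\<in>K. obox n x (1 / real (Suc k)))" for k
  have Vo: "openin (eucl n) (V k)" for k
    unfolding V_def by (intro openin_Int W(1) openin_Union) (use openin_obox in blast)
  have VW: "V k \<subseteq> W" for k unfolding V_def by blast
  have KV: "K \<subseteq> V k" for k
  proof
    fix x assume x: "x \<in> K"
    have "x \<in> obox n x (1 / real (Suc k))"
      unfolding obox_iff using compactin_eucl_extensional[OF K(1)] x by auto
    then show "x \<in> V k" using x W(2) unfolding V_def by blast
  qed
  have Vdec: "V m \<subseteq> V k" if "k \<le> m" for k m
  proof -
    have "1 / real (Suc m) \<le> 1 / real (Suc k)" using that by (simp add: frac_le)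
    then have "obox n x (1 / real (Suc m)) \<subseteq> obox n x (1 / real (Suc k))" for x
      by (rule obox_mono)
    then show ?thesis unfolding V_def by blast
  qed
  define F where "F k u = ennreal (indicator (V k) u * jac u)" for k u
  have Fm: "F k \<in> borel_measurable (eucl_lebesgue n)" for k
    unfolding F_def using measurable_indicator_jac[OF Vo order_trans[OF VW W(3)]] by measurable
  have "vol n (f ` K) \<le> (INF k. integral\<^sup>N (eucl_lebesgue n) (F k))"
    unfolding F_def using VW W(3) by (intro INF_greatest emeasure_image_le_open[OF K(1) Vo KV]) blast
  also have "\<dots> = (\<integral>\<^sup>+u. (INF k. F k u) \<partial>eucl_lebesgue n)"
  proof (rule nn_integral_monotone_convergence_INF_decseq[symmetric])
    show "decseq F"
    proof (intro decseq_def[THEN iffD2] allI impI le_funI)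
      fix k m :: nat and u assume "k \<le> m"
      then have "indicator (V m) u \<le> (indicator (V k) u :: real)"
        using Vdec by (intro indicator_leI) blast
      then show "F m u \<le> F k u"
        unfolding F_def by (intro ennreal_leI mult_right_mono jac_nonneg)
    qed
    have "indicator (V 0) u \<le> (indicator W u :: real)" for u
      using VW by (intro indicator_leI) blast
    then have "integral\<^sup>N (eucl_lebesgue n) (F 0) \<le> (\<integral>\<^sup>+u. ennreal (indicator W u * jac u) \<partial>eucl_lebesgue n)"
      unfolding F_def by (intro nn_integral_mono ennreal_leI mult_right_mono jac_nonneg)
    then show "integral\<^sup>N (eucl_lebesgue n) (F 0) < \<infinity>" using W(4) by (rule le_less_trans)
  qed (rule Fm)
  also have "\<dots> \<le> (\<integral>\<^sup>+u. ennreal (indicator K u * jac u) \<partial>eucl_lebesgue n)"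
  proof (rule nn_integral_mono)
    fix u assume "u \<in> space (eucl_lebesgue n)"
    then have ue: "u \<in> extensional {..<n}" by (simp add: space_eucl_lebesgue)
    show "(INF k. F k u) \<le> ennreal (indicator K u * jac u)"
    proof (cases "u \<in> K")
      case True
      have "(INF k. F k u) \<le> F 0 u" by (rule INF_lower) simp
      also have "\<dots> = ennreal (indicator K u * jac u)" using True KV[of 0] by (simp add: F_def subsetD)
      finally show ?thesis .
    next
      case False
      obtain d where d: "d > 0" "obox n u d \<inter> K = {}"
        using compactin_eucl_separation[OF K(1) ue False] .
      obtain k where k: "1 / real (Suc k) < d" using d(1) nat_approx_posE by blast
      have "u \<notin> V k"
      proof
        assume "u \<in> V k"
        then obtain x where x: "x \<in> K" "u \<in> obox n x (1 / real (Suc k))" unfolding V_def by blast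
        have "x \<in> obox n u d"
          using x(2) k compactin_eucl_extensional[OF K(1)] x(1) unfolding obox_iff
          by (metis abs_minus_commute less_trans subsetD)
        then show False using d(2) x(1) by blast
      qed
      have "(INF k. F k u) \<le> F k u" by (rule INF_lower) simp
      also have "\<dots> = 0" using \<open>u \<notin> V k\<close> by (simp add: F_def)
      finally show ?thesis by simp
    qed
  qed
  finally show ?thesis .
qed

end

section \<open>Gram determinants and minors\<close>

definition last_col_mat :: "nat \<Rightarrow> (nat \<Rightarrow> nat \<Rightarrow> real) \<Rightarrow> (nat \<Rightarrow> real) \<Rightarrow> real Matrix.mat" where
  "last_col_mat n L w = Matrix.mat n n (\<lambda>(i, j). if j < n - 1 then L i j else w i)"

text \<open>The generalized cross product of the first \<open>n - 1\<close> columns, a normal vector of their span.\<close>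

definition minor_vec :: "nat \<Rightarrow> (nat \<Rightarrow> nat \<Rightarrow> real) \<Rightarrow> nat \<Rightarrow> real" where
  "minor_vec n L i = cofactor (last_col_mat n L (\<lambda>_. 0)) i (n - 1)"

lemma last_col_mat_carrier [simp]: "last_col_mat n L w \<in> carrier_mat n n"
  by (simp add: last_col_mat_def)

lemma det_last_col_mat:
  assumes n: "n \<ge> 1"
  shows "Determinant.det (last_col_mat n L w) = (\<Sum>i<n. w i * minor_vec n L i)"
proof -
  have "Determinant.det (last_col_mat n L w) =
      (\<Sum>i<n. last_col_mat n L w $$ (i, n - 1) * cofactor (last_col_mat n L w) i (n - 1))"
    using n by (intro laplace_expansion_column) auto
  also have "\<dots> = (\<Sum>i<n. w i * minor_vec n L i)"
  proof (rule sum.cong)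
    fix i assume i: "i \<in> {..<n}"
    have "mat_delete (last_col_mat n L w) i (n - 1) = mat_delete (last_col_mat n L (\<lambda>_. 0)) i (n - 1)"
      using i n by (intro eq_matI) (auto simp: mat_delete_def last_col_mat_def)
    then have "cofactor (last_col_mat n L w) i (n - 1) = minor_vec n L i"
      by (simp add: minor_vec_def cofactor_def)
    moreover have "last_col_mat n L w $$ (i, n - 1) = w i" using i n by (simp add: last_col_mat_def)
    ultimately show "last_col_mat n L w $$ (i, n - 1) * cofactor (last_col_mat n L w) i (n - 1) = w i * minor_vec n L i"
      by simp
  qed simp
  finally show ?thesis .
qed

text \<open>Repeating column \<open>j\<close> as the last column makes the determinant
  vanish.\<close>

lemma minor_vec_orthogonal:
  assumes j: "j < n - 1"
  shows "(\<Sum>i<n. L i j * minor_vec n L i) = 0"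
proof -
  have "Determinant.det (last_col_mat n L (\<lambda>i. L i j)) = 0"
  proof (rule det_identical_columns[where n = n and i = j and j = "n - 1"])
    show "col (last_col_mat n L (\<lambda>i. L i j)) j = col (last_col_mat n L (\<lambda>i. L i j)) (n - 1)"
      using j by (intro eq_vecI) (auto simp: last_col_mat_def)
  qed (use j in auto)
  then show ?thesis using det_last_col_mat[of n L "\<lambda>i. L i j"] j by simp
qed

text \<open>If \<open>w\<close> is orthogonal to the columns of \<open>L\<close>, appending it as a
  last column gives a matrix \<open>M\<close> whose product \<open>transpose_mat M * M\<close> is
  block diagonal: the Gram matrix of \<open>L\<close> and the squared length of \<open>w\<close>.
  Both sides are the determinant of that product.\<close>

lemma det_gram_orthogonal:
  assumes n: "n \<ge> 1" and orth: "\<And>j. j < n - 1 \<Longrightarrow> (\<Sum>i<n. L i j * w i) = 0"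
  shows "(\<Sum>i<n. w i * minor_vec n L i)\<^sup>2 =
    Determinant.det (Matrix.mat (n - 1) (n - 1) (\<lambda>(j, k). \<Sum>i<n. L i j * L i k)) * (\<Sum>i<n. (w i)\<^sup>2)"
proof -
  define M where "M = last_col_mat n L w"
  define G where "G = Matrix.mat (n - 1) (n - 1) (\<lambda>(j, k). \<Sum>i<n. L i j * L i k)"
  have M: "M \<in> carrier_mat n n" and MT: "transpose_mat M \<in> carrier_mat n n" by (simp_all add: M_def)
  define N where "N = transpose_mat M * M"
  have N: "N \<in> carrier_mat n n" unfolding N_def by (rule mult_carrier_mat[OF MT M])
  have idx: "N $$ (j, k) = (\<Sum>i<n. M $$ (i, j) * M $$ (i, k))" if "j < n" "k < n" for j k
    unfolding N_def index_mult_mat_sum[OF MT M that]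
    using that M by (intro sum.cong) auto
  have last: "N $$ (i, n - 1) = (if i = n - 1 then \<Sum>i<n. (w i)\<^sup>2 else 0)" if i: "i < n" for i
  proof -
    have "N $$ (i, n - 1) = (\<Sum>k<n. (if i < n - 1 then L k i else w k) * w k)"
      unfolding idx[OF i, of "n - 1", simplified] using i n
      by (subst idx) (auto simp: M_def last_col_mat_def intro!: sum.cong)
    also have "\<dots> = (if i = n - 1 then \<Sum>i<n. (w i)\<^sup>2 else 0)"
    proof (cases "i = n - 1")
      case False
      then have "i < n - 1" using i by simp
      then show ?thesis using orth[of i] by simp
    qed (simp add: power2_eq_square)
    finally show ?thesis .
  qed
  have "(\<Sum>i<n. w i * minor_vec n L i)\<^sup>2 = Determinant.det (transpose_mat M) * Determinant.det M"
    using Determinant.det_transpose[OF M] det_last_col_mat[OF n, of L w] by (simp add: M_def power2_eq_square)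
  also have "\<dots> = Determinant.det N"
    unfolding N_def by (rule Determinant.det_mult[OF MT M, symmetric])
  also have "\<dots> = (\<Sum>i<n. N $$ (i, n - 1) * cofactor N i (n - 1))"
    using n by (intro laplace_expansion_column[OF N]) simp
  also have "\<dots> = (\<Sum>i<n. if i = n - 1 then (\<Sum>i<n. (w i)\<^sup>2) * cofactor N i (n - 1) else 0)"
    by (intro sum.cong) (auto simp only: last lessThan_iff mult_zero_left split: if_splits)
  also have "\<dots> = (\<Sum>i<n. (w i)\<^sup>2) * cofactor N (n - 1) (n - 1)"
    using n by (subst sum.delta) auto
  also have "cofactor N (n - 1) (n - 1) = Determinant.det (mat_delete N (n - 1) (n - 1))"
    by (simp add: cofactor_def)
  also have "mat_delete N (n - 1) (n - 1) = G"
  proof (rule eq_matI)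
    fix j k assume "j < dim_row G" "k < dim_col G"
    then have jk: "j < n - 1" "k < n - 1" by (auto simp: G_def)
    have "mat_delete N (n - 1) (n - 1) $$ (j, k) = N $$ (j, k)"
      using jk N by (simp add: mat_delete_def)
    also have "\<dots> = G $$ (j, k)"
      using jk by (subst idx) (auto simp: G_def M_def last_col_mat_def intro!: sum.cong)
    finally show "mat_delete N (n - 1) (n - 1) $$ (j, k) = G $$ (j, k)" .
  qed (use N in \<open>auto simp: G_def mat_delete_def\<close>)
  finally show ?thesis unfolding G_def by (simp add: mult.commute)
qed

text \<open>A case of Cauchy-Binet. The vector of minors is itself orthogonal to the columns, so
  \<open>det_gram_orthogonal\<close> applies to it and one factor cancels. If that vector is zero,
  another nonzero orthogonal vector forces the Gram determinant to be zero.\<close>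

lemma det_gram_eq_minors:
  assumes n: "n \<ge> 1"
  shows "Determinant.det (Matrix.mat (n - 1) (n - 1) (\<lambda>(j, k). \<Sum>i<n. L i j * L i k)) =
    (\<Sum>i<n. (minor_vec n L i)\<^sup>2)" (is "?G = ?C")
proof (cases "?C = 0")
  case False
  have "(\<Sum>i<n. minor_vec n L i * minor_vec n L i)\<^sup>2 = ?G * ?C"
    by (rule det_gram_orthogonal[OF n minor_vec_orthogonal])
  then have "?C * ?C = ?G * ?C" by (simp add: power2_eq_square)
  then show ?thesis using False by simp
next
  case True
  then have C0: "minor_vec n L i = 0" if "i < n" for i
    using that by (simp add: sum_nonneg_eq_0_iff)
  \<comment> \<open>With a zero last column the square matrix is singular; a kernel vector of its
    transpose is orthogonal to all columns of \<open>L\<close>.\<close>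
  let ?M = "last_col_mat n L (\<lambda>_. 0)"
  have "Determinant.det (transpose_mat ?M) = 0"
    using Determinant.det_transpose[of ?M n] det_last_col_mat[OF n, of L "\<lambda>_. 0"] by simp
  then obtain v where v: "v \<in> carrier_vec n" "v \<noteq> 0\<^sub>v n" "transpose_mat ?M *\<^sub>v v = 0\<^sub>v n"
    using det_0_iff_vec_prod_zero_field[of "transpose_mat ?M" n] by auto
  define w where "w i = vec_index v i" for i
  have orth: "(\<Sum>i<n. L i j * w i) = 0" if j: "j < n - 1" for j
  proof -
    have "vec_index (transpose_mat ?M *\<^sub>v v) j = (\<Sum>i<n. ?M $$ (i, j) * w i)"
      using j v(1) by (simp add: scalar_prod_def atLeast0LessThan w_def last_col_mat_def)
    also have "\<dots> = (\<Sum>i<n. L i j * w i)"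
      using j by (intro sum.cong) (auto simp: last_col_mat_def)
    finally show ?thesis using v(3) j by simp
  qed
  have "?G * (\<Sum>i<n. (w i)\<^sup>2) = (\<Sum>i<n. w i * minor_vec n L i)\<^sup>2"
    by (rule det_gram_orthogonal[OF n orth, symmetric])
  also have "\<dots> = 0" using C0 by simp
  finally have "?G * (\<Sum>i<n. (w i)\<^sup>2) = 0" .
  moreover have "(\<Sum>i<n. (w i)\<^sup>2) \<noteq> 0"
  proof
    assume "(\<Sum>i<n. (w i)\<^sup>2) = 0"
    then have "w i = 0" if "i < n" for i using that by (simp add: sum_nonneg_eq_0_iff)
    then have "v = 0\<^sub>v n" using v(1) by (intro eq_vecI) (auto simp: w_def)
    with v(2) show False by simp
  qed
  ultimately show ?thesis using True by simp
qed

section \<open>Volume swept by a piecewise smooth surface\<close>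

text \<open>The minus sign makes this the set of points \<open>x\<close> for which the segment from
  \<open>x\<close> to \<open>x + v\<close> meets \<open>S\<close>.\<close>

definition prism :: "nat \<Rightarrow> (nat \<Rightarrow> real) \<Rightarrow> (nat \<Rightarrow> real) set \<Rightarrow> (nat \<Rightarrow> real) set" where
  "prism n v S = (\<lambda>(y, t). \<lambda>i\<in>{..<n}. y i - t * v i) ` (S \<times> {0..1})"

lemma prism_UN: "prism n v (\<Union>p\<in>P. S p) = (\<Union>p\<in>P. prism n v (S p))"
  unfolding prism_def by blast

lemma compactin_prism:
  assumes "compactin (eucl n) S"
  shows "compactin (eucl n) (prism n v S)"
proof -
  have "continuous_map (prod_topology (eucl n) euclideanreal) (eucl n) (\<lambda>(y, t). \<lambda>i\<in>{..<n}. y i - t * v i)"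
  proof (rule continuous_map_euclI)
    fix i assume i: "i < n"
    have 1: "continuous_map (prod_topology (eucl n) euclideanreal) euclideanreal (\<lambda>p. fst p i)"
      using continuous_map_compose[OF continuous_map_fst continuous_map_eucl_coord[OF i], of euclideanreal]
      by (simp add: o_def)
    have "continuous_map (prod_topology (eucl n) euclideanreal) euclideanreal (\<lambda>p. fst p i - snd p * v i)"
      by (intro continuous_map_diff 1 continuous_map_real_mult continuous_map_snd) simp
    then show "continuous_map (prod_topology (eucl n) euclideanreal) euclideanreal
        (\<lambda>p. (case p of (y, t) \<Rightarrow> \<lambda>i\<in>{..<n}. y i - t * v i) i)"
      using i by (simp add: case_prod_beta)
  qed auto
  moreover have "compactin (prod_topology (eucl n) euclideanreal) (S \<times> {0..1})"
    using assms by (simp add: compactin_Times)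
  ultimately show ?thesis unfolding prism_def using image_compactin by blast
qed

locale parametrized_piece =
  fixes m :: nat and K U :: "(nat \<Rightarrow> real) set" and \<phi> :: "(nat \<Rightarrow> real) \<Rightarrow> nat \<Rightarrow> real"
  assumes compact_K: "compactin (eucl m) K" and open_U: "openin (eucl m) U" and K_sub_U: "K \<subseteq> U"
    and C1: "C1_on m (Suc m) U \<phi>"
begin

abbreviation pd :: "(nat \<Rightarrow> real) \<Rightarrow> nat \<Rightarrow> nat \<Rightarrow> real" where
  "pd u i j \<equiv> partial_deriv (\<lambda>u. \<phi> u i) j u"

lemma U_ext: "U \<subseteq> extensional {..<m}"
  using openin_subset[OF open_U] by (simp only: topspace_eucl)

lemma continuous_map_pd:
  "i < Suc m \<Longrightarrow> j < m \<Longrightarrow> continuous_map (subtopology (eucl m) U) euclideanreal (\<lambda>u. pd u i j)"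
  using C1 unfolding C1_on_def by (simp add: eta_contract_eq)

lemma pd_derivative:
  assumes "u \<in> U" "i < Suc m" "j < m"
  shows "((\<lambda>t. \<phi> (u(j := t)) i) has_real_derivative pd u i j) (at (u j))"
  using C1 assms unfolding C1_on_def partial_deriv_def
  by (metis DERIV_deriv_iff_real_differentiable)

definition cyl :: "(nat \<Rightarrow> real) set \<Rightarrow> (nat \<Rightarrow> real) set" where
  "cyl X = {w \<in> extensional {..<Suc m}. restrict w {..<m} \<in> X}"

lemma continuous_map_restrict_eucl: "continuous_map (eucl (Suc m)) (eucl m) (\<lambda>w. restrict w {..<m})"
  by (rule continuous_map_euclI) (simp_all add: continuous_map_eucl_coord)

lemma openin_cyl: "openin (eucl (Suc m)) (cyl U)"
  using openin_continuous_map_preimage[OF continuous_map_restrict_eucl open_U]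
  unfolding cyl_def by (simp only: topspace_eucl)

lemma continuous_map_cyl:
  assumes "continuous_map (subtopology (eucl m) U) euclideanreal g"
  shows "continuous_map (subtopology (eucl (Suc m)) (cyl U)) euclideanreal (\<lambda>w. g (restrict w {..<m}))"
proof -
  have "continuous_map (subtopology (eucl (Suc m)) (cyl U)) (subtopology (eucl m) U) (\<lambda>w. restrict w {..<m})"
    by (intro continuous_map_into_subtopology continuous_map_from_subtopology continuous_map_restrict_eucl)
      (auto simp: cyl_def)
  from continuous_map_compose[OF this assms] show ?thesis by (simp add: o_def)
qed

text \<open>Points of the cylinder over \<open>U\<close> carry the time parameter in the coordinate \<open>m\<close>.\<close>

definition sweep :: "(nat \<Rightarrow> real) \<Rightarrow> (nat \<Rightarrow> real) \<Rightarrow> nat \<Rightarrow> real" where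
  "sweep v w = (\<lambda>i\<in>{..<Suc m}. \<phi> (restrict w {..<m}) i - w m * v i)"

definition sweep' :: "(nat \<Rightarrow> real) \<Rightarrow> nat \<Rightarrow> nat \<Rightarrow> (nat \<Rightarrow> real) \<Rightarrow> real" where
  "sweep' v i j w = (if j < m then pd (restrict w {..<m}) i j else - v i)"

lemma C1_sweep: "C1_self_map (Suc m) (cyl U) (sweep v) (sweep' v)"
proof
  show "openin (eucl (Suc m)) (cyl U)" by (rule openin_cyl)
  fix i j assume i: "i < Suc m" and j: "j < Suc m"
  show "continuous_map (subtopology (eucl (Suc m)) (cyl U)) euclideanreal (sweep' v i j)"
  proof (cases "j < m")
    case True
    show ?thesis
      using continuous_map_cyl[OF continuous_map_pd[OF i True]] True by (simp add: sweep'_def[abs_def])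
  next
    case False
    then show ?thesis by (simp add: sweep'_def[abs_def])
  qed
  fix w assume w: "w \<in> cyl U"
  show "((\<lambda>t. sweep v (w(j := t)) i) has_real_derivative sweep' v i j w) (at (w j))"
  proof (cases "j < m")
    case True
    have upd: "restrict (w(j := t)) {..<m} = (restrict w {..<m})(j := t)" for t
      using True by (auto simp: restrict_def fun_eq_iff)
    have "((\<lambda>t. \<phi> ((restrict w {..<m})(j := t)) i) has_real_derivative pd (restrict w {..<m}) i j)
        (at ((restrict w {..<m}) j))"
      using w i True by (intro pd_derivative) (auto simp: cyl_def)
    then have "((\<lambda>t. \<phi> ((restrict w {..<m})(j := t)) i - w m * v i) has_real_derivative pd (restrict w {..<m}) i j - 0)
        (at (w j))"
      using True by (intro DERIV_diff) auto
    then show ?thesis using i True by (simp add: sweep_def sweep'_def upd)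
  next
    case False
    then have jm: "j = m" using j by simp
    have upd: "restrict (w(m := t)) {..<m} = restrict w {..<m}" for t
      by (auto simp: restrict_def fun_eq_iff)
    have "((\<lambda>t. \<phi> (restrict w {..<m}) i - t * v i) has_real_derivative - v i) (at (w m))"
      by (auto intro!: derivative_eq_intros)
    then show ?thesis using i by (simp add: sweep_def sweep'_def jm upd)
  qed
qed (simp add: sweep_def)

definition slab :: "(nat \<Rightarrow> real) set" where
  "slab = (\<lambda>(u, t). u(m := t)) ` (K \<times> {0..1})"

lemma slab_iff: "w \<in> slab \<longleftrightarrow> w \<in> cyl K \<and> 0 \<le> w m \<and> w m \<le> 1"
proof
  assume "w \<in> slab"
  then obtain u t where ut: "u \<in> K" "t \<in> {0..1}" "w = u(m := t)" unfolding slab_def by auto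
  have u: "u \<in> extensional {..<m}" using ut(1) K_sub_U U_ext by blast
  have "restrict w {..<m} = u" using u ut(3) by (auto simp: restrict_def extensional_def fun_eq_iff)
  then show "w \<in> cyl K \<and> 0 \<le> w m \<and> w m \<le> 1"
    using ut u by (auto simp: cyl_def extensional_def)
next
  assume w: "w \<in> cyl K \<and> 0 \<le> w m \<and> w m \<le> 1"
  have "w = (restrict w {..<m})(m := w m)"
    using w by (auto simp: cyl_def restrict_def extensional_def fun_eq_iff)
  moreover have "restrict w {..<m} \<in> K" using w by (simp add: cyl_def)
  ultimately show "w \<in> slab" unfolding slab_def using w by (auto intro!: image_eqI[of _ _ "(restrict w {..<m}, w m)"])
qed

lemma compactin_slab: "compactin (eucl (Suc m)) slab"
proof -
  have "continuous_map (prod_topology (eucl m) euclideanreal) (eucl (Suc m)) (\<lambda>(u, t). u(m := t))"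
  proof (rule continuous_map_euclI)
    fix i assume i: "i < Suc m"
    show "continuous_map (prod_topology (eucl m) euclideanreal) euclideanreal (\<lambda>p. (case p of (u, t) \<Rightarrow> u(m := t)) i)"
    proof (cases "i = m")
      case True
      then show ?thesis by (simp add: case_prod_beta continuous_map_snd)
    next
      case False
      then have "i < m" using i by simp
      from continuous_map_compose[OF continuous_map_fst continuous_map_eucl_coord[OF this], of euclideanreal] False
      show ?thesis by (simp add: case_prod_beta o_def)
    qed
  qed (auto simp: extensional_def PiE_iff)
  moreover have "compactin (prod_topology (eucl m) euclideanreal) (K \<times> {0..1})"
    using compact_K by (simp add: compactin_Times)
  ultimately show ?thesis unfolding slab_def using image_compactin by blast
qed

lemma sweep_slab: "sweep v ` slab = prism (Suc m) v (\<phi> ` K)"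
proof -
  have "sweep v (u(m := t)) = (\<lambda>i\<in>{..<Suc m}. \<phi> u i - t * v i)" if "u \<in> K" for u t
  proof -
    have "u \<in> extensional {..<m}" using that K_sub_U U_ext by blast
    then have "restrict (u(m := t)) {..<m} = u" by (auto simp: restrict_def extensional_def fun_eq_iff)
    then show ?thesis by (simp add: sweep_def)
  qed
  then show ?thesis unfolding slab_def prism_def by (force simp: image_iff)
qed

text \<open>A normal vector of the parametrized surface that is deliberately not normalized: its
  length is the area density.\<close>

definition nvec :: "(nat \<Rightarrow> real) \<Rightarrow> nat \<Rightarrow> real" where
  "nvec u = minor_vec (Suc m) (pd u)"

text \<open>The derivative of \<open>sweep v\<close> has the partial derivatives of
  \<open>\<phi>\<close> and \<open>- v\<close> as columns. Expansion along the last column gives the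
  inner product of \<open>v\<close> with \<open>nvec\<close> up to sign, and this does not depend on
  the time, which is integrated over \<open>{0..1}\<close>.\<close>

lemma emeasure_prism_le:
  "vol (Suc m) (prism (Suc m) v (\<phi> ` K)) \<le>
    (\<integral>\<^sup>+u. ennreal (indicator K u * \<bar>\<Sum>i<Suc m. v i * nvec u i\<bar>) \<partial>eucl_lebesgue m)"
proof -
  interpret sw: C1_self_map "Suc m" "cyl U" "sweep v" "sweep' v" by (rule C1_sweep)
  have slab_sub: "slab \<subseteq> cyl U" using slab_iff K_sub_U unfolding cyl_def by blast
  have jac: "sw.jac w = \<bar>\<Sum>i<Suc m. v i * nvec (restrict w {..<m}) i\<bar>" for w
  proof -
    have "Matrix.mat (Suc m) (Suc m) (\<lambda>(i, j). sweep' v i j w) =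
        last_col_mat (Suc m) (pd (restrict w {..<m})) (\<lambda>i. - v i)"
      by (intro eq_matI) (auto simp: last_col_mat_def sweep'_def)
    then have "sw.jac w = \<bar>\<Sum>i<Suc m. - v i * nvec (restrict w {..<m}) i\<bar>"
      unfolding sw.jac_def by (simp only: det_last_col_mat[of "Suc m"] nvec_def)
    also have "\<dots> = \<bar>\<Sum>i<Suc m. v i * nvec (restrict w {..<m}) i\<bar>"
      by (simp only: mult_minus_left sum_negf abs_minus_cancel)
    finally show ?thesis .
  qed
  have slabm: "slab \<in> sets (eucl_lebesgue (Suc m))" by (rule compactin_eucl_sets[OF compactin_slab])
  define F where "F w = ennreal (indicator slab w * sw.jac w)" for w
  have "(\<lambda>w. indicator slab w * (indicator (cyl U) w * sw.jac w)) \<in> borel_measurable (eucl_lebesgue (Suc m))"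
    using sw.measurable_indicator_jac[OF sw.openU order_refl] slabm by measurable
  moreover have "indicator slab w * (indicator (cyl U) w * sw.jac w) = indicator slab w * sw.jac w" for w
    using slab_sub by (auto simp: indicator_def)
  ultimately have Fm: "F \<in> borel_measurable (eucl_lebesgue (Suc m))" unfolding F_def by simp
  have set_eq: "{..<Suc m} = insert m {..<m}" by auto
  have "vol (Suc m) (prism (Suc m) v (\<phi> ` K)) \<le> integral\<^sup>N (eucl_lebesgue (Suc m)) F"
    unfolding sweep_slab[symmetric] F_def by (rule sw.emeasure_image_le[OF compactin_slab slab_sub])
  also have "\<dots> = (\<integral>\<^sup>+u. (\<integral>\<^sup>+t. F (u(m := t)) \<partial>lborel) \<partial>eucl_lebesgue m)"
    using Fm unfolding set_eq by (intro lb.product_nn_integral_insert) auto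
  also have "\<dots> = (\<integral>\<^sup>+u. ennreal (indicator K u * \<bar>\<Sum>i<Suc m. v i * nvec u i\<bar>) \<partial>eucl_lebesgue m)"
  proof (rule nn_integral_cong)
    fix u assume "u \<in> space (eucl_lebesgue m)"
    then have u: "u \<in> extensional {..<m}" by (simp add: space_eucl_lebesgue)
    have res: "restrict (u(m := t)) {..<m} = u" for t
      using u by (auto simp: restrict_def extensional_def fun_eq_iff)
    have ind: "indicator slab (u(m := t)) = (indicator K u * indicator {0..1} t :: real)" for t
      using u by (auto simp: indicator_def slab_iff cyl_def res extensional_def)
    have "(\<integral>\<^sup>+t. F (u(m := t)) \<partial>lborel) =
        (\<integral>\<^sup>+t. ennreal (indicator K u * \<bar>\<Sum>i<Suc m. v i * nvec u i\<bar>) * indicator {0..1::real} t \<partial>lborel)"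
    proof (rule nn_integral_cong)
      fix t :: real
      show "F (u(m := t)) = ennreal (indicator K u * \<bar>\<Sum>i<Suc m. v i * nvec u i\<bar>) * indicator {0..1} t"
        unfolding F_def jac ind res by (cases "t \<in> {0..1}") auto
    qed
    also have "\<dots> = ennreal (indicator K u * \<bar>\<Sum>i<Suc m. v i * nvec u i\<bar>)"
      by (subst nn_integral_cmult) auto
    finally show "(\<integral>\<^sup>+t. F (u(m := t)) \<partial>lborel) = ennreal (indicator K u * \<bar>\<Sum>i<Suc m. v i * nvec u i\<bar>)" .
  qed
  finally show ?thesis .
qed

lemma det_gram_matrix: "Determinant.det (gram_matrix (Suc m) \<phi> u) = (\<Sum>i<Suc m. (nvec u i)\<^sup>2)"
  using det_gram_eq_minors[of "Suc m" "pd u"] unfolding gram_matrix_def nvec_def by simp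

lemma continuous_map_nvec:
  assumes "i < Suc m"
  shows "continuous_map (subtopology (eucl m) U) euclideanreal (\<lambda>u. nvec u i)"
proof -
  \<comment> \<open>A unit vector as the last column makes the determinant pick out component
    \<open>i\<close> of \<open>nvec\<close>, so continuity follows from that of
    determinants.\<close>
  let ?e = "\<lambda>k. if k = i then 1 else 0 :: real"
  have "nvec u i = Determinant.det (Matrix.mat (Suc m) (Suc m) (\<lambda>(k, j). if j < m then pd u k j else ?e k))" for u
  proof -
    have "Determinant.det (last_col_mat (Suc m) (pd u) ?e) = (\<Sum>k<Suc m. ?e k * nvec u k)"
      unfolding nvec_def by (rule det_last_col_mat) simp
    also have "\<dots> = nvec u i"
      using assms by (simp add: if_distrib[of "\<lambda>a. a * _"] cong: if_cong del: sum.lessThan_Suc)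
    finally show ?thesis by (simp add: last_col_mat_def)
  qed
  moreover have "continuous_map (subtopology (eucl m) U) euclideanreal
      (\<lambda>u. Determinant.det (Matrix.mat (Suc m) (Suc m) (\<lambda>(k, j). if j < m then pd u k j else ?e k)))"
  proof (rule continuous_map_det)
    fix k j assume "k < Suc m" "j < Suc m"
    then show "continuous_map (subtopology (eucl m) U) euclideanreal (\<lambda>u. if j < m then pd u k j else ?e k)"
      using continuous_map_pd by (cases "j < m") auto
  qed
  ultimately show ?thesis by simp
qed

definition area_density :: "(nat \<Rightarrow> real) \<Rightarrow> real" where
  "area_density u = sqrt (\<Sum>i<Suc m. (nvec u i)\<^sup>2)"

lemma measurable_indicator_K:
  assumes "continuous_map (subtopology (eucl m) U) euclideanreal g"
  shows "(\<lambda>u. indicator K u * g u) \<in> borel_measurable (eucl_lebesgue m)"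
proof -
  have "(\<lambda>u. indicator K u * (indicator U u * g u)) \<in> borel_measurable (eucl_lebesgue m)"
    using borel_measurable_indicator_openin_eucl[OF open_U assms] compactin_eucl_sets[OF compact_K]
    by measurable
  moreover have "indicator K u * (indicator U u * g u) = indicator K u * g u" for u
    using K_sub_U by (auto simp: indicator_def)
  ultimately show ?thesis by simp
qed

lemma continuous_map_area_density: "continuous_map (subtopology (eucl m) U) euclideanreal area_density"
proof -
  have "continuous_map (subtopology (eucl m) U) euclideanreal (\<lambda>u. \<Sum>i<Suc m. nvec u i * nvec u i)"
    by (intro continuous_map_sum continuous_map_real_mult continuous_map_nvec) auto
  moreover have "continuous_map euclideanreal euclideanreal sqrt"
    by (simp add: continuous_on_real_sqrt)
  ultimately have "continuous_map (subtopology (eucl m) U) euclideanreal (sqrt \<circ> (\<lambda>u. \<Sum>i<Suc m. nvec u i * nvec u i))"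
    by (rule continuous_map_compose)
  then show ?thesis unfolding area_density_def by (simp add: o_def power2_eq_square)
qed

lemma area_density_nonneg: "area_density u \<ge> 0"
  by (simp add: area_density_def sum_nonneg del: sum.lessThan_Suc)

text \<open>\<open>piece_area\<close> is a Bochner integral and would be 0 for a non-integrable
  density. The density is continuous on the compact set \<open>K\<close>, hence bounded and
  integrable, so the value agrees with the nonnegative integral.\<close>

lemma piece_area_eq:
  "(\<integral>\<^sup>+u. ennreal (indicator K u * area_density u) \<partial>eucl_lebesgue m) = ennreal (piece_area (Suc m) K \<phi>)"
  "piece_area (Suc m) K \<phi> \<ge> 0"
proof -
  define g where "g u = indicator K u * area_density u" for u
  have gm: "g \<in> borel_measurable (eucl_lebesgue m)"
    unfolding g_def by (rule measurable_indicator_K[OF continuous_map_area_density])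
  have g0: "g u \<ge> 0" for u unfolding g_def by (simp add: area_density_nonneg)
  have pa: "piece_area (Suc m) K \<phi> = integral\<^sup>L (eucl_lebesgue m) g"
    unfolding piece_area_def set_lebesgue_integral_def g_def area_density_def det_gram_matrix by simp
  have "compactin (subtopology (eucl m) U) K" using compact_K K_sub_U by (simp add: compactin_subtopology)
  then have "compactin euclideanreal (area_density ` K)"
    by (rule image_compactin[OF _ continuous_map_area_density])
  then have "bounded (area_density ` K)" using compact_imp_bounded by auto
  then obtain B where B: "\<And>u. u \<in> K \<Longrightarrow> area_density u \<le> B" by (auto simp: bounded_iff abs_le_iff)
  have "(\<integral>\<^sup>+u. ennreal (g u) \<partial>eucl_lebesgue m) \<le> (\<integral>\<^sup>+u. ennreal B * indicator K u \<partial>eucl_lebesgue m)"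
    using B by (intro nn_integral_mono) (auto simp: g_def indicator_def intro: ennreal_leI)
  also have "\<dots> = ennreal B * vol m K"
    using compactin_eucl_sets[OF compact_K] by (simp add: nn_integral_cmult)
  also have "\<dots> < \<infinity>" using emeasure_compactin_eucl_finite[OF compact_K] by (simp add: ennreal_mult_less_top)
  finally have "integrable (eucl_lebesgue m) g"
    using gm g0 by (intro integrableI_nonneg) auto
  then have "(\<integral>\<^sup>+u. ennreal (g u) \<partial>eucl_lebesgue m) = ennreal (integral\<^sup>L (eucl_lebesgue m) g)"
    using g0 by (intro nn_integral_eq_integral) auto
  then show "(\<integral>\<^sup>+u. ennreal (indicator K u * area_density u) \<partial>eucl_lebesgue m) = ennreal (piece_area (Suc m) K \<phi>)"
    unfolding pa by (simp add: g_def)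
  show "piece_area (Suc m) K \<phi> \<ge> 0" unfolding pa using g0 by (rule Bochner_Integration.integral_nonneg)
qed

text \<open>Cauchy-Schwarz over the finite family \<open>\<Omega>\<close>, applied at each parameter
  \<open>u\<close> before integrating. \<open>\<sigma>\<close> bounds the total second moment, not
  the mean, hence the factor \<open>card \<Omega>\<close> under the root.\<close>

lemma sum_emeasure_prism_le:
  fixes v :: "'b \<Rightarrow> nat \<Rightarrow> real" and \<sigma> :: real
  assumes fin: "finite \<Omega>"
    and second: "\<And>c :: nat \<Rightarrow> real. (\<Sum>\<omega>\<in>\<Omega>. (\<Sum>i<Suc m. v \<omega> i * c i)\<^sup>2) \<le> \<sigma> * (\<Sum>i<Suc m. (c i)\<^sup>2)"
  shows "(\<Sum>\<omega>\<in>\<Omega>. vol (Suc m) (prism (Suc m) (v \<omega>) (\<phi> ` K))) \<le>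
    ennreal (sqrt (card \<Omega> * \<sigma>) * piece_area (Suc m) K \<phi>)"
proof -
  have meas: "(\<lambda>u. ennreal (indicator K u * \<bar>\<Sum>i<Suc m. v \<omega> i * nvec u i\<bar>)) \<in> borel_measurable (eucl_lebesgue m)" for \<omega>
  proof -
    have "continuous_map (subtopology (eucl m) U) euclideanreal (\<lambda>u. \<bar>\<Sum>i<Suc m. v \<omega> i * nvec u i\<bar>)"
      by (intro continuous_map_real_abs continuous_map_sum continuous_map_real_mult continuous_map_nvec) auto
    from measurable_indicator_K[OF this] show ?thesis by measurable
  qed
  have CS: "(\<Sum>\<omega>\<in>\<Omega>. \<bar>\<Sum>i<Suc m. v \<omega> i * c i\<bar>) \<le> sqrt (card \<Omega> * \<sigma>) * sqrt (\<Sum>i<Suc m. (c i)\<^sup>2)" for c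
  proof -
    have "(\<Sum>\<omega>\<in>\<Omega>. \<bar>\<Sum>i<Suc m. v \<omega> i * c i\<bar>)\<^sup>2 \<le> real (card \<Omega>) * (\<Sum>\<omega>\<in>\<Omega>. \<bar>\<Sum>i<Suc m. v \<omega> i * c i\<bar>\<^sup>2)"
      using sum_squared_le_sum_of_squares[of "\<lambda>\<omega>. \<bar>\<Sum>i<Suc m. v \<omega> i * c i\<bar>" \<Omega>]
      by (simp only: mult.commute)
    also have "\<dots> \<le> real (card \<Omega>) * (\<sigma> * (\<Sum>i<Suc m. (c i)\<^sup>2))"
      using second[of c] by (intro mult_left_mono) (simp_all only: power2_abs of_nat_0_le_iff)
    finally have "(\<Sum>\<omega>\<in>\<Omega>. \<bar>\<Sum>i<Suc m. v \<omega> i * c i\<bar>) \<le> sqrt (card \<Omega> * (\<sigma> * (\<Sum>i<Suc m. (c i)\<^sup>2)))"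
      by (rule real_le_rsqrt)
    then show ?thesis by (simp only: real_sqrt_mult mult.assoc)
  qed
  have "(\<Sum>\<omega>\<in>\<Omega>. vol (Suc m) (prism (Suc m) (v \<omega>) (\<phi> ` K))) \<le>
      (\<Sum>\<omega>\<in>\<Omega>. \<integral>\<^sup>+u. ennreal (indicator K u * \<bar>\<Sum>i<Suc m. v \<omega> i * nvec u i\<bar>) \<partial>eucl_lebesgue m)"
    by (intro sum_mono emeasure_prism_le)
  also have "\<dots> = (\<integral>\<^sup>+u. (\<Sum>\<omega>\<in>\<Omega>. ennreal (indicator K u * \<bar>\<Sum>i<Suc m. v \<omega> i * nvec u i\<bar>)) \<partial>eucl_lebesgue m)"
    by (rule nn_integral_sum[symmetric]) (rule meas)
  also have "\<dots> \<le> (\<integral>\<^sup>+u. ennreal (sqrt (card \<Omega> * \<sigma>)) * ennreal (indicator K u * area_density u) \<partial>eucl_lebesgue m)"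
  proof (rule nn_integral_mono)
    fix u
    have "(\<Sum>\<omega>\<in>\<Omega>. ennreal (indicator K u * \<bar>\<Sum>i<Suc m. v \<omega> i * nvec u i\<bar>)) =
        ennreal (\<Sum>\<omega>\<in>\<Omega>. indicator K u * \<bar>\<Sum>i<Suc m. v \<omega> i * nvec u i\<bar>)"
      by (rule sum_ennreal) simp
    also have "\<dots> \<le> ennreal (sqrt (card \<Omega> * \<sigma>) * (indicator K u * area_density u))"
    proof (rule ennreal_leI)
      have "(\<Sum>\<omega>\<in>\<Omega>. indicator K u * \<bar>\<Sum>i<Suc m. v \<omega> i * nvec u i\<bar>) =
          indicator K u * (\<Sum>\<omega>\<in>\<Omega>. \<bar>\<Sum>i<Suc m. v \<omega> i * nvec u i\<bar>)"
        by (simp only: sum_distrib_left)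
      also have "\<dots> \<le> indicator K u * (sqrt (card \<Omega> * \<sigma>) * area_density u)"
        unfolding area_density_def using CS[of "nvec u"] by (intro mult_left_mono) auto
      finally show "(\<Sum>\<omega>\<in>\<Omega>. indicator K u * \<bar>\<Sum>i<Suc m. v \<omega> i * nvec u i\<bar>) \<le>
          sqrt (card \<Omega> * \<sigma>) * (indicator K u * area_density u)"
        by (simp only: mult.left_commute)
    qed
    also have "\<dots> = ennreal (sqrt (card \<Omega> * \<sigma>)) * ennreal (indicator K u * area_density u)"
      by (rule ennreal_mult'') (simp add: area_density_nonneg)
    finally show "(\<Sum>\<omega>\<in>\<Omega>. ennreal (indicator K u * \<bar>\<Sum>i<Suc m. v \<omega> i * nvec u i\<bar>)) \<le>
        ennreal (sqrt (card \<Omega> * \<sigma>)) * ennreal (indicator K u * area_density u)" .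
  qed
  also have "\<dots> = ennreal (sqrt (card \<Omega> * \<sigma>)) * (\<integral>\<^sup>+u. ennreal (indicator K u * area_density u) \<partial>eucl_lebesgue m)"
  proof (rule nn_integral_cmult)
    show "(\<lambda>u. ennreal (indicator K u * area_density u)) \<in> borel_measurable (eucl_lebesgue m)"
      using measurable_indicator_K[OF continuous_map_area_density] by measurable
  qed
  also have "\<dots> = ennreal (sqrt (card \<Omega> * \<sigma>) * piece_area (Suc m) K \<phi>)"
    unfolding piece_area_eq(1) by (rule ennreal_mult''[symmetric]) (rule piece_area_eq(2))
  finally show ?thesis .
qed

end

lemma smooth_piece_parametrized:
  assumes "smooth_piece (Suc m) K \<phi>"
  obtains U where "parametrized_piece m K U \<phi>"
  using assms unfolding smooth_piece_def parametrized_piece_def by auto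

lemma sum_emeasure_prism_surface_le:
  fixes v :: "'b \<Rightarrow> nat \<Rightarrow> real" and \<sigma> :: real
  assumes n: "n \<ge> 1" and S: "has_surface_area n S A" and fin: "finite \<Omega>"
    and second: "\<And>c :: nat \<Rightarrow> real. (\<Sum>\<omega>\<in>\<Omega>. (\<Sum>i<n. v \<omega> i * c i)\<^sup>2) \<le> \<sigma> * (\<Sum>i<n. (c i)\<^sup>2)"
  shows "(\<Sum>\<omega>\<in>\<Omega>. vol n (prism n (v \<omega>) S)) \<le> ennreal (sqrt (card \<Omega> * \<sigma>) * A)"
    and "A \<ge> 0"
proof -
  obtain m where m: "n = Suc m" using n by (cases n) auto
  obtain N :: nat and K \<phi> where P0: "\<forall>p<N. smooth_piece n (K p) (\<phi> p)"
    and P: "S = (\<Union>p<N. \<phi> p ` K p)" "A = (\<Sum>p<N. piece_area n (K p) (\<phi> p))"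
    using S unfolding has_surface_area_def by blast
  have pos: "piece_area n (K p) (\<phi> p) \<ge> 0"
    and est: "(\<Sum>\<omega>\<in>\<Omega>. vol n (prism n (v \<omega>) (\<phi> p ` K p))) \<le>
      ennreal (sqrt (card \<Omega> * \<sigma>) * piece_area n (K p) (\<phi> p))"
    and meas: "prism n w (\<phi> p ` K p) \<in> sets (eucl_lebesgue n)" if p: "p < N" for p w
  proof -
    obtain U where U: "parametrized_piece m (K p) U (\<phi> p)"
      using smooth_piece_parametrized P0[rule_format, OF p] unfolding m by blast
    interpret parametrized_piece m "K p" U "\<phi> p" by (rule U)
    show "piece_area n (K p) (\<phi> p) \<ge> 0" unfolding m by (rule piece_area_eq(2))
    show "(\<Sum>\<omega>\<in>\<Omega>. vol n (prism n (v \<omega>) (\<phi> p ` K p))) \<le>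
        ennreal (sqrt (card \<Omega> * \<sigma>) * piece_area n (K p) (\<phi> p))"
      unfolding m by (rule sum_emeasure_prism_le[OF fin second[unfolded m]])
    interpret sw: C1_self_map "Suc m" "cyl U" "sweep w" "sweep' w" by (rule C1_sweep)
    have "slab \<subseteq> cyl U" using slab_iff K_sub_U unfolding cyl_def by blast
    then show "prism n w (\<phi> p ` K p) \<in> sets (eucl_lebesgue n)"
      unfolding m sweep_slab[symmetric] by (intro compactin_eucl_sets sw.compactin_image compactin_slab)
  qed
  show "A \<ge> 0" unfolding P(2) using pos by (intro sum_nonneg) auto
  have "(\<Sum>\<omega>\<in>\<Omega>. vol n (prism n (v \<omega>) S)) \<le>
      (\<Sum>\<omega>\<in>\<Omega>. \<Sum>p<N. vol n (prism n (v \<omega>) (\<phi> p ` K p)))"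
    unfolding P(1) prism_UN using meas by (intro sum_mono emeasure_subadditive_finite) auto
  also have "\<dots> = (\<Sum>p<N. \<Sum>\<omega>\<in>\<Omega>. vol n (prism n (v \<omega>) (\<phi> p ` K p)))"
    by (rule sum.swap)
  also have "\<dots> \<le> (\<Sum>p<N. ennreal (sqrt (card \<Omega> * \<sigma>) * piece_area n (K p) (\<phi> p)))"
    using est by (intro sum_mono) auto
  also have "\<dots> = (\<Sum>p<N. ennreal (sqrt (card \<Omega> * \<sigma>)) * ennreal (piece_area n (K p) (\<phi> p)))"
    using pos by (intro sum.cong ennreal_mult'') auto
  also have "\<dots> = ennreal (sqrt (card \<Omega> * \<sigma>)) * ennreal A"
    unfolding P(2) using pos by (subst sum_ennreal[symmetric]) (auto simp: sum_distrib_left)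
  also have "\<dots> = ennreal (sqrt (card \<Omega> * \<sigma>) * A)"
    using \<open>A \<ge> 0\<close> by (rule ennreal_mult''[symmetric])
  finally show "(\<Sum>\<omega>\<in>\<Omega>. vol n (prism n (v \<omega>) S)) \<le> ennreal (sqrt (card \<Omega> * \<sigma>) * A)" .
qed

section \<open>Symmetric tilings\<close>

definition unit_cube :: "nat \<Rightarrow> (nat \<Rightarrow> real) set" where
  "unit_cube n = PiE {..<n} (\<lambda>_. {0..<1})"

text \<open>By the sign convention of \<open>prism\<close>, these are the points \<open>x\<close>
  for which the segment from \<open>x\<close> to \<open>x + v\<close> meets some lattice translate
  of \<open>S\<close>.\<close>

definition hit_set :: "nat \<Rightarrow> (nat \<Rightarrow> real) set \<Rightarrow> (nat \<Rightarrow> real) \<Rightarrow> (nat \<Rightarrow> real) set" where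
  "hit_set n S v = (\<Union>z\<in>int_lattice n. translate n z (prism n v S))"

lemma countable_int_lattice: "countable (int_lattice n)"
  by (intro countable_PiE) auto

lemma sets_unit_cube: "unit_cube n \<in> sets (eucl_lebesgue n)"
  unfolding unit_cube_def by (intro sets_PiM_I_finite) auto

lemma emeasure_unit_cube: "vol n (unit_cube n) = 1"
  unfolding unit_cube_def using emeasure_eucl_half_open_cube[of 0 1 n "\<lambda>_. 0"] by simp

lemma translate_sets:
  assumes "B \<in> sets (eucl_lebesgue n)"
  shows "translate n z B \<in> sets (eucl_lebesgue n)"
    and "vol n (translate n z B) = vol n B"
  unfolding translate_def using emeasure_eucl_translate[OF assms] by auto

lemma translate_iff:
  assumes "B \<subseteq> extensional {..<n}"
  shows "x \<in> translate n z B \<longleftrightarrow> x \<in> extensional {..<n} \<and> (\<lambda>i\<in>{..<n}. x i - real_of_int (z i)) \<in> B"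
proof
  assume "x \<in> translate n z B"
  then obtain y where y: "y \<in> B" "x = (\<lambda>i\<in>{..<n}. y i + real_of_int (z i))" unfolding translate_def by blast
  have "(\<lambda>i\<in>{..<n}. x i - real_of_int (z i)) = y"
    using assms y by (intro extensionalityI[where A = "{..<n}"]) auto
  then show "x \<in> extensional {..<n} \<and> (\<lambda>i\<in>{..<n}. x i - real_of_int (z i)) \<in> B" using y by simp
next
  assume x: "x \<in> extensional {..<n} \<and> (\<lambda>i\<in>{..<n}. x i - real_of_int (z i)) \<in> B"
  have "x = (\<lambda>i\<in>{..<n}. (\<lambda>i\<in>{..<n}. x i - real_of_int (z i)) i + real_of_int (z i))"
    using x by (intro extensionalityI[where A = "{..<n}"]) auto
  then show "x \<in> translate n z B" unfolding translate_def using x by blast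
qed

text \<open>\<open>B\<close> is cut into the parts \<open>C z\<close> that translation by
  \<open>z\<close> moves into the unit cube. These parts are disjoint and translations preserve
  volume, so folding modulo the lattice can only lose volume through overlaps.\<close>

lemma emeasure_lattice_folding_le:
  assumes B: "B \<in> sets (eucl_lebesgue n)"
  shows "vol n ((\<Union>z\<in>int_lattice n. translate n z B) \<inter> unit_cube n) \<le> vol n B"
proof -
  let ?Z = "int_lattice n" and ?\<mu> = "eucl_lebesgue n"
  have Be: "B \<subseteq> extensional {..<n}" using sets.sets_into_space[OF B] by (simp add: space_eucl_lebesgue)
  have Qe: "unit_cube n \<subseteq> extensional {..<n}" unfolding unit_cube_def PiE_def by (rule Int_lower2)
  define C where "C z = {y \<in> B. (\<lambda>i\<in>{..<n}. y i + real_of_int (z i)) \<in> unit_cube n}" for z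
  have TC: "translate n z B \<inter> unit_cube n = translate n z (C z)" for z
    unfolding translate_def C_def by blast
  have Cm: "C z \<in> sets ?\<mu>" for z
  proof -
    have "C z = B \<inter> translate n (\<lambda>i. - z i) (unit_cube n)"
    proof (intro Set.set_eqI iffI)
      fix y assume "y \<in> C z"
      then show "y \<in> B \<inter> translate n (\<lambda>i. - z i) (unit_cube n)"
        unfolding C_def translate_iff[OF Qe] Int_iff using Be by (simp add: subset_eq)
    next
      fix y assume "y \<in> B \<inter> translate n (\<lambda>i. - z i) (unit_cube n)"
      then show "y \<in> C z" unfolding C_def translate_iff[OF Qe] Int_iff by simp
    qed
    then show ?thesis using translate_sets(1)[OF sets_unit_cube] B by simp
  qed
  have disj: "disjoint_family_on C ?Z"
    unfolding disjoint_family_on_def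
  proof (intro ballI impI)
    fix z z' assume z: "z \<in> ?Z" "z' \<in> ?Z" "z \<noteq> z'"
    have "False" if "y \<in> C z" "y \<in> C z'" for y
    proof -
      have "z i = z' i" if i: "i < n" for i
      proof -
        have "(\<lambda>i\<in>{..<n}. y i + real_of_int (z i)) i \<in> {0..<1}" "(\<lambda>i\<in>{..<n}. y i + real_of_int (z' i)) i \<in> {0..<1}"
          using \<open>y \<in> C z\<close> \<open>y \<in> C z'\<close> i unfolding C_def unit_cube_def by blast+
        then have "\<bar>real_of_int (z i) - real_of_int (z' i)\<bar> < 1" using i by auto
        then show ?thesis by linarith
      qed
      then show False using z by (metis PiE_ext lessThan_iff)
    qed
    then show "C z \<inter> C z' = {}" by blast
  qed
  have Tm: "translate n z (C z) \<in> sets ?\<mu>" for z by (rule translate_sets(1)[OF Cm])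
  have "emeasure ?\<mu> ((\<Union>z\<in>?Z. translate n z B) \<inter> unit_cube n) = emeasure ?\<mu> (\<Union>z\<in>?Z. translate n z (C z))"
    unfolding TC[symmetric] by (rule arg_cong[where f = "emeasure ?\<mu>"]) blast
  also have "\<dots> = (\<integral>\<^sup>+x. indicator (\<Union>z\<in>?Z. translate n z (C z)) x \<partial>?\<mu>)"
    using sets.countable_UN''[OF countable_int_lattice Tm] by simp
  also have "\<dots> \<le> (\<integral>\<^sup>+x. (\<integral>\<^sup>+z. indicator (translate n z (C z)) x \<partial>count_space ?Z) \<partial>?\<mu>)"
  proof (rule nn_integral_mono)
    fix x
    show "indicator (\<Union>z\<in>?Z. translate n z (C z)) x \<le> (\<integral>\<^sup>+z. indicator (translate n z (C z)) x \<partial>count_space ?Z)"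
    proof (cases "x \<in> (\<Union>z\<in>?Z. translate n z (C z))")
      case True
      then obtain z0 where z0: "z0 \<in> ?Z" "x \<in> translate n z0 (C z0)" by blast
      have "(1::ennreal) = (\<integral>\<^sup>+z. indicator {z0} z \<partial>count_space ?Z)"
        using z0(1) by (subst nn_integral_indicator) (auto simp: emeasure_count_space)
      also have "\<dots> \<le> (\<integral>\<^sup>+z. indicator (translate n z (C z)) x \<partial>count_space ?Z)"
        using z0 by (intro nn_integral_mono) (auto simp: indicator_def)
      finally show ?thesis using True by simp
    qed simp
  qed
  also have "\<dots> = (\<integral>\<^sup>+z. (\<integral>\<^sup>+x. indicator (translate n z (C z)) x \<partial>?\<mu>) \<partial>count_space ?Z)"
    using Tm by (intro nn_integral_count_space_nn_integral countable_int_lattice) auto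
  also have "\<dots> = (\<integral>\<^sup>+z. emeasure ?\<mu> (C z) \<partial>count_space ?Z)"
    using Tm translate_sets(2)[OF Cm] by (intro nn_integral_cong) simp
  also have "\<dots> = emeasure ?\<mu> (\<Union>z\<in>?Z. C z)"
    by (rule emeasure_UN_countable[symmetric, OF Cm countable_int_lattice disj])
  also have "\<dots> \<le> emeasure ?\<mu> B"
    using B by (intro emeasure_mono) (auto simp: C_def)
  finally show ?thesis .
qed

lemma sets_hit_set:
  assumes "compactin (eucl n) S"
  shows "hit_set n S v \<in> sets (eucl_lebesgue n)"
  unfolding hit_set_def
  by (intro sets.countable_UN'' countable_int_lattice translate_sets compactin_eucl_sets compactin_prism assms)

lemma emeasure_hit_set_le:
  assumes "compactin (eucl n) S"
  shows "vol n (hit_set n S v \<inter> unit_cube n) \<le> vol n (prism n v S)"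
  unfolding hit_set_def by (intro emeasure_lattice_folding_le compactin_eucl_sets compactin_prism assms)

section \<open>Interior points of a symmetric tiling body and lifts of segments\<close>

locale symmetric_tiling =
  fixes n :: nat and D :: "(nat \<Rightarrow> real) set"
  assumes tiling: "tiling_body n D" and symm: "symmetric_set n D"
begin

abbreviation inner :: "(nat \<Rightarrow> real) set" where "inner \<equiv> eucl n interior_of D"
abbreviation bdry :: "(nat \<Rightarrow> real) set" where "bdry \<equiv> eucl n frontier_of D"

lemma compact_D: "compactin (eucl n) D"
  using tiling by (simp add: tiling_body_def body_def)

lemma D_ext: "D \<subseteq> extensional {..<n}"
  by (rule compactin_eucl_extensional[OF compact_D])

lemma closure_D: "eucl n closure_of D = D"
  using compactin_eucl_closedin[OF compact_D] by (rule closure_of_closedin)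

lemma compact_bdry: "compactin (eucl n) bdry"
proof (rule closed_compactin[OF compact_D])
  show "bdry \<subseteq> D" unfolding frontier_of_def closure_D by blast
qed (rule closedin_frontier_of)

lemma inner_sub: "inner \<subseteq> D"
  by (rule interior_of_subset)

lemma inner_ext: "y \<in> inner \<Longrightarrow> y \<in> extensional {..<n}"
  using inner_sub D_ext by blast

lemma inner_permute:
  assumes pi: "\<pi> permutes {..<n}" and y: "y \<in> inner"
  shows "y \<circ> inv_into UNIV \<pi> \<in> inner"
proof -
  have ext: "x \<circ> \<sigma> \<in> extensional {..<n}" if "x \<in> extensional {..<n}" "\<sigma> permutes {..<n}" for x :: "nat \<Rightarrow> real" and \<sigma>
    using that by (auto simp: extensional_def permutes_def)
  have "continuous_map (eucl n) (eucl n) (\<lambda>x. x \<circ> \<pi>)"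
  proof (rule continuous_map_euclI)
    fix i assume "i < n"
    then have "\<pi> i < n" using permutes_in_image[OF pi, of i] by simp
    then show "continuous_map (eucl n) euclideanreal (\<lambda>x. (x \<circ> \<pi>) i)"
      by (simp add: continuous_map_eucl_coord)
  qed (use ext[OF _ pi] in \<open>simp only: topspace_eucl\<close>)
  from openin_continuous_map_preimage[OF this openin_interior_of]
  have "openin (eucl n) {x \<in> extensional {..<n}. x \<circ> \<pi> \<in> inner}" by (simp only: topspace_eucl)
  moreover have "{x \<in> extensional {..<n}. x \<circ> \<pi> \<in> inner} \<subseteq> D"
  proof
    fix x assume x: "x \<in> {x \<in> extensional {..<n}. x \<circ> \<pi> \<in> inner}"
    then have "x \<in> topspace (eucl n)" by (simp only: topspace_eucl mem_Collect_eq)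
    moreover have "x \<circ> \<pi> \<in> D" using x inner_sub by blast
    ultimately show "x \<in> D" using symm pi unfolding symmetric_set_def by blast
  qed
  ultimately have "{x \<in> extensional {..<n}. x \<circ> \<pi> \<in> inner} \<subseteq> inner" by (rule interior_of_maximal[rotated])
  moreover have "(y \<circ> inv_into UNIV \<pi>) \<circ> \<pi> = y"
    using permutes_inv_o(2)[OF pi] by (simp add: o_assoc[symmetric])
  ultimately show ?thesis using y ext[OF inner_ext[OF y] permutes_inv[OF pi]] by auto
qed

lemma inner_translate:
  assumes y: "y \<in> inner"
  shows "(\<lambda>i\<in>{..<n}. y i + real_of_int (w i)) \<in> eucl n interior_of translate n w D"
proof -
  let ?g = "\<lambda>x. \<lambda>i\<in>{..<n}. x i - real_of_int (w i)"
  have "continuous_map (eucl n) (eucl n) ?g"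
  proof (rule continuous_map_euclI)
    fix i assume i: "i < n"
    show "continuous_map (eucl n) euclideanreal (\<lambda>x. ?g x i)"
      using continuous_map_diff[OF continuous_map_eucl_coord[OF i], of "\<lambda>_. real_of_int (w i)"] i by simp
  qed simp
  from openin_continuous_map_preimage[OF this openin_interior_of]
  have "openin (eucl n) {x \<in> extensional {..<n}. ?g x \<in> inner}" by (simp only: topspace_eucl)
  moreover have "{x \<in> extensional {..<n}. ?g x \<in> inner} \<subseteq> translate n w D"
    using inner_sub by (auto simp: translate_iff[OF D_ext])
  ultimately have sub: "{x \<in> extensional {..<n}. ?g x \<in> inner} \<subseteq> eucl n interior_of translate n w D"
    by (rule interior_of_maximal[rotated])
  have "?g (\<lambda>i\<in>{..<n}. y i + real_of_int (w i)) = y"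
    using inner_ext[OF y] by (intro extensionalityI[where A = "{..<n}"]) auto
  then show ?thesis using y sub by auto
qed

lemma inner_coordinate_difference:
  assumes y: "y \<in> inner" and ij: "i < n" "j < n" "i \<noteq> j" and diff: "y i - y j = real_of_int k"
  shows "k = 0"
proof (rule ccontr)
  assume k: "k \<noteq> 0"
  define \<pi> where "\<pi> = Transposition.transpose i j"
  \<comment> \<open>Since \<open>y j = y i - k\<close>, swapping the two coordinates adds
    \<open>- k\<close> in position \<open>i\<close> and \<open>k\<close> in position
    \<open>j\<close>.\<close>
  define w :: "nat \<Rightarrow> int" where "w = (\<lambda>l\<in>{..<n}. if l = i then - k else if l = j then k else 0)"
  have pi: "\<pi> permutes {..<n}" unfolding \<pi>_def using ij by (intro permutes_swap_id) auto
  have "inv_into UNIV \<pi> = \<pi>" unfolding \<pi>_def by simp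
  then have "y \<circ> \<pi> \<in> inner" using inner_permute[OF pi y] by simp
  moreover have "y \<circ> \<pi> = (\<lambda>l\<in>{..<n}. y l + real_of_int (w l))"
  proof
    fix l
    show "(y \<circ> \<pi>) l = (\<lambda>l\<in>{..<n}. y l + real_of_int (w l)) l"
      using ij diff inner_ext[OF y] by (auto simp: \<pi>_def w_def transpose_def extensional_def)
  qed
  ultimately have 1: "(\<lambda>l\<in>{..<n}. y l + real_of_int (w l)) \<in> inner" by simp
  \<comment> \<open>The zero of \<open>int_lattice n\<close> has to be extensional; translation by
    it gives back \<open>D\<close>.\<close>
  define w0 where "w0 = (\<lambda>l\<in>{..<n}. 0 :: int)"
  have "translate n w0 D = D"
  proof
    show "translate n w0 D \<subseteq> D"
    proof
      fix x assume x: "x \<in> translate n w0 D"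
      have "(\<lambda>i\<in>{..<n}. x i - real_of_int (w0 i)) = x"
        using x unfolding translate_iff[OF D_ext] by (intro extensionalityI[where A = "{..<n}"]) (auto simp: w0_def)
      then show "x \<in> D" using x unfolding translate_iff[OF D_ext] by simp
    qed
    show "D \<subseteq> translate n w0 D"
    proof
      fix x assume x: "x \<in> D"
      have "(\<lambda>i\<in>{..<n}. x i - real_of_int (w0 i)) = x"
        using x D_ext by (intro extensionalityI[where A = "{..<n}"]) (auto simp: w0_def)
      then show "x \<in> translate n w0 D" using x D_ext unfolding translate_iff[OF D_ext] by auto
    qed
  qed
  then have 2: "(\<lambda>l\<in>{..<n}. y l + real_of_int (w l)) \<in> eucl n interior_of translate n w0 D" using 1 by simp
  have "w \<in> int_lattice n" "w0 \<in> int_lattice n" unfolding w_def w0_def by auto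
  moreover have "w \<noteq> w0"
  proof
    assume "w = w0"
    then have "w i = w0 i" by simp
    then show False using k ij by (simp add: w_def w0_def)
  qed
  ultimately have "eucl n interior_of translate n w D \<inter> eucl n interior_of translate n w0 D = {}"
    using tiling unfolding tiling_body_def disjoint_family_on_def by blast
  with 2 inner_translate[OF y, of w] show False by blast
qed

text \<open>The order of quantifiers matters: \<open>z\<close> is chosen before \<open>v\<close> and
  \<open>t\<close>, so what different directions reveal about \<open>z\<close> can be combined. The
  lifted segment starts in \<open>D\<close> and avoids the frontier, so by connectedness it stays in
  \<open>D\<close>, and thus in the interior.\<close>

lemma lattice_lift:
  assumes x: "x \<in> extensional {..<n}"
  obtains z :: "nat \<Rightarrow> int" where "\<And>v t. x \<notin> hit_set n bdry v \<Longrightarrow> 0 \<le> t \<Longrightarrow> t \<le> 1 \<Longrightarrow>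
    (\<lambda>i\<in>{..<n}. x i - real_of_int (z i) + t * v i) \<in> inner"
proof -
  have "x \<in> (\<Union>z\<in>int_lattice n. translate n z D)"
    using tiling x unfolding tiling_body_def topspace_eucl by simp
  then obtain z where z: "z \<in> int_lattice n" "x \<in> translate n z D" by blast
  define \<gamma> where "\<gamma> v t = (\<lambda>i\<in>{..<n}. x i - real_of_int (z i) + t * v i)" for v t
  show ?thesis
  proof (rule that)
    fix v :: "nat \<Rightarrow> real" and t :: real
    assume nh: "x \<notin> hit_set n bdry v" and t: "0 \<le> t" "t \<le> 1"
    have nb: "\<gamma> v s \<notin> bdry" if "0 \<le> s" "s \<le> 1" for s
    proof
      assume b: "\<gamma> v s \<in> bdry"
      have "(\<lambda>i\<in>{..<n}. \<gamma> v s i - s * v i) \<in> prism n v bdry"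
        unfolding prism_def using b that by (auto intro!: image_eqI[of _ _ "(\<gamma> v s, s)"])
      moreover have "x = (\<lambda>i\<in>{..<n}. (\<lambda>i\<in>{..<n}. \<gamma> v s i - s * v i) i + real_of_int (z i))"
        using x by (intro extensionalityI[where A = "{..<n}"]) (auto simp: \<gamma>_def)
      ultimately have "x \<in> translate n z (prism n v bdry)" unfolding translate_def by blast
      then show False using nh z(1) unfolding hit_set_def by blast
    qed
    have D0: "\<gamma> v 0 \<in> D"
      using z(2) unfolding translate_iff[OF D_ext] by (simp add: \<gamma>_def)
    have "continuous_map (top_of_set {0..1}) (eucl n) (\<gamma> v)"
    proof (rule continuous_map_euclI)
      fix i assume "i < n"
      moreover have "continuous_on {0..1} (\<lambda>t. x i - real_of_int (z i) + t * v i)"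
        by (intro continuous_intros)
      ultimately show "continuous_map (top_of_set {0..1}) euclideanreal (\<lambda>t. \<gamma> v t i)"
        by (simp add: \<gamma>_def)
    qed (simp add: \<gamma>_def)
    moreover have "connectedin (top_of_set {0..1::real}) {0..1}"
      by (simp add: connectedin_subtopology)
    ultimately have conn: "connectedin (eucl n) (\<gamma> v ` {0..1})"
      by (rule connectedin_continuous_map_image)
    have "\<gamma> v ` {0..1} \<inter> D \<noteq> {}" using D0 by force
    then have "\<gamma> v ` {0..1} - D = {}"
      using connectedin_Int_frontier_of[OF conn] nb by fastforce
    then have "\<gamma> v t \<in> D" using t by auto
    then have "\<gamma> v t \<in> inner" using nb[OF t] unfolding frontier_of_def closure_D by blast
    then show "(\<lambda>i\<in>{..<n}. x i - real_of_int (z i) + t * v i) \<in> inner" unfolding \<gamma>_def .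
  qed
qed

end

section \<open>A constant lower bound from two coordinate directions\<close>

context symmetric_tiling
begin

text \<open>Moving a single coordinate \<open>i\<close> up by a full unit meets every other
  coordinate \<open>j\<close> modulo 1. Without a hit the meeting must be exact, which means that
  \<open>y i < y j\<close> held at the start. This cannot hold for 0 and 1 in both orders.\<close>

lemma unit_cube_subset_hit_sets:
  assumes n: "n \<ge> 2"
  shows "unit_cube n \<subseteq> hit_set n bdry (\<lambda>i. if i = 0 then 1 else 0) \<union> hit_set n bdry (\<lambda>i. if i = 1 then 1 else 0)"
proof
  fix x assume "x \<in> unit_cube n"
  then have xe: "x \<in> extensional {..<n}" unfolding unit_cube_def PiE_def by blast
  obtain z :: "nat \<Rightarrow> int" where z: "\<And>v t. x \<notin> hit_set n bdry v \<Longrightarrow> 0 \<le> t \<Longrightarrow> t \<le> 1 \<Longrightarrow>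
    (\<lambda>i\<in>{..<n}. x i - real_of_int (z i) + t * v i) \<in> inner"
    using lattice_lift[OF xe] by blast
  define y where "y i = x i - real_of_int (z i)" for i
  have lt: "y i < y j" if ij: "i < n" "j < n" "i \<noteq> j" and nh: "x \<notin> hit_set n bdry (\<lambda>k. if k = i then 1 else 0)" for i j
  proof -
    \<comment> \<open>The only time in the interval from 0 (excluded) to 1 at which
      \<open>y i + t\<close> and \<open>y j\<close> agree modulo 1.\<close>
    define t where "t = y j - y i - real_of_int (\<lceil>y j - y i\<rceil> - 1)"
    have t: "0 < t" "t \<le> 1" unfolding t_def by linarith+
    have "(\<lambda>k\<in>{..<n}. y k + t * (if k = i then 1 else 0)) \<in> inner"
      using z[OF nh, of t] t unfolding y_def by simp
    then have "1 - \<lceil>y j - y i\<rceil> = 0"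
      by (rule inner_coordinate_difference[OF _ ij]) (use ij in \<open>simp add: t_def\<close>)
    then show ?thesis by linarith
  qed
  show "x \<in> hit_set n bdry (\<lambda>i. if i = 0 then 1 else 0) \<union> hit_set n bdry (\<lambda>i. if i = 1 then 1 else 0)"
  proof (rule ccontr)
    assume "x \<notin> hit_set n bdry (\<lambda>i. if i = 0 then 1 else 0) \<union> hit_set n bdry (\<lambda>i. if i = 1 then 1 else 0)"
    then have "y 0 < y 1" "y 1 < y 0" using lt[of 0 1] lt[of 1 0] n by simp_all
    then show False by simp
  qed
qed

text \<open>The two directions together cover the whole cube, and being orthonormal they have second
  moment bound 1, whence \<open>1 \<le> sqrt 2 * A\<close>. This serves the dimensions with
  \<open>ln n\<close> below 16.\<close>

lemma surface_area_ge_half: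
  assumes n: "n \<ge> 2" and A: "has_surface_area n bdry A"
  shows "A \<ge> 1 / 2"
proof -
  define v :: "nat \<Rightarrow> nat \<Rightarrow> real" where "v \<omega> i = (if i = \<omega> then 1 else 0)" for \<omega> i
  have "(\<Sum>\<omega>\<in>{0, 1}. vol n (prism n (v \<omega>) bdry)) \<le> ennreal (sqrt (real (card {0, 1 :: nat}) * 1) * A)"
  proof (rule sum_emeasure_prism_surface_le(1)[OF _ A])
    fix c :: "nat \<Rightarrow> real"
    have "(\<Sum>i<n. v \<omega> i * c i) = c \<omega>" if "\<omega> \<in> {0, 1}" for \<omega>
      using that n unfolding v_def by (auto simp: if_distrib[of "\<lambda>a. a * _"] cong: if_cong)
    then have "(\<Sum>\<omega>\<in>{0, 1}. (\<Sum>i<n. v \<omega> i * c i)\<^sup>2) = (\<Sum>\<omega>\<in>{0, 1}. (c \<omega>)\<^sup>2)"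
      by (intro sum.cong) auto
    also have "\<dots> \<le> (\<Sum>i<n. (c i)\<^sup>2)" using n by (intro sum_mono2) auto
    finally show "(\<Sum>\<omega>\<in>{0, 1}. (\<Sum>i<n. v \<omega> i * c i)\<^sup>2) \<le> 1 * (\<Sum>i<n. (c i)\<^sup>2)" by simp
  qed (use n in auto)
  then have est: "vol n (prism n (v 0) bdry) + vol n (prism n (v 1) bdry) \<le> ennreal (sqrt 2 * A)"
    by simp
  have "unit_cube n \<subseteq> (hit_set n bdry (v 0) \<inter> unit_cube n) \<union> (hit_set n bdry (v 1) \<inter> unit_cube n)"
    using unit_cube_subset_hit_sets[OF n] unfolding v_def by blast
  then have "vol n (unit_cube n) \<le>
      vol n ((hit_set n bdry (v 0) \<inter> unit_cube n) \<union> (hit_set n bdry (v 1) \<inter> unit_cube n))"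
    by (intro emeasure_mono) (auto intro: sets_hit_set[OF compact_bdry] sets_unit_cube)
  also have "\<dots> \<le> vol n (hit_set n bdry (v 0) \<inter> unit_cube n) + vol n (hit_set n bdry (v 1) \<inter> unit_cube n)"
    by (intro emeasure_subadditive sets.Int sets_hit_set[OF compact_bdry] sets_unit_cube)
  also have "\<dots> \<le> vol n (prism n (v 0) bdry) + vol n (prism n (v 1) bdry)"
    by (intro add_mono emeasure_hit_set_le compact_bdry)
  also note est
  finally have "1 \<le> sqrt 2 * A"
    by (simp add: emeasure_unit_cube ennreal_1[symmetric] ennreal_le_iff2 del: ennreal_1)
  moreover have "A \<ge> 0" by (rule sum_emeasure_prism_surface_le(2)[OF _ A, of "{} :: nat set" "\<lambda>_ _. 0" 0]) (use n in auto)
  moreover have "sqrt 2 \<le> 2" by (rule real_le_lsqrt) auto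
  ultimately show ?thesis using mult_right_mono[of "sqrt 2" 2 A] by linarith
qed

end

text \<open>A common partner \<open>k\<close> in the preceding arc for any two members of an arc
  makes \<open>z\<close> constant on every arc. Passing from arc to arc then keeps the value, except
  that closing the circle adds 1, a contradiction.\<close>

lemma circle_no_winding:
  fixes J :: "nat \<Rightarrow> 'a set" and z :: "'a \<Rightarrow> int"
  assumes N: "N \<ge> 1" and ne: "\<And>a. a < N \<Longrightarrow> J a \<noteq> {}"
    and step: "\<And>a i j. a < N \<Longrightarrow> i \<in> J (Suc a mod N) \<Longrightarrow> j \<in> J (Suc a mod N) \<Longrightarrow>
      \<exists>k\<in>J a. z k = z i + (if Suc a = N then 1 else 0) \<and> z k = z j + (if Suc a = N then 1 else 0)"
  shows False
proof -
  define rep where "rep a = (SOME i. i \<in> J a)" for a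
  have rep: "rep a \<in> J a" if "a < N" for a unfolding rep_def using ne[OF that] by (rule some_in_eq[THEN iffD2])
  have const: "z i = z j" if ij: "i \<in> J a" "j \<in> J a" and a: "a < N" for i j a
  proof -
    obtain a' where a': "a' < N" "Suc a' mod N = a"
    proof (cases a)
      case 0
      then show ?thesis using that[of "N - 1"] N by simp
    next
      case (Suc b)
      then show ?thesis using that[of b] a by simp
    qed
    have "\<exists>k\<in>J a'. z k = z i + (if Suc a' = N then 1 else 0) \<and> z k = z j + (if Suc a' = N then 1 else 0)"
      using step[OF a'(1), of i j] ij a'(2) by simp
    then show ?thesis by auto
  qed
  have nxt: "z (rep a) = z (rep (Suc a mod N)) + (if Suc a = N then 1 else 0)" if a: "a < N" for a
  proof -
    have r: "rep (Suc a mod N) \<in> J (Suc a mod N)" using N by (intro rep) simp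
    obtain k where k: "k \<in> J a" "z k = z (rep (Suc a mod N)) + (if Suc a = N then 1 else 0)"
      using step[OF a r r] by blast
    show ?thesis using const[OF rep[OF a] k(1) a] k(2) by simp
  qed
  have "z (rep a) = z (rep 0)" if "a < N" for a
    using that
  proof (induction a)
    case (Suc a)
    then show ?case using nxt[of a] by simp
  qed simp
  from this[of "N - 1"] nxt[of "N - 1"] N show False by simp
qed

section \<open>Random directions and their moments\<close>

definition sign_of :: "nat \<Rightarrow> real" where
  "sign_of a = (if a = 0 then 1 else if a = 1 then -1 else 0)"

text \<open>The probability space of the directions, with uniform counting: through
  \<open>sign_of\<close>, one of \<open>r\<close> equally likely values per coordinate yields +1 and
  -1 with weight \<open>1 / r\<close> each and rest otherwise. Expectations become finite sums
  divided by the cardinality.\<close>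

abbreviation choices :: "nat \<Rightarrow> nat \<Rightarrow> (nat \<Rightarrow> nat) set" where
  "choices n r \<equiv> PiE {..<n} (\<lambda>_. {..<r})"

lemma finite_choices: "finite (choices n r)"
  by (intro finite_PiE) auto

lemma card_choices: "card (choices n r) = r ^ n"
  by (simp add: card_PiE)

lemma sum_sign_of: "r \<ge> 2 \<Longrightarrow> (\<Sum>a<r. sign_of a) = 0"
  and sum_sign_of_sq: "r \<ge> 2 \<Longrightarrow> (\<Sum>a<r. (sign_of a)\<^sup>2) = 2"
proof -
  assume r: "r \<ge> 2"
  have eq: "{..<r} = {0, 1} \<union> {2..<r}" using r by auto
  show "(\<Sum>a<r. sign_of a) = 0"
    unfolding eq by (subst sum.union_disjoint) (auto simp: sign_of_def)
  show "(\<Sum>a<r. (sign_of a)\<^sup>2) = 2"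
    unfolding eq by (subst sum.union_disjoint) (auto simp: sign_of_def)
qed

text \<open>Distinct coordinates are independent with mean 0, and a single one has variance
  \<open>2 / r\<close>. The summand is written as a product of \<open>F k\<close> over all
  coordinates, so that the sum over choices factorizes.\<close>

lemma sum_choices_sign:
  assumes r: "r \<ge> 2" and i: "i < n" and j: "j < n"
  shows "(\<Sum>\<omega>\<in>choices n r. sign_of (\<omega> i) * sign_of (\<omega> j)) = (if i = j then 2 / r * card (choices n r) else 0)"
proof (cases "i = j")
  case False
  define F where "F k a = (if k = i \<or> k = j then sign_of a else 1)" for k a :: nat
  have "(\<Sum>\<omega>\<in>choices n r. sign_of (\<omega> i) * sign_of (\<omega> j)) = (\<Sum>\<omega>\<in>choices n r. \<Prod>k<n. F k (\<omega> k))"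
  proof (rule sum.cong)
    fix \<omega>
    have "(\<Prod>k<n. F k (\<omega> k)) = F i (\<omega> i) * (F j (\<omega> j) * (\<Prod>k\<in>{..<n} - {i} - {j}. F k (\<omega> k)))"
      using i j False by (subst prod.remove[of _ i], simp, simp, subst prod.remove[of _ j]) auto
    also have "(\<Prod>k\<in>{..<n} - {i} - {j}. F k (\<omega> k)) = 1"
      by (rule prod.neutral) (auto simp: F_def)
    finally show "sign_of (\<omega> i) * sign_of (\<omega> j) = (\<Prod>k<n. F k (\<omega> k))" by (simp add: F_def)
  qed simp
  also have "\<dots> = (\<Prod>k<n. \<Sum>a<r. F k a)" by (rule prod_sum_PiE[symmetric]) auto
  also have "\<dots> = 0"
    using i sum_sign_of[OF r] by (intro prod_zero) (auto simp: F_def intro!: bexI[of _ i])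
  finally show ?thesis using False by simp
next
  case True
  define F where "F k a = (if k = i then (sign_of a)\<^sup>2 else 1)" for k a :: nat
  have "(\<Sum>\<omega>\<in>choices n r. sign_of (\<omega> i) * sign_of (\<omega> j)) = (\<Sum>\<omega>\<in>choices n r. \<Prod>k<n. F k (\<omega> k))"
  proof (rule sum.cong)
    fix \<omega>
    have "(\<Prod>k<n. F k (\<omega> k)) = F i (\<omega> i) * (\<Prod>k\<in>{..<n} - {i}. F k (\<omega> k))"
      using i by (subst prod.remove[of _ i]) auto
    also have "(\<Prod>k\<in>{..<n} - {i}. F k (\<omega> k)) = 1"
      by (rule prod.neutral) (auto simp: F_def)
    finally show "sign_of (\<omega> i) * sign_of (\<omega> j) = (\<Prod>k<n. F k (\<omega> k))"
      using True by (simp add: F_def power2_eq_square)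
  qed simp
  also have "\<dots> = (\<Prod>k<n. \<Sum>a<r. F k a)" by (rule prod_sum_PiE[symmetric]) auto
  also have "\<dots> = (\<Sum>a<r. F i a) * (\<Prod>k\<in>{..<n} - {i}. \<Sum>a<r. F k a)"
    using i by (subst prod.remove[of _ i]) auto
  also have "(\<Sum>a<r. F i a) = 2" using sum_sign_of_sq[OF r] by (simp add: F_def)
  also have "(\<Prod>k\<in>{..<n} - {i}. \<Sum>a<r. F k a) = (\<Prod>k\<in>{..<n} - {i}. real r)"
    by (intro prod.cong) (auto simp: F_def)
  also have "\<dots> = real r ^ (n - 1)" using i by simp
  also have "2 * real r ^ (n - 1) = 2 / r * card (choices n r)"
    using i r by (cases n) (auto simp: card_choices field_simps)
  finally show ?thesis using True by simp
qed

lemma sum_choices_inner_product_sq: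
  fixes c :: "nat \<Rightarrow> real"
  assumes r: "r \<ge> 2"
  shows "(\<Sum>\<omega>\<in>choices n r. (\<Sum>i<n. s * sign_of (\<omega> i) * c i)\<^sup>2) = 2 / r * card (choices n r) * s\<^sup>2 * (\<Sum>i<n. (c i)\<^sup>2)"
proof -
  have "(\<Sum>\<omega>\<in>choices n r. (\<Sum>i<n. s * sign_of (\<omega> i) * c i)\<^sup>2) =
      (\<Sum>\<omega>\<in>choices n r. \<Sum>i<n. \<Sum>j<n. s\<^sup>2 * (c i * c j) * (sign_of (\<omega> i) * sign_of (\<omega> j)))"
    unfolding power2_eq_square sum_product by (intro sum.cong refl) (simp add: mult_ac)
  also have "\<dots> = (\<Sum>i<n. \<Sum>j<n. s\<^sup>2 * (c i * c j) * (\<Sum>\<omega>\<in>choices n r. sign_of (\<omega> i) * sign_of (\<omega> j)))"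
    unfolding sum_distrib_left by (subst sum.swap) (intro sum.cong refl, rule sum.swap)
  also have "\<dots> = (\<Sum>i<n. \<Sum>j<n. if j = i then s\<^sup>2 * (c i * c j) * (2 / r * card (choices n r)) else 0)"
    by (intro sum.cong refl) (use sum_choices_sign[OF r] in auto)
  also have "\<dots> = (\<Sum>i<n. s\<^sup>2 * (c i * c i) * (2 / r * card (choices n r)))"
    by (intro sum.cong refl) (subst sum.delta, auto)
  also have "\<dots> = 2 / r * card (choices n r) * s\<^sup>2 * (\<Sum>i<n. (c i)\<^sup>2)"
    by (simp add: sum_distrib_left sum_divide_distrib power2_eq_square mult_ac)
  finally show ?thesis .
qed

text \<open>The coordinate moves exactly if \<open>\<omega> i < 2\<close>, and the indicator of this
  event is the square of its sign, so the count is a second moment.\<close>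

lemma card_choices_small:
  assumes r: "r \<ge> 2" and i: "i < n"
  shows "real (card {\<omega> \<in> choices n r. \<omega> i < 2}) = 2 / r * card (choices n r)"
proof -
  have "real (card {\<omega> \<in> choices n r. \<omega> i < 2}) = (\<Sum>\<omega>\<in>choices n r. if \<omega> i < 2 then 1 else 0)"
    using finite_choices by (subst sum.inter_filter[symmetric]) auto
  also have "\<dots> = (\<Sum>\<omega>\<in>choices n r. sign_of (\<omega> i) * sign_of (\<omega> i))"
    by (intro sum.cong) (auto simp: sign_of_def)
  also have "\<dots> = 2 / r * card (choices n r)" using sum_choices_sign[OF r i i] by simp
  finally show ?thesis .
qed

lemma card_choices_avoid:
  assumes r: "r \<ge> 1" and J: "J \<subseteq> {..<n}"
  shows "real (card {\<omega> \<in> choices n r. \<forall>k\<in>J. \<omega> k \<noteq> 0}) = (1 - 1 / r) ^ card J * card (choices n r)"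
proof -
  have "{\<omega> \<in> choices n r. \<forall>k\<in>J. \<omega> k \<noteq> 0} = PiE {..<n} (\<lambda>k. if k \<in> J then {1..<r} else {..<r})"
  proof (intro Set.set_eqI iffI)
    fix \<omega> assume w: "\<omega> \<in> {\<omega> \<in> choices n r. \<forall>k\<in>J. \<omega> k \<noteq> 0}"
    show "\<omega> \<in> PiE {..<n} (\<lambda>k. if k \<in> J then {1..<r} else {..<r})"
    proof (rule PiE_I)
      fix k assume k: "k \<in> {..<n}"
      have "\<omega> k \<in> {..<r}" using w k by blast
      then show "\<omega> k \<in> (if k \<in> J then {1..<r} else {..<r})" using w by (auto simp: Suc_le_eq)
    next
      fix k assume "k \<notin> {..<n}"
      moreover have "\<omega> \<in> choices n r" using w by blast
      ultimately show "\<omega> k = undefined" by (rule PiE_arb[rotated])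
    qed
  next
    fix \<omega> assume w: "\<omega> \<in> PiE {..<n} (\<lambda>k. if k \<in> J then {1..<r} else {..<r})"
    have "\<omega> \<in> choices n r" using w by (rule subsetD[OF PiE_mono, rotated]) auto
    moreover have "\<omega> k \<noteq> 0" if "k \<in> J" for k
    proof -
      have "\<omega> k \<in> (if k \<in> J then {1..<r} else {..<r})" using w that J by blast
      then show ?thesis using that by simp
    qed
    ultimately show "\<omega> \<in> {\<omega> \<in> choices n r. \<forall>k\<in>J. \<omega> k \<noteq> 0}" by blast
  qed
  then have "card {\<omega> \<in> choices n r. \<forall>k\<in>J. \<omega> k \<noteq> 0} = (\<Prod>k<n. if k \<in> J then r - 1 else r)"
    by (simp add: card_PiE if_distrib[of card] cong: if_cong)
  also have "real \<dots> = (\<Prod>k<n. (if k \<in> J then 1 - 1 / real r else 1) * real r)"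
    unfolding of_nat_prod using r by (intro prod.cong) (auto simp: field_simps of_nat_diff)
  also have "\<dots> = (\<Prod>k<n. if k \<in> J then 1 - 1 / real r else 1) * real r ^ n"
    by (simp add: prod.distrib)
  also have "(\<Prod>k<n. if k \<in> J then 1 - 1 / real r else 1) = (1 - 1 / r) ^ card J"
    using J by (subst prod.inter_restrict[symmetric]) (auto simp: Int_absorb1)
  finally show ?thesis by (simp add: card_choices)
qed

definition arc :: "nat \<Rightarrow> nat \<Rightarrow> (nat \<Rightarrow> real) \<Rightarrow> nat \<Rightarrow> nat set" where
  "arc n N x a = {k. k < n \<and> real a / N \<le> x k \<and> x k < (real a + 1) / N}"

section \<open>Hits for points whose arcs are all well filled\<close>

context symmetric_tiling
begin

text \<open>If fewer than half of the choices hit, then for each arc and each pair in the next arc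
  some choice misses the boundary, keeps the pair at rest and moves some \<open>k\<close> of the arc
  upwards; \<open>circle_no_winding\<close> excludes this. The hypothesis on \<open>r\<close> gives
  \<open>2 / r \<le> 1 / 8\<close> for each static coordinate, and the one on \<open>m\<close>
  bounds the proportion without a mover by
  \<open>(1 - 1 / r) ^ m \<le> exp (- 2) \<le> 1 / 4\<close>.\<close>

lemma half_of_choices_hit:
  assumes x: "x \<in> unit_cube n" and N: "N \<ge> 1" and r: "r \<ge> 16" and m: "m \<ge> 2 * r"
    and arcs: "\<And>a. a < N \<Longrightarrow> card (arc n N x a) \<ge> m"
  shows "card (choices n r) \<le> 2 * card {\<omega> \<in> choices n r. x \<in> hit_set n bdry (\<lambda>i. 2 / N * sign_of (\<omega> i))}"
proof (rule ccontr)
  let ?\<Omega> = "choices n r"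
  let ?v = "\<lambda>\<omega> i. 2 / N * sign_of (\<omega> i)"
  define Hit where "Hit = {\<omega> \<in> ?\<Omega>. x \<in> hit_set n bdry (?v \<omega>)}"
  assume "\<not> card ?\<Omega> \<le> 2 * card {\<omega> \<in> ?\<Omega>. x \<in> hit_set n bdry (?v \<omega>)}"
  then have half: "real (card Hit) < card ?\<Omega> / 2" unfolding Hit_def by simp
  have xe: "x \<in> extensional {..<n}" using x unfolding unit_cube_def PiE_def by blast
  have x01: "0 \<le> x k" "x k < 1" if "k < n" for k
  proof -
    have "x k \<in> {0..<1}" using x that unfolding unit_cube_def by blast
    then show "0 \<le> x k" "x k < 1" by auto
  qed
  obtain z :: "nat \<Rightarrow> int" where z: "\<And>v t. x \<notin> hit_set n bdry v \<Longrightarrow> 0 \<le> t \<Longrightarrow> t \<le> 1 \<Longrightarrow>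
    (\<lambda>i\<in>{..<n}. x i - real_of_int (z i) + t * v i) \<in> inner"
    using lattice_lift[OF xe] by blast
  have arc_n: "arc n N x a \<subseteq> {..<n}" for a unfolding arc_def by auto
  have finarc: "finite (arc n N x a)" for a using arc_n finite_subset by blast
  have Npos: "real N > 0" using N by simp
  have collide: "z k = z i + (if Suc a = N then 1 else 0)"
    if a: "a < N" and k: "k \<in> arc n N x a" and i: "i \<in> arc n N x (Suc a mod N)"
      and w: "\<omega> k = 0" "2 \<le> \<omega> i" and nh: "x \<notin> hit_set n bdry (?v \<omega>)" for a k i \<omega>
  proof -
    \<comment> \<open>The winding term: when the next arc is arc 0, its coordinates are seen one
      turn further, at \<open>x i + 1\<close>.\<close>
    define b :: int where "b = (if Suc a = N then 1 else 0)"
    have kn: "k < n" and "i < n" using k i by (auto simp: arc_def)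
    have xi: "(real a + 1) / N \<le> x i + b" "x i + b < (real a + 2) / N"
    proof -
      have "(real a + 1) / N \<le> x i + b \<and> x i + b < (real a + 2) / N"
      proof (cases "Suc a = N")
        case True
        then have "real N = real a + 1" by simp
        then show ?thesis using i True Npos by (auto simp: arc_def b_def field_simps)
      next
        case False
        then have "Suc a mod N = Suc a" using a by simp
        then show ?thesis using i False by (auto simp: arc_def b_def add_ac)
      qed
      then show "(real a + 1) / N \<le> x i + b" "x i + b < (real a + 2) / N" by auto
    qed
    have xk: "real a / N \<le> x k" "x k < (real a + 1) / N" using k by (auto simp: arc_def)
    \<comment> \<open>The time at which \<open>k\<close>, moving with speed \<open>2 / N\<close>,
      reaches \<open>x i + b\<close>. It is at most 1 because two consecutive arcs have total length
      \<open>2 / N\<close>.\<close>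
    define t where "t = (x i + b - x k) * N / 2"
    have "x i + b - x k > 0" using xi xk by linarith
    then have t0: "0 \<le> t" unfolding t_def using Npos by simp
    have "x i + b - x k \<le> 2 / N"
      using xi(2) xk(1) unfolding add_divide_distrib by linarith
    then have "(x i + b - x k) * N \<le> 2" using Npos by (simp add: field_simps)
    then have t1: "t \<le> 1" unfolding t_def by simp
    \<comment> \<open>One coordinate moves and the other rests, so they differ even for
      \<open>N = 1\<close>, when both arcs coincide.\<close>
    have ki: "k \<noteq> i" using w by auto
    have inn: "(\<lambda>l\<in>{..<n}. x l - real_of_int (z l) + t * ?v \<omega> l) \<in> inner" by (rule z[OF nh t0 t1])
    have "b - z k + z i = 0"
    proof (rule inner_coordinate_difference[OF inn kn \<open>i < n\<close> ki])
      have "t * (2 / N) = x i + b - x k" unfolding t_def using Npos by simp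
      then show "(\<lambda>l\<in>{..<n}. x l - real_of_int (z l) + t * ?v \<omega> l) k -
          (\<lambda>l\<in>{..<n}. x l - real_of_int (z l) + t * ?v \<omega> l) i = real_of_int (b - z k + z i)"
        using kn \<open>i < n\<close> w by (simp add: sign_of_def)
    qed
    then show ?thesis unfolding b_def by simp
  qed
  show False
  proof (rule circle_no_winding[OF N, of "arc n N x" z])
    fix a assume "a < N"
    then have "card (arc n N x a) > 0" using arcs[of a] m r by linarith
    then show "arc n N x a \<noteq> {}" by auto
  next
    fix a i j assume a: "a < N" and i: "i \<in> arc n N x (Suc a mod N)" and j: "j \<in> arc n N x (Suc a mod N)"
    have inn: "i < n" "j < n" using i j by (auto simp: arc_def)
    let ?Ei = "{\<omega> \<in> ?\<Omega>. \<omega> i < 2}" and ?Ej = "{\<omega> \<in> ?\<Omega>. \<omega> j < 2}"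
      and ?E0 = "{\<omega> \<in> ?\<Omega>. \<forall>k\<in>arc n N x a. \<omega> k \<noteq> 0}"
    have r2: "r \<ge> 2" and r1: "r \<ge> 1" using r by auto
    have cpos: "real (card ?\<Omega>) > 0" using r by (simp add: card_choices)
    have quarter: "2 / real r * card ?\<Omega> \<le> 1 / 8 * card ?\<Omega>"
      using r by (intro mult_right_mono) (auto simp: field_simps)
    have "(1 - 1 / real r) ^ card (arc n N x a) \<le> (1 - 1 / real r) ^ m"
      using arcs[OF a] r by (intro power_decreasing) auto
    also have "\<dots> \<le> exp (- (1 / real r)) ^ m"
      using r exp_ge_add_one_self[of "- (1 / real r)"] by (intro power_mono) auto
    also have "\<dots> = exp (- (real m / real r))" by (simp add: exp_of_nat_mult[symmetric])
    also have "\<dots> \<le> exp (- 2)"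
    proof -
      have "2 * real r \<le> real m" using m by (metis of_nat_le_iff of_nat_mult of_nat_numeral)
      then have "2 \<le> real m / real r" using r by (simp add: field_simps)
      then show ?thesis by simp
    qed
    also have "\<dots> \<le> 1 / 4"
    proof -
      have "2 \<le> exp (1 :: real)" using exp_ge_add_one_self[of 1] by simp
      then have "2 * 2 \<le> exp 1 * exp (1 :: real)" by (intro mult_mono) auto
      then have "4 \<le> exp (2 :: real)" by (simp add: exp_add[symmetric])
      then show ?thesis by (simp add: exp_minus field_simps)
    qed
    finally have "(1 - 1 / real r) ^ card (arc n N x a) * card ?\<Omega> \<le> 1 / 4 * card ?\<Omega>"
      by (intro mult_right_mono) auto
    then have c0: "real (card ?E0) \<le> 1 / 4 * card ?\<Omega>" using card_choices_avoid[OF r1 arc_n] by simp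
    have ci: "real (card ?Ei) \<le> 1 / 8 * card ?\<Omega>" "real (card ?Ej) \<le> 1 / 8 * card ?\<Omega>"
      using card_choices_small[OF r2 inn(1)] card_choices_small[OF r2 inn(2)] quarter by auto
    \<comment> \<open>The proportions 1/2, 1/8, 1/8 and 1/4 sum to 1, and the first bound is strict,
      so some choice avoids all four bad sets.\<close>
    have "card (Hit \<union> ?Ei \<union> ?Ej \<union> ?E0) \<le> card Hit + card ?Ei + card ?Ej + card ?E0"
      by (meson add_le_mono card_Un_le le_refl order_trans)
    then have "real (card (Hit \<union> ?Ei \<union> ?Ej \<union> ?E0)) < card ?\<Omega>"
      using half ci c0 by linarith
    then have "\<not> ?\<Omega> \<subseteq> Hit \<union> ?Ei \<union> ?Ej \<union> ?E0"
      using card_mono[of "Hit \<union> ?Ei \<union> ?Ej \<union> ?E0" ?\<Omega>] finite_choices unfolding Hit_def by fastforce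
    then obtain \<omega> k where w: "\<omega> \<in> ?\<Omega>" "\<omega> \<notin> Hit" "2 \<le> \<omega> i" "2 \<le> \<omega> j" "k \<in> arc n N x a" "\<omega> k = 0"
      by fastforce
    have nh: "x \<notin> hit_set n bdry (?v \<omega>)" using w(1,2) unfolding Hit_def by blast
    show "\<exists>k\<in>arc n N x a. z k = z i + (if Suc a = N then 1 else 0) \<and> z k = z j + (if Suc a = N then 1 else 0)"
      using collide[OF a w(5) i w(6) w(3) nh] collide[OF a w(5) j w(6) w(4) nh] w(5) by blast
  qed
qed

end

section \<open>The lower bound\<close>

text \<open>The factor of an exponential moment for a Chernoff bound: for a point of the unit cube,
  the product over the coordinates is 1/2 to the number of coordinates in arc
  \<open>a\<close>.\<close>

definition arc_weight :: "nat \<Rightarrow> nat \<Rightarrow> real \<Rightarrow> real" where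
  "arc_weight N a t = indicator {0..<1} t * (if real a / N \<le> t \<and> t < (real a + 1) / N then 1 / 2 else 1)"

lemma arc_weight_measurable [measurable]: "arc_weight N a \<in> borel_measurable borel"
  unfolding arc_weight_def by measurable

lemma nn_integral_arc_weight:
  assumes a: "a < N"
  shows "(\<integral>\<^sup>+t. ennreal (arc_weight N a t) \<partial>lborel) = ennreal (1 - 1 / (2 * real N))"
proof -
  define p q where "p = real a / N" and "q = (real a + 1) / N"
  have N: "real N > 0" using a by simp
  have p0: "0 \<le> p" and pq: "p \<le> q" using N by (simp_all add: p_def q_def divide_right_mono)
  have q1: "q \<le> 1" using a N by (simp add: q_def divide_le_eq_1)
  have "ennreal (arc_weight N a t) = indicator {0..<p} t + (ennreal (1 / 2) * indicator {p..<q} t + indicator {q..<1} t)" for t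
  proof -
    consider "t < 0" | "0 \<le> t" "t < p" | "p \<le> t" "t < q" | "q \<le> t" "t < 1" | "1 \<le> t" by linarith
    then show ?thesis
      using p0 pq q1 by cases (auto simp: arc_weight_def indicator_def p_def[symmetric] q_def[symmetric])
  qed
  then have "(\<integral>\<^sup>+t. ennreal (arc_weight N a t) \<partial>lborel) =
      (\<integral>\<^sup>+t. indicator {0..<p} t + (ennreal (1 / 2) * indicator {p..<q} t + indicator {q..<1} t) \<partial>lborel)"
    by simp
  also have "\<dots> = emeasure lborel {0..<p} + (ennreal (1 / 2) * emeasure lborel {p..<q} + emeasure lborel {q..<1})"
    by (simp add: nn_integral_add nn_integral_cmult)
  also have "\<dots> = ennreal p + (ennreal (1 / 2) * ennreal (q - p) + ennreal (1 - q))"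
    using p0 pq q1 by simp
  also have "\<dots> = ennreal (p + (1 / 2 * (q - p) + (1 - q)))"
    using p0 pq q1
    by (subst ennreal_mult[symmetric], simp, simp, subst ennreal_plus[symmetric], simp, simp,
        subst ennreal_plus[symmetric]) auto
  also have "p + (1 / 2 * (q - p) + (1 - q)) = 1 - 1 / (2 * real N)"
    using N by (simp add: p_def q_def field_simps)
  finally show ?thesis .
qed

lemma nn_integral_prod_arc_weight_le:
  assumes a: "a < N"
  shows "(\<integral>\<^sup>+x. (\<Prod>k<n. ennreal (arc_weight N a (x k))) \<partial>eucl_lebesgue n) \<le> ennreal (exp (- (real n / (2 * real N))))"
proof -
  have N: "real N \<ge> 1" using a by simp
  have "(\<integral>\<^sup>+x. (\<Prod>k<n. ennreal (arc_weight N a (x k))) \<partial>eucl_lebesgue n) =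
      (\<Prod>k<n. \<integral>\<^sup>+t. ennreal (arc_weight N a t) \<partial>lborel)"
    by (rule lb.product_nn_integral_prod) auto
  also have "\<dots> = ennreal ((1 - 1 / (2 * real N)) ^ n)"
    unfolding nn_integral_arc_weight[OF a] using N by (simp add: ennreal_power)
  also have "\<dots> \<le> ennreal (exp (- (1 / (2 * real N))) ^ n)"
    using N exp_ge_add_one_self[of "- (1 / (2 * real N))"] by (intro ennreal_leI power_mono) auto
  also have "exp (- (1 / (2 * real N))) ^ n = exp (- (real n / (2 * real N)))"
    by (simp add: exp_of_nat_mult[symmetric])
  finally show ?thesis .
qed

section \<open>Averaging over the unit cube\<close>

context symmetric_tiling
begin

text \<open>If all arcs are well filled, at least half of the choices hit and the first sum is large
  enough. Otherwise some arc has fewer than \<open>m\<close> coordinates and its weight, multiplied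
  by \<open>2 ^ m\<close>, is at least 1. As a pointwise form of Markov's inequality it can be
  integrated directly.\<close>

lemma one_le_hits_plus_arc_deviation:
  fixes N r m :: nat
  assumes x: "x \<in> unit_cube n" and N: "N \<ge> 1" and r: "r \<ge> 16" and m: "m \<ge> 2 * r"
  shows "1 \<le> ennreal (2 / card (choices n r)) *
      (\<Sum>\<omega>\<in>choices n r. indicator (hit_set n bdry (\<lambda>i. 2 / N * sign_of (\<omega> i)) \<inter> unit_cube n) x) +
    (\<Sum>a<N. ennreal (2 ^ m) * (\<Prod>k<n. ennreal (arc_weight N a (x k))))"
    (is "_ \<le> ?H + ?T")
proof (cases "\<forall>a<N. card (arc n N x a) \<ge> m")
  case True
  let ?hit = "\<lambda>\<omega>. hit_set n bdry (\<lambda>i. 2 / N * sign_of (\<omega> i))"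
  have cpos: "real (card (choices n r)) > 0" using r by (simp add: card_choices)
  have "card (choices n r) \<le> 2 * card {\<omega> \<in> choices n r. x \<in> ?hit \<omega>}"
    using half_of_choices_hit[OF x N r m] True by blast
  then have "real (card (choices n r)) \<le> 2 * real (card {\<omega> \<in> choices n r. x \<in> ?hit \<omega>})"
    by linarith
  then have "1 \<le> 2 / card (choices n r) * real (card {\<omega> \<in> choices n r. x \<in> ?hit \<omega>})"
    using cpos by (simp add: field_simps)
  then have "1 \<le> ennreal (2 / card (choices n r) * real (card {\<omega> \<in> choices n r. x \<in> ?hit \<omega>}))"
    by (rule order_trans[OF eq_refl[OF ennreal_1[symmetric]] ennreal_leI])
  also have "\<dots> = ennreal (2 / card (choices n r)) * of_nat (card {\<omega> \<in> choices n r. x \<in> ?hit \<omega>})"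
    by (subst ennreal_mult'') (auto simp: ennreal_of_nat_eq_real_of_nat)
  also have "of_nat (card {\<omega> \<in> choices n r. x \<in> ?hit \<omega>}) = (\<Sum>\<omega>\<in>choices n r. indicator (?hit \<omega> \<inter> unit_cube n) x :: ennreal)"
  proof -
    have "(\<Sum>\<omega>\<in>choices n r. indicator (?hit \<omega> \<inter> unit_cube n) x :: ennreal) =
        (\<Sum>\<omega>\<in>choices n r. if x \<in> ?hit \<omega> then 1 else 0)"
      using x by (intro sum.cong) (auto simp: indicator_def)
    also have "\<dots> = of_nat (card {\<omega> \<in> choices n r. x \<in> ?hit \<omega>})"
      by (subst sum.inter_filter[symmetric]) (auto simp: finite_choices)
    finally show ?thesis by simp
  qed
  finally show ?thesis by (rule order_trans) (simp add: add_increasing2)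
next
  case False
  then obtain a where a: "a < N" "card (arc n N x a) < m" by auto
  have "arc_weight N a (x k) = (if k \<in> arc n N x a then 1 / 2 else 1)" if "k < n" for k
  proof -
    have "x k \<in> {0..<1}" using x that unfolding unit_cube_def by blast
    then show ?thesis using that by (simp add: arc_weight_def arc_def)
  qed
  then have "(\<Prod>k<n. ennreal (arc_weight N a (x k))) = (\<Prod>k<n. ennreal (if k \<in> arc n N x a then 1 / 2 else 1))"
    by (intro prod.cong) auto
  also have "\<dots> = ennreal (\<Prod>k<n. if k \<in> arc n N x a then 1 / 2 else 1)"
    by (rule prod_ennreal) auto
  also have "(\<Prod>k<n. if k \<in> arc n N x a then 1 / 2 else 1) = (1 / 2 :: real) ^ card (arc n N x a)"
  proof -
    have "{..<n} \<inter> arc n N x a = arc n N x a" unfolding arc_def by auto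
    then show ?thesis by (subst prod.inter_restrict[symmetric]) auto
  qed
  finally have eq: "(\<Prod>k<n. ennreal (arc_weight N a (x k))) = ennreal ((1 / 2) ^ card (arc n N x a))" .
  have "(1 :: real) = 2 ^ m * (1 / 2) ^ m" by (simp add: power_mult_distrib[symmetric])
  also have "\<dots> \<le> 2 ^ m * (1 / 2) ^ card (arc n N x a)"
    using a(2) by (intro mult_left_mono power_decreasing) auto
  finally have "1 \<le> ennreal (2 ^ m * (1 / 2) ^ card (arc n N x a))"
    by (rule order_trans[OF eq_refl[OF ennreal_1[symmetric]] ennreal_leI])
  also have "\<dots> = ennreal (2 ^ m) * (\<Prod>k<n. ennreal (arc_weight N a (x k)))"
    unfolding eq by (rule ennreal_mult) auto
  also have "\<dots> \<le> ?T" using a(1) by (intro member_le_sum) auto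
  finally show ?thesis by (rule order_trans) (simp add: add_increasing)
qed

text \<open>Integrating the pointwise inequality bounds 1 by twice the mean prism volume, at most
  \<open>2 * s * sqrt (2 / r) * A\<close>, plus the deviation term, at most 1/2 by
  \<open>dev\<close>. Inserting \<open>s = 2 / N\<close> gives the constant 8.\<close>

lemma surface_area_ge:
  fixes N r m :: nat
  assumes n: "n \<ge> 1" and A: "has_surface_area n bdry A"
    and N: "N \<ge> 1" and r: "r \<ge> 16" and m: "m \<ge> 2 * r"
    and dev: "real N * (2 ^ m * exp (- (real n / (2 * real N)))) \<le> 1 / 2"
  shows "real N \<le> 8 * sqrt (2 / r) * A"
proof -
  let ?\<mu> = "eucl_lebesgue n" and ?\<Omega> = "choices n r"
  define s where "s = 2 / real N"
  define v where "v = (\<lambda>(\<omega> :: nat \<Rightarrow> nat) i. s * sign_of (\<omega> i))"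
  have s: "s > 0" using N by (simp add: s_def)
  have cpos: "real (card ?\<Omega>) > 0" using r by (simp add: card_choices)
  have A0: "A \<ge> 0"
    by (rule sum_emeasure_prism_surface_le(2)[OF n A, of "{} :: nat set" "\<lambda>_ _. 0" 0]) auto
  have "(\<Sum>\<omega>\<in>?\<Omega>. emeasure ?\<mu> (prism n (v \<omega>) bdry)) \<le> ennreal (sqrt (card ?\<Omega> * (2 / r * card ?\<Omega> * s\<^sup>2)) * A)"
    by (rule sum_emeasure_prism_surface_le(1)[OF n A finite_choices])
      (use sum_choices_inner_product_sq[where r = r and n = n and s = s] r in \<open>simp add: v_def\<close>)
  also have "sqrt (card ?\<Omega> * (2 / r * card ?\<Omega> * s\<^sup>2)) = card ?\<Omega> * s * sqrt (2 / r)"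
  proof -
    \<comment> \<open>Per choice, what remains is \<open>s * sqrt (2 / r)\<close>, the standard
      deviation of a coordinate of \<open>v\<close>.\<close>
    have "card ?\<Omega> * (2 / r * card ?\<Omega> * s\<^sup>2) = (card ?\<Omega> * s)\<^sup>2 * (2 / r)"
      by (simp add: power2_eq_square mult_ac)
    moreover have "card ?\<Omega> * s \<ge> 0" using s by simp
    ultimately show ?thesis by (simp only: real_sqrt_mult real_sqrt_abs abs_of_nonneg)
  qed
  finally have prisms: "(\<Sum>\<omega>\<in>?\<Omega>. emeasure ?\<mu> (prism n (v \<omega>) bdry)) \<le> ennreal (card ?\<Omega> * s * sqrt (2 / r) * A)" .
  have hm: "hit_set n bdry (v \<omega>) \<inter> unit_cube n \<in> sets ?\<mu>" for \<omega>
    by (intro sets.Int sets_hit_set[OF compact_bdry] sets_unit_cube)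
  have pm: "(\<lambda>x. \<Prod>k<n. ennreal (arc_weight N a (x k))) \<in> borel_measurable ?\<mu>" for a
    by measurable
  have "1 = (\<integral>\<^sup>+x. indicator (unit_cube n) x \<partial>?\<mu>)"
    using sets_unit_cube[of n] by (simp add: emeasure_unit_cube)
  also have "\<dots> \<le> (\<integral>\<^sup>+x. ennreal (2 / card ?\<Omega>) * (\<Sum>\<omega>\<in>?\<Omega>. indicator (hit_set n bdry (v \<omega>) \<inter> unit_cube n) x) +
      (\<Sum>a<N. ennreal (2 ^ m) * (\<Prod>k<n. ennreal (arc_weight N a (x k)))) \<partial>?\<mu>)"
  proof (rule nn_integral_mono)
    fix x
    show "indicator (unit_cube n) x \<le> ennreal (2 / card ?\<Omega>) * (\<Sum>\<omega>\<in>?\<Omega>. indicator (hit_set n bdry (v \<omega>) \<inter> unit_cube n) x) +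
      (\<Sum>a<N. ennreal (2 ^ m) * (\<Prod>k<n. ennreal (arc_weight N a (x k))))"
      using one_le_hits_plus_arc_deviation[OF _ N r m, of x]
      by (cases "x \<in> unit_cube n") (simp_all add: v_def s_def)
  qed
  also have "\<dots> = ennreal (2 / card ?\<Omega>) * (\<Sum>\<omega>\<in>?\<Omega>. emeasure ?\<mu> (hit_set n bdry (v \<omega>) \<inter> unit_cube n)) +
      (\<Sum>a<N. ennreal (2 ^ m) * (\<integral>\<^sup>+x. (\<Prod>k<n. ennreal (arc_weight N a (x k))) \<partial>?\<mu>))"
    using hm pm by (simp add: nn_integral_add nn_integral_cmult nn_integral_sum)
  also have "\<dots> \<le> ennreal (2 / card ?\<Omega>) * (\<Sum>\<omega>\<in>?\<Omega>. emeasure ?\<mu> (prism n (v \<omega>) bdry)) +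
      (\<Sum>a<N. ennreal (2 ^ m) * ennreal (exp (- (real n / (2 * real N)))))"
    by (intro add_mono mult_left_mono sum_mono emeasure_hit_set_le compact_bdry nn_integral_prod_arc_weight_le) auto
  also have "\<dots> \<le> ennreal (2 / card ?\<Omega>) * ennreal (card ?\<Omega> * s * sqrt (2 / r) * A) +
      (\<Sum>a<N. ennreal (2 ^ m * exp (- (real n / (2 * real N)))))"
    by (intro add_mono mult_left_mono prisms sum_mono) (auto simp: ennreal_mult)
  also have "\<dots> = ennreal (2 / card ?\<Omega> * (card ?\<Omega> * s * sqrt (2 / r) * A) + real N * (2 ^ m * exp (- (real n / (2 * real N)))))"
    using s A0 by (simp add: ennreal_mult[symmetric] ennreal_of_nat_eq_real_of_nat)
  also have "2 / card ?\<Omega> * (card ?\<Omega> * s * sqrt (2 / r) * A) = 2 * s * sqrt (2 / r) * A"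
    using cpos by simp
  finally have "1 \<le> 2 * s * sqrt (2 / r) * A + real N * (2 ^ m * exp (- (real n / (2 * real N))))"
    by (simp only: ennreal_ge_1)
  then have "1 / 2 \<le> 2 * s * sqrt (2 / r) * A" using dev by linarith
  then have "1 / 2 * real N \<le> 2 * s * sqrt (2 / r) * A * real N" by (intro mult_right_mono) auto
  also have "\<dots> = 4 * sqrt (2 / r) * A" using N by (simp add: s_def)
  finally show ?thesis by simp
qed

end

text \<open>
  With \<open>L\<close> about \<open>ln n\<close>, the choice \<open>r = L\<close>, \<open>m = 2 * L\<close> and arcs of length about \<open>8 * L / n\<close> makes the
  expected number of arcs with fewer than \<open>m\<close> coordinates at most \<open>1 / n\<close>.
\<close>

lemma symmetric_tiling_area_large:
  assumes T: "symmetric_tiling n D" and A: "has_surface_area n (eucl n frontier_of D) A"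
    and n: "ln (real n) \<ge> 16"
  shows "A \<ge> 1 / 256 * (real n / sqrt (ln (real n)))"
proof -
  interpret symmetric_tiling n D by (rule T)
  define l where "l = ln (real n)"
  define L where "L = nat \<lceil>l\<rceil>"
  have l16: "l \<ge> 16" using n by (simp add: l_def)
  have npos: "real n > 0"
  proof (rule ccontr)
    assume "\<not> real n > 0"
    then have "n = 0" by simp
    then show False using l16 by (simp add: l_def)
  qed
  have L: "l \<le> real L" "real L \<le> l + 1" using l16 unfolding L_def by linarith+
  have L16: "L \<ge> 16" using L(1) l16 by linarith
  have expl: "exp l = real n" using npos by (simp add: l_def)
  \<comment> \<open>The quadratic term is at least \<open>8 * l\<close>, which makes
    \<open>n\<close> large enough for \<open>N \<ge> 1\<close>.\<close>
  have "1 + l + l\<^sup>2 / 2 \<le> exp l" using l16 by (intro exp_lower_Taylor_quadratic) simp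
  moreover have "16 * l \<le> l\<^sup>2" using l16 by (simp add: power2_eq_square mult_right_mono)
  ultimately have n8: "8 * real L \<le> real n" using L(2) l16 expl by linarith
  define N where "N = n div (8 * L)"
  have "8 * L \<le> n" using n8 by linarith
  then have N1: "N \<ge> 1" using L16 unfolding N_def by (simp add: div_greater_zero_iff Suc_le_eq)
  have Nup: "real N * (8 * real L) \<le> real n"
  proof -
    have "N * (8 * L) \<le> n" unfolding N_def by simp
    then show ?thesis by (metis of_nat_le_iff of_nat_mult of_nat_numeral)
  qed
  \<comment> \<open>Rounding down in \<open>N\<close> costs at most a factor 2, because
    \<open>N \<ge> 1\<close>.\<close>
  have Nlow: "real n \<le> 16 * real L * real N"
  proof -
    have "n mod (8 * L) < 8 * L" using L16 by simp
    moreover have "n = N * (8 * L) + n mod (8 * L)" unfolding N_def by (simp only: div_mult_mod_eq)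
    ultimately have "n \<le> N * (8 * L) + 8 * L" by linarith
    also have "\<dots> \<le> N * (8 * L) + N * (8 * L)" using N1 by simp
    finally have "n \<le> 16 * L * N" by simp
    then show ?thesis by (metis of_nat_le_iff of_nat_mult of_nat_numeral)
  qed
  \<comment> \<open>An arc holds at least \<open>8 * L\<close> coordinates on average, so the
    exponent \<open>n / (2 * N)\<close> is at least \<open>4 * L\<close>. This beats
    \<open>2 ^ (2 * L) \<le> exp (2 * L)\<close> and leaves
    \<open>exp (- 2 * L) \<le> 1 / n\<^sup>2\<close>, enough to sum over \<open>N \<le> n\<close>
    arcs.\<close>
  have dev: "real N * (2 ^ (2 * L) * exp (- (real n / (2 * real N)))) \<le> 1 / 2"
  proof -
    have "4 * real L \<le> real n / (2 * real N)" using Nup N1 by (simp add: field_simps)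
    then have e1: "exp (- (real n / (2 * real N))) \<le> exp (- (4 * real L))" by simp
    have "2 \<le> exp (1 :: real)" using exp_ge_add_one_self[of 1] by simp
    then have "(2 :: real) ^ (2 * L) \<le> exp 1 ^ (2 * L)" by (intro power_mono) auto
    also have "\<dots> = exp (2 * real L)" by (simp add: exp_of_nat_mult[symmetric])
    finally have e2: "(2 :: real) ^ (2 * L) \<le> exp (2 * real L)" .
    have "(2 :: real) ^ (2 * L) * exp (- (real n / (2 * real N))) \<le> exp (2 * real L) * exp (- (4 * real L))"
      using e1 e2 by (intro mult_mono) auto
    also have "\<dots> = exp (- (2 * real L))" by (simp add: exp_add[symmetric])
    also have "\<dots> \<le> exp (- (2 * l))" using L(1) by simp
    also have "\<dots> = 1 / (real n * real n)"
      using expl by (simp add: exp_minus exp_double power2_eq_square divide_inverse)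
    finally have "real N * (2 ^ (2 * L) * exp (- (real n / (2 * real N)))) \<le> real N * (1 / (real n * real n))"
      by (intro mult_left_mono) auto
    also have "\<dots> \<le> real n * (1 / (real n * real n))"
      by (intro mult_right_mono) (auto simp: N_def)
    also have "\<dots> = 1 / real n" using npos by simp
    also have "\<dots> \<le> 1 / 2" using n8 L16 by (simp add: field_simps)
    finally show ?thesis .
  qed
  have A0: "A \<ge> 0"
    by (rule sum_emeasure_prism_surface_le(2)[OF _ A, of "{} :: nat set" "\<lambda>_ _. 0" 0]) (use npos in auto)
  have "real N \<le> 8 * sqrt (2 / real L) * A"
    by (rule surface_area_ge[OF _ A N1 L16 _ dev]) (use npos in auto)
  \<comment> \<open>Multiplying by \<open>16 * L\<close> turns the left side into a bound for
    \<open>n\<close>. The constant is 256 = 16 * 8 * 2, the last factor from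
    \<open>sqrt (2 * L) \<le> 2 * sqrt l\<close>.\<close>
  then have "16 * real L * real N \<le> 16 * real L * (8 * sqrt (2 / real L) * A)"
    by (rule mult_left_mono) simp
  also have "\<dots> = 128 * sqrt (2 * real L) * A"
  proof -
    have "real L * sqrt (2 / real L) = sqrt (2 * real L)"
      using L16 by (simp add: real_sqrt_divide real_sqrt_mult real_div_sqrt field_simps)
    then show ?thesis by (simp add: mult_ac)
  qed
  also have "\<dots> \<le> 128 * (2 * sqrt l) * A"
  proof -
    have "sqrt (2 * real L) \<le> sqrt (4 * l)" using L(2) l16 by simp
    also have "\<dots> = 2 * sqrt l" by (simp add: real_sqrt_mult)
    finally show ?thesis using A0 by (intro mult_right_mono mult_left_mono) auto
  qed
  finally have "real n \<le> 256 * sqrt l * A" using Nlow by linarith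
  moreover have "sqrt l > 0" using l16 by simp
  ultimately show ?thesis unfolding l_def[symmetric] by (simp add: field_simps)
qed

theorem theorem1p3:
  "\<exists>c::real. c > 0 \<and>
     (\<forall>(n::nat) (D::(nat \<Rightarrow> real) set) (A::real).
        n \<ge> 2 \<longrightarrow> tiling_body n D \<longrightarrow> symmetric_set n D \<longrightarrow>
        measure (eucl_lebesgue n) D = 1 \<longrightarrow>
        has_surface_area n (eucl n frontier_of D) A \<longrightarrow>
        A \<ge> c * (real n / sqrt (ln (real n))))"
proof (intro exI[of _ "min (1 / 256) (sqrt (ln 2) / (2 * exp 16))"] conjI allI impI)
  show "min (1 / 256) (sqrt (ln 2) / (2 * exp 16)) > (0 :: real)" by simp
  fix n D A
  assume n: "(n :: nat) \<ge> 2" and "tiling_body n D" "symmetric_set n D"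
    and A: "has_surface_area n (eucl n frontier_of D) A"
  then have T: "symmetric_tiling n D" by unfold_locales
  let ?R = "real n / sqrt (ln (real n))"
  have R0: "?R \<ge> 0" using n by simp
  show "min (1 / 256) (sqrt (ln 2) / (2 * exp 16)) * ?R \<le> A"
  proof (cases "ln (real n) \<ge> 16")
    case True
    have "min (1 / 256) (sqrt (ln 2) / (2 * exp 16)) * ?R \<le> 1 / 256 * ?R"
      by (intro mult_right_mono R0) simp
    also have "\<dots> \<le> A" by (rule symmetric_tiling_area_large[OF T A True])
    finally show ?thesis .
  next
    case False
    \<comment> \<open>In this range \<open>?R\<close> is at most
      \<open>exp 16 / sqrt (ln 2)\<close>; the second entry of the minimum scales this to 1/2, the
      bound of \<open>surface_area_ge_half\<close>.\<close>
    have "real n \<le> exp 16" using False n by (metis exp_le_cancel_iff exp_ln less_eq_real_def not_le of_nat_0_less_iff pos2 order_less_le_trans)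
    have ln2: "ln 2 \<le> ln (real n)" "ln 2 > (0 :: real)" using n by auto
    have "min (1 / 256) (sqrt (ln 2) / (2 * exp 16)) * ?R \<le> sqrt (ln 2) / (2 * exp 16) * ?R"
      by (intro mult_right_mono R0) simp
    also have "\<dots> \<le> sqrt (ln 2) / (2 * exp 16) * (exp 16 / sqrt (ln 2))"
      using \<open>real n \<le> exp 16\<close> ln2 by (intro mult_left_mono frac_le) auto
    also have "\<dots> = 1 / 2" using ln2 by simp
    also have "\<dots> \<le> A" by (rule symmetric_tiling.surface_area_ge_half[OF T n A])
    finally show ?thesis .
  qed
qed

end
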